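(* Let $\alpha\in(1,2)$, let $L^{(\alpha)}$ be the strictly $\alpha$-stable Lévy process without negative jumps, starting from one, normalized as in the context, let $T=\inf\{t>0:\ L^{(\alpha)}_t=0\}$ and $\mathcal{A}_\alpha=\int_0^T L^{(\alpha)}_s\,ds$. Then $$\mathcal{A}_\alpha\ \stackrel{d}{=}\ \left(\frac{\alpha+1}{4}\right)\times \mathbf{Z}_{\frac{2}{\alpha+1}}^{\,2}\times \mathbf{B}_{\frac12,\frac{\alpha-1}{2(\alpha+1)}}^{-1},$$ where the random variables $\mathbf{Z}_{\frac{2}{\alpha+1}}$ and $\mathbf{B}_{\frac12,\frac{\alpha-1}{2(\alpha+1)}}$ on the right-hand side are independent.
   Context: For $\alpha\in(1,2)$, $\{L^{(\alpha)}_t,\ t\ge 0\}$ denotes a strictly $\alpha$-stable Lévy process without negative jumps (spectrally positive), started from $L^{(\alpha)}_0=1$, with the normalization $\mathbb{E}[e^{-\lambda (L^{(\alpha)}_1-L^{(\alpha)}_0)}]=e^{\lambda^\alpha}$ for all $\lambda\ge 0$. For $a\in(0,1)$, $\mathbf{Z}_a$ denotes the positive $a$-stable random variable with Laplace transform $\mathbb{E}[e^{-\lambda \mathbf{Z}_a}]=e^{-\lambda^a}$, $\lambda\ge 0$. For $a,b>0$, $\mathbf{B}_{a,b}$ denotes the Beta random variable with density $\frac{\Gamma(a+b)}{\Gamma(a)\Gamma(b)}x^{a-1}(1-x)^{b-1}\mathbf{1}_{(0,1)}(x)$. The symbol $\stackrel{d}{=}$ denotes equality in law. *)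

theory Defs
  imports "HOL-Probability.Probability"
begin

definition eq_in_law :: "'a measure \<Rightarrow> ('a \<Rightarrow> real) \<Rightarrow> 'b measure \<Rightarrow> ('b \<Rightarrow> real) \<Rightarrow> bool" where
  "eq_in_law M X N Y \<longleftrightarrow>
     X \<in> borel_measurable M \<and> Y \<in> borel_measurable N \<and> distr M borel X = distr N borel Y"

text \<open>Paths and processes are indexed by \<^typ>\<open>real\<close>; only the times \<open>t \<ge> 0\<close> are ever constrained
  or used.\<close>

definition cadlag :: "(real \<Rightarrow> real) \<Rightarrow> bool" where
  "cadlag f \<longleftrightarrow>
     (\<forall>t\<ge>0. (f \<longlongrightarrow> f t) (at_right t)) \<and> (\<forall>t>0. \<exists>l. (f \<longlongrightarrow> l) (at_left t))"

definition no_negative_jumps :: "(real \<Rightarrow> real) \<Rightarrow> bool" where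
  "no_negative_jumps f \<longleftrightarrow> (\<forall>t>0. \<forall>l. (f \<longlongrightarrow> l) (at_left t) \<longrightarrow> l \<le> f t)"

definition levy_process :: "'a measure \<Rightarrow> (real \<Rightarrow> 'a \<Rightarrow> real) \<Rightarrow> real \<Rightarrow> bool" where
  "levy_process M L x \<longleftrightarrow>
     prob_space M \<and>
     (\<forall>t\<ge>0. L t \<in> borel_measurable M) \<and>
     (AE \<omega> in M. L 0 \<omega> = x) \<and>
     (\<forall>(n::nat) (t::nat \<Rightarrow> real). 0 \<le> t 0 \<and> (\<forall>i<n. t i < t (Suc i)) \<longrightarrow>
        prob_space.indep_vars M (\<lambda>_. borel) (\<lambda>i \<omega>. L (t (Suc i)) \<omega> - L (t i) \<omega>) {..<n}) \<and>
     (\<forall>s\<ge>0. \<forall>h\<ge>0. eq_in_law M (\<lambda>\<omega>. L (s + h) \<omega> - L s \<omega>) M (\<lambda>\<omega>. L h \<omega> - L 0 \<omega>)) \<and>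
     (AE \<omega> in M. cadlag (\<lambda>t. L t \<omega>))"

text \<open>For a process with stationary independent increments, equality of the one-dimensional
  marginals below is the same as equality of the finite-dimensional distributions.\<close>

definition strictly_stable :: "real \<Rightarrow> 'a measure \<Rightarrow> (real \<Rightarrow> 'a \<Rightarrow> real) \<Rightarrow> bool" where
  "strictly_stable \<alpha> M L \<longleftrightarrow>
     (\<forall>c>0. \<forall>t\<ge>0. eq_in_law M (\<lambda>\<omega>. L (c * t) \<omega> - L 0 \<omega>)
                            M (\<lambda>\<omega>. c powr (1 / \<alpha>) * (L t \<omega> - L 0 \<omega>)))"

text \<open>The exponential moment is a Bochner integral, which is 0 for non-integrable functions; since
  the right-hand side is positive, integrability is part of the condition.\<close>

definition spectrally_positive_stable_levy ::
    "real \<Rightarrow> 'a measure \<Rightarrow> (real \<Rightarrow> 'a \<Rightarrow> real) \<Rightarrow> real \<Rightarrow> bool" where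
  "spectrally_positive_stable_levy \<alpha> M L x \<longleftrightarrow>
     levy_process M L x \<and>
     strictly_stable \<alpha> M L \<and>
     (AE \<omega> in M. no_negative_jumps (\<lambda>t. L t \<omega>)) \<and>
     (\<forall>u\<ge>0. prob_space.expectation M (\<lambda>\<omega>. exp (- u * (L 1 \<omega> - L 0 \<omega>))) = exp (u powr \<alpha>))"

text \<open>The hitting time is \<open>\<infinity>\<close> for a path that never visits 0, which for the processes above has
  probability 0. A hitting time of a point by a cadlag process is in general measurable only for
  the completed sigma-algebra, so the law of the area is to be taken under the completion of the
  underlying probability measure.\<close>

definition hitting_time_zero :: "(real \<Rightarrow> real) \<Rightarrow> ereal" where
  "hitting_time_zero f = (INF t\<in>{t. t > 0 \<and> f t = 0}. ereal t)"

definition area_until_zero :: "(real \<Rightarrow> real) \<Rightarrow> real" where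
  "area_until_zero f = (LBINT s=0..hitting_time_zero f. f s)"

definition positive_stable_rv :: "real \<Rightarrow> 'b measure \<Rightarrow> ('b \<Rightarrow> real) \<Rightarrow> bool" where
  "positive_stable_rv a N Z \<longleftrightarrow>
     Z \<in> borel_measurable N \<and>
     (AE \<omega> in N. Z \<omega> > 0) \<and>
     (\<forall>u\<ge>0. prob_space.expectation N (\<lambda>\<omega>. exp (- u * Z \<omega>)) = exp (- (u powr a)))"

definition beta_density :: "real \<Rightarrow> real \<Rightarrow> real \<Rightarrow> real" where
  "beta_density a b x =
     Gamma (a + b) / (Gamma a * Gamma b) * x powr (a - 1) * (1 - x) powr (b - 1)
       * indicator {0<..<1} x"

definition beta_rv :: "real \<Rightarrow> real \<Rightarrow> 'b measure \<Rightarrow> ('b \<Rightarrow> real) \<Rightarrow> bool" where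
  "beta_rv a b N B \<longleftrightarrow> distributed N lborel B (\<lambda>x. ennreal (beta_density a b x))"

end

theory Submission imports Defs "HOL-Complex_Analysis.Complex_Analysis"
begin

text \<open>Let \<open>h\<^sub>q(x) = Re (\<integral>\<^sub>0\<^sup>\<infinity> exp (-\<i> y x + (\<i> y)\<^sup>\<alpha>\<^sup>+\<^sup>1 / (q (\<alpha> + 1))) dy)\<close>. Integration by parts shows that the
  generator of \<open>L\<close> acts on \<open>h\<^sub>q\<close> as multiplication by \<open>q x\<close>, so that
  \<open>h\<^sub>q(L\<^sub>t) exp (-q \<integral>\<^sub>0\<^sup>t L)\<close> is a martingale. Integrating along the imaginary axis makes \<open>h\<^sub>q\<close> bounded
  on the whole line and involves only the characteristic function of \<open>L\<close>. Optional stopping is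
  carried out on dyadic grids of mesh \<open>d\<close>, where each step costs an error \<open>O(d\<^sup>2)\<close>. It gives
  \<open>E exp (-q A) = h\<^sub>q(1) / h\<^sub>q(0)\<close> for the area \<open>A\<close> up to the passage below 0; the same formula for the
  passage below \<open>\<epsilon> \<rightarrow> 0\<close> encloses the hitting time of 0.

  The negative moments of \<open>A\<close> are then Mellin transforms of \<open>h\<^sub>1\<close>, computed by Gamma integrals and the
  reflection formula, and they agree with those of the right-hand side by the duplication formula.
  Moments of orders in an open interval determine the law, by analytic continuation to the
  characteristic function of the logarithm under a tilted measure.\<close>

section \<open>Laplace transforms on a strip\<close>

text \<open>The integration by parts leaves a boundary term at \<open>y = 0\<close>. It is the
  purely imaginary number \<open>\<i> * q\<close>, so only the real part of the integral is an
  eigenfunction; this is the reason for Re in the definition. The absence of negative jumps is used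
  pathwise: a path cannot jump across 0, so at its passage below 0 the martingale has the
  deterministic value h(0), which can be divided out. Finiteness of the passage time is not
  presupposed. Late passage is controlled by the decay h(x) = O(1/|x|) together with the
  characteristic function of \<open>L\<close>, and almost sure passage then follows by letting q
  tend to 0. By scaling, the Laplace transform of the area at q = v^(\<alpha>+1) is h_1(v) / h_1(0);
  this is why a Mellin transform in the space variable yields moments of the area. Exponents w in
  (0,1) of the Mellin transform correspond to moments of order -w/(\<alpha>+1). Measurability of the
  area is not presupposed either: limits of grid functionals supply measurable versions, and the
  completion absorbs the null set.\<close>

lemma norm_exp_minus_1_le_exp:
  fixes w :: complex
  shows "norm (exp w - 1) \<le> norm w * exp (norm w)"
proof -
  have "norm (exp w - exp 0) \<le> exp (norm w) * norm (w - 0)"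
  proof (rule field_differentiable_bound[where S = "cball 0 (norm w)" and f' = exp])
    show "norm (exp z) \<le> exp (norm w)" if "z \<in> cball 0 (norm w)" for z :: complex
      using norm_exp[of z] that by (simp add: order_trans)
  qed (auto intro!: DERIV_subset[OF DERIV_exp])
  then show ?thesis by (simp add: mult.commute)
qed

lemma norm_exp_minus_1_le:
  fixes w :: complex
  assumes "Re w \<le> 0"
  shows "norm (exp w - 1) \<le> norm w"
proof -
  have "norm (exp w - exp 0) \<le> 1 * norm (w - 0)"
    by (rule field_differentiable_bound[where S = "{z. Re z \<le> 0}" and f' = exp])
       (use assms in \<open>auto intro!: DERIV_subset[OF DERIV_exp] convex_halfspace_Re_le\<close>)
  then show ?thesis by simp
qed

text \<open>Mean value inequality for exp z - z, whose derivative exp z - 1 is bounded by the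
  previous lemma. That no exponential factor appears in the left half-plane is what later gives a
  clean quadratic error per grid step.\<close>

lemma norm_exp_minus_1_minus_le:
  fixes w :: complex
  assumes "Re w \<le> 0"
  shows "norm (exp w - 1 - w) \<le> (norm w)\<^sup>2"
proof -
  let ?S = "{z. Re z \<le> 0} \<inter> cball 0 (norm w)"
  have "norm ((exp w - w) - (exp 0 - 0)) \<le> norm w * norm (w - 0)"
  proof (rule field_differentiable_bound[where S = ?S and f' = "\<lambda>z. exp z - 1"])
    show "convex ?S" by (intro convex_Int convex_halfspace_Re_le) auto
    show "norm (exp z - 1) \<le> norm w" if "z \<in> ?S" for z
      using norm_exp_minus_1_le[of z] that by auto
  qed (use assms in \<open>auto intro!: derivative_eq_intros\<close>)
  then show ?thesis by (simp add: power2_eq_square algebra_simps)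
qed

text \<open>The quotient costs a factor \<open>\<bar>x\<bar> * exp (norm k * \<bar>x\<bar>)\<close>.
  Half of the radius \<open>d\<close> absorbs the exponential and the other half the factor
  \<open>\<bar>x\<bar>\<close>, so a total of \<open>exp (d * \<bar>x\<bar>)\<close> suffices. The
  bound consists of the transform's integrand at the two real points \<open>Re z + d\<close> and
  \<open>Re z - d\<close>, hence is integrable when both lie in the interval of convergence.\<close>

lemma norm_exp_difference_quotient_le:
  fixes z k :: complex and x d :: real
  assumes d: "d > 0" and k: "norm k < d / 2" "k \<noteq> 0"
  shows "norm ((exp (-((z + k) * of_real x)) - exp (-(z * of_real x))) / k)
           \<le> 2 / d * (exp (-((Re z + d) * x)) + exp (-((Re z - d) * x)))"
proof -
  have "exp (-((z + k) * of_real x)) - exp (-(z * of_real x)) =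
      exp (-(z * of_real x)) * (exp (-(k * of_real x)) - 1)"
    by (simp add: algebra_simps flip: exp_add)
  then have "norm ((exp (-((z + k) * of_real x)) - exp (-(z * of_real x))) / k) =
      exp (-(Re z * x)) * norm (exp (-(k * of_real x)) - 1) / norm k"
    by (simp add: norm_mult norm_divide)
  also have "\<dots> \<le> exp (-(Re z * x)) * (norm (-(k * of_real x)) * exp (norm (-(k * of_real x)))) / norm k"
    by (intro divide_right_mono mult_left_mono norm_exp_minus_1_le_exp) auto
  also have "\<dots> = exp (-(Re z * x)) * (\<bar>x\<bar> * exp (norm k * \<bar>x\<bar>))"
    using k by (simp add: norm_mult)
  also have "\<dots> \<le> exp (-(Re z * x)) * ((2 / d * exp (d / 2 * \<bar>x\<bar>)) * exp (d / 2 * \<bar>x\<bar>))"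
  proof (intro mult_left_mono mult_mono)
    have "d / 2 * \<bar>x\<bar> \<le> exp (d / 2 * \<bar>x\<bar>)"
      using exp_ge_add_one_self[of "d / 2 * \<bar>x\<bar>"] by linarith
    then show "\<bar>x\<bar> \<le> 2 / d * exp (d / 2 * \<bar>x\<bar>)"
      using d by (simp add: field_simps)
    show "exp (norm k * \<bar>x\<bar>) \<le> exp (d / 2 * \<bar>x\<bar>)"
      unfolding exp_le_cancel_iff by (rule mult_right_mono) (use k in auto)
  qed (use d in auto)
  also have "\<dots> = 2 / d * exp (-(Re z * x) + d * \<bar>x\<bar>)"
    by (simp flip: exp_add)
  also have "\<dots> \<le> 2 / d * (exp (-((Re z + d) * x)) + exp (-((Re z - d) * x)))"
    by (rule mult_left_mono) (use d in \<open>auto simp: abs_if algebra_simps\<close>)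
  finally show ?thesis .
qed

lemma
  fixes X :: "'a \<Rightarrow> real" and I :: "real set"
  assumes X[measurable]: "X \<in> borel_measurable M"
    and int: "\<And>u. u \<in> I \<Longrightarrow> integrable M (\<lambda>w. exp (-(u * X w)))"
  shows integrable_complex_laplace:
      "Re z \<in> I \<Longrightarrow> integrable M (\<lambda>w. exp (-(z * of_real (X w))) :: complex)"
    and holomorphic_laplace:
      "open I \<Longrightarrow> (\<lambda>z. \<integral>w. exp (-(z * of_real (X w))) \<partial>M) holomorphic_on {z. Re z \<in> I}"
proof -
  show *: "integrable M (\<lambda>w. exp (-(z * of_real (X w))) :: complex)" if "Re z \<in> I" for z
    by (rule Bochner_Integration.integrable_bound[OF int[OF that]]) (auto intro!: AE_I2)
  assume I: "open I"
  define f where "f = (\<lambda>z. \<integral>w. exp (-(z * of_real (X w))) \<partial>M :: complex)"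
  have "\<exists>D. (f has_field_derivative D) (at z)" if z: "Re z \<in> I" for z
  proof -
    obtain e where e: "e > 0" "cball (Re z) e \<subseteq> I"
      using I z open_contains_cball by blast
    have in_I: "u \<in> I" if "\<bar>u - Re z\<bar> \<le> e" for u
      using e that by (auto simp: dist_real_def subset_iff abs_minus_commute)
    define D where "D = (\<integral>w. - of_real (X w) * exp (-(z * of_real (X w))) \<partial>M :: complex)"
    have "(\<lambda>h. (f (z + h) - f z) / h) \<midarrow>0\<rightarrow> D"
      unfolding tendsto_at_iff_sequentially
    proof (intro allI impI)
      fix s :: "nat \<Rightarrow> complex"
      assume s: "\<forall>i. s i \<in> UNIV - {0}" "s \<longlonglongrightarrow> 0"
      \<comment> \<open>Dropping the first \<open>N\<close> terms makes the domination valid for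
        every term of the remaining sequence.\<close>
      obtain N where N: "\<And>n. n \<ge> N \<Longrightarrow> norm (s n) < e / 2"
        using s(2) e(1) unfolding LIMSEQ_iff by (metis diff_zero half_gt_zero)
      let ?Q = "\<lambda>n w. (exp (-((z + s (n + N)) * of_real (X w))) - exp (-(z * of_real (X w)))) / s (n + N)"
      have "(\<lambda>n. \<integral>w. ?Q n w \<partial>M)
          \<longlonglongrightarrow> D"
        unfolding D_def
      proof (rule integral_dominated_convergence
          [where w = "\<lambda>w. 2 / e * (exp (-((Re z + e) * X w)) + exp (-((Re z - e) * X w)))"])
        show "integrable M (\<lambda>w. 2 / e * (exp (-((Re z + e) * X w)) + exp (-((Re z - e) * X w))))"
          using e(1) by (intro integrable_mult_right Bochner_Integration.integrable_add int in_I) auto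
        show "AE w in M. (\<lambda>n. ?Q n w)
            \<longlonglongrightarrow> - of_real (X w) * exp (-(z * of_real (X w)))"
        proof (intro AE_I2)
          fix w
          have "((\<lambda>z. exp (-(z * of_real (X w)))) has_field_derivative
              - of_real (X w) * exp (-(z * of_real (X w)))) (at z)"
            by (auto intro!: derivative_eq_intros)
          then have "((\<lambda>h. (exp (-((z + h) * of_real (X w))) - exp (-(z * of_real (X w)))) / h) \<circ> s)
              \<longlonglongrightarrow> - of_real (X w) * exp (-(z * of_real (X w)))"
            using s unfolding DERIV_def tendsto_at_iff_sequentially by blast
          from LIMSEQ_ignore_initial_segment[OF this, of N]
          show "(\<lambda>n. ?Q n w)
            \<longlonglongrightarrow> - of_real (X w) * exp (-(z * of_real (X w)))"
            by (simp add: o_def)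
        qed
        show "AE w in M. norm (?Q n w)
           \<le> 2 / e * (exp (-((Re z + e) * X w)) + exp (-((Re z - e) * X w)))" for n
          using norm_exp_difference_quotient_le[OF e(1) N[of "n + N"], of z] s(1) by auto
      qed measurable
      moreover have "(f (z + s (n + N)) - f z) / s (n + N) =
        (\<integral>w. ?Q n w \<partial>M)" for n
      proof -
        have "Re (z + s (n + N)) \<in> I"
          using N[of "n + N"] abs_Re_le_cmod[of "s (n + N)"] e(1) by (intro in_I) auto
        then show ?thesis
          unfolding f_def
          by (subst integral_divide_zero, subst Bochner_Integration.integral_diff) (auto intro!: * z)
      qed
      ultimately have "(\<lambda>n. (f (z + s (n + N)) - f z) / s (n + N)) \<longlonglongrightarrow> D" by (simp only:)
      from LIMSEQ_offset[OF this] show "((\<lambda>h. (f (z + h) - f z) / h) \<circ> s) \<longlonglongrightarrow> D"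
        by (simp add: o_def)
    qed
    then show ?thesis unfolding DERIV_def by blast
  qed
  then have "\<And>z. z \<in> {z. Re z \<in> I} \<Longrightarrow> f field_differentiable (at z within {z. Re z \<in> I})"
    using field_differentiable_at_within field_differentiable_def by blast
  then show "(\<lambda>z. \<integral>w. exp (-(z * of_real (X w))) \<partial>M) holomorphic_on {z. Re z \<in> I}"
    unfolding holomorphic_on_def f_def by blast
qed

text \<open>Identity theorem: the interval, embedded in the complex plane, accumulates at
  \<open>u\<close> inside the connected strip.\<close>

lemma holomorphic_eq_on_strip:
  fixes I :: "real set"
  assumes I: "open I" "convex I" "u \<in> I"
    and f: "f holomorphic_on {z. Re z \<in> I}" and g: "g holomorphic_on {z. Re z \<in> I}"
    and eq: "\<And>u. u \<in> I \<Longrightarrow> f (of_real u) = g (of_real u)"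
    and z: "Re z \<in> I"
  shows "f z = g z"
proof -
  let ?S = "{z. Re z \<in> I}"
  have S: "open ?S" using open_vimage[OF I(1) continuous_on_Re[OF continuous_on_id]]
    by (simp add: vimage_def)
  have "convex ?S"
    using convex_linear_vimage[OF bounded_linear.linear[OF bounded_linear_Re] I(2)] by (simp add: vimage_def)
  then have S': "connected ?S" by (rule convex_connected)
  have lim: "complex_of_real u islimpt (of_real ` I)"
  proof -
    have "u islimpt I" using I(1,3) interior_limit_point interior_open by blast
    then obtain s where s: "\<And>n::nat. s n \<in> I - {u}" "s \<longlonglongrightarrow> u"
      unfolding islimpt_sequential by blast
    have "\<forall>n::nat. complex_of_real (s n) \<in> of_real ` I - {of_real u}" using s(1) by auto
    moreover have "(\<lambda>n. complex_of_real (s n)) \<longlonglongrightarrow> of_real u" using s(2) by (rule tendsto_of_real)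
    ultimately show ?thesis unfolding islimpt_sequential by (metis (lifting))
  qed
  have "(\<lambda>z. f z - g z) holomorphic_on ?S" by (rule holomorphic_on_diff[OF f g])
  moreover have "of_real ` I \<subseteq> ?S" by auto
  moreover have "f v - g v = 0" if "v \<in> of_real ` I" for v using eq that by auto
  ultimately have "f z - g z = 0"
    using analytic_continuation[OF _ S S' _ _ lim, of "\<lambda>z. f z - g z" z] I(3) z by simp
  then show ?thesis by simp
qed

text \<open>Extends a transform known at real arguments to complex ones. It serves both for Gamma
  integrals with complex parameter and for the characteristic function of \<open>L\<close>.\<close>

lemma complex_laplace_eqI:
  fixes X :: "'a \<Rightarrow> real" and I :: "real set" and g :: "complex \<Rightarrow> complex"
  assumes X[measurable]: "X \<in> borel_measurable M" and I: "open I" "convex I"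
    and int: "\<And>u. u \<in> I \<Longrightarrow> has_bochner_integral M (\<lambda>w. exp (-(u * X w))) (G u)"
    and g: "g holomorphic_on {z. Re z \<in> I}"
    and eq: "\<And>u. u \<in> I \<Longrightarrow> g (of_real u) = of_real (G u)"
    and z: "Re z \<in> I"
  shows "has_bochner_integral M (\<lambda>w. exp (-(z * of_real (X w)))) (g z)"
proof -
  have i: "u \<in> I \<Longrightarrow> integrable M (\<lambda>w. exp (-(u * X w)))" for u
    using int has_bochner_integral_iff by blast
  have "(\<integral>w. exp (-(z * of_real (X w))) \<partial>M) = g z"
  proof (rule holomorphic_eq_on_strip[OF I z _ g _ z])
    show "(\<lambda>z. \<integral>w. exp (-(z * of_real (X w))) \<partial>M) holomorphic_on {z. Re z \<in> I}"
      by (rule holomorphic_laplace[OF X i I(1)])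
    show "(\<integral>w. exp (-(complex_of_real u * of_real (X w))) \<partial>M) = g (of_real u)" if "u \<in> I" for u
    proof -
      have "(\<integral>w. exp (-(complex_of_real u * of_real (X w))) \<partial>M) = (\<integral>w. of_real (exp (-(u * X w))) \<partial>M)"
        by (simp flip: exp_of_real)
      also have "\<dots> = of_real (\<integral>w. exp (-(u * X w)) \<partial>M)" by (rule integral_complex_of_real)
      finally show ?thesis using eq[OF that] int[OF that] by (simp add: has_bochner_integral_iff)
    qed
  qed
  then show ?thesis
    using integrable_complex_laplace[OF X i z] by (simp add: has_bochner_integral_iff)
qed

text \<open>Since 0 need not lie in \<open>I\<close>, characteristic functions are not directly
  available. Tilting both laws by \<open>exp (-(u * x)) / c\<close> turns the transform on the line
  \<open>Re z = u\<close> into a characteristic function, to which uniqueness applies. The tilt has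
  a positive density, so multiplying by its reciprocal recovers the original laws.\<close>

lemma distr_eqI_laplace:
  fixes X :: "'a \<Rightarrow> real" and Y :: "'b \<Rightarrow> real" and I :: "real set"
  assumes "prob_space M" "prob_space N"
    and X[measurable]: "X \<in> borel_measurable M" and Y[measurable]: "Y \<in> borel_measurable N"
    and I: "open I" "convex I" "u \<in> I"
    and intX: "\<And>u. u \<in> I \<Longrightarrow> has_bochner_integral M (\<lambda>w. exp (-(u * X w))) (G u)"
    and intY: "\<And>u. u \<in> I \<Longrightarrow> has_bochner_integral N (\<lambda>w. exp (-(u * Y w))) (G u)"
  shows "distr M borel X = distr N borel Y"
proof -
  interpret M: prob_space M by fact
  interpret N: prob_space N by fact
  have iX: "u \<in> I \<Longrightarrow> integrable M (\<lambda>w. exp (-(u * X w)))" for u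
    using intX has_bochner_integral_iff by blast
  have iY: "u \<in> I \<Longrightarrow> integrable N (\<lambda>w. exp (-(u * Y w)))" for u
    using intY has_bochner_integral_iff by blast
  define g where "g = (\<lambda>z. \<integral>w. exp (-(z * of_real (Y w))) \<partial>N :: complex)"
  have g: "g holomorphic_on {z. Re z \<in> I}"
    unfolding g_def by (rule holomorphic_laplace[OF Y iY I(1)])
  have g_of_real: "g (of_real v) = of_real (G v)" if "v \<in> I" for v
  proof -
    have "g (of_real v) = (\<integral>w. of_real (exp (-(v * Y w))) \<partial>N)"
      unfolding g_def by (simp flip: exp_of_real)
    also have "\<dots> = of_real (\<integral>w. exp (-(v * Y w)) \<partial>N)" by (rule integral_complex_of_real)
    finally show ?thesis using intY[OF that] by (simp add: has_bochner_integral_iff)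
  qed
  have eq: "(\<integral>w. exp (-(z * of_real (X w))) \<partial>M) = g z" if "Re z \<in> I" for z
    using complex_laplace_eqI[OF X I(1,2) intX g g_of_real that] by (simp add: has_bochner_integral_iff)
  define c where "c = G u"
  have "0 < (\<integral>w. exp (-(u * X w)) \<partial>M)"
    by (rule M.expectation_greater) (use iX[OF I(3)] in auto)
  then have c: "c > 0" using intX[OF I(3)] by (simp add: c_def has_bochner_integral_iff)
  let ?k = "\<lambda>x. ennreal (exp (-(u * x)) / c)"
  have dens: "density (distr K borel W) ?k = distr (density K (\<lambda>w. ?k (W w))) borel W"
    if "W \<in> borel_measurable K" for K :: "'c measure" and W by (rule density_distr) (use that in auto)
  have rd: "real_distribution (density (distr K borel W) ?k)"
    if K: "prob_space K" and W[measurable]: "W \<in> borel_measurable K"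
      and i: "has_bochner_integral K (\<lambda>w. exp (-(u * W w))) c" for K :: "'c measure" and W
  proof -
    interpret K: prob_space K by (rule K)
    have "emeasure (density K (\<lambda>w. ?k (W w))) (space K) = (\<integral>\<^sup>+w. ennreal (exp (-(u * W w)) / c) \<partial>K)"
      by (simp add: emeasure_density)
    also have "\<dots> = ennreal (\<integral>w. exp (-(u * W w)) / c \<partial>K)"
      using i c by (intro nn_integral_eq_integral) (auto simp: has_bochner_integral_iff)
    also have "\<dots> = 1" using i c by (simp add: has_bochner_integral_iff)
    finally have "prob_space (density K (\<lambda>w. ?k (W w)))" by (intro prob_spaceI) simp
    then show ?thesis unfolding dens[OF W]
      by (intro prob_space.real_distribution_distr) auto
  qed
  have ch: "char (density (distr K borel W) ?k) t = (\<integral>w. exp (-((u - \<i> * t) * of_real (W w))) \<partial>K) / c"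
    if W[measurable]: "W \<in> borel_measurable K" for K :: "'c measure" and W t
  proof -
    have "char (density (distr K borel W) ?k) t = (\<integral>w. (exp (-(u * W w)) / c) *\<^sub>R iexp (t * W w) \<partial>K)"
      unfolding char_def using c by (subst integral_density) (auto simp: integral_distr)
    also have "\<dots> = (\<integral>w. exp (-((u - \<i> * t) * of_real (W w))) / c \<partial>K)"
    proof (rule Bochner_Integration.integral_cong)
      fix w
      have "exp (-((u - \<i> * t) * of_real (W w))) = exp (of_real (-(u * W w))) * iexp (t * W w)"
        unfolding exp_add[symmetric] by (simp add: algebra_simps)
      then show "(exp (-(u * W w)) / c) *\<^sub>R iexp (t * W w) = exp (-((u - \<i> * t) * of_real (W w))) / c"
        by (simp add: scaleR_conv_of_real flip: exp_of_real)
    qed simp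
    finally show ?thesis by simp
  qed
  have "density (distr M borel X) ?k = density (distr N borel Y) ?k"
  proof (rule Levy_uniqueness)
    show "real_distribution (density (distr M borel X) ?k)"
      by (rule rd) (use intX[OF I(3)] assms in \<open>auto simp: c_def\<close>)
    show "real_distribution (density (distr N borel Y) ?k)"
      by (rule rd) (use intY[OF I(3)] assms in \<open>auto simp: c_def\<close>)
    show "char (density (distr M borel X) ?k) = char (density (distr N borel Y) ?k)"
      using eq[of "u - \<i> * _"] I(3) by (auto simp: ch fun_eq_iff g_def)
  qed
  then have "density (density (distr M borel X) ?k) (\<lambda>x. ennreal (c * exp (u * x))) =
      density (density (distr N borel Y) ?k) (\<lambda>x. ennreal (c * exp (u * x)))" by simp
  moreover have "?k x * ennreal (c * exp (u * x)) = 1" for x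
    using c by (simp add: ennreal_mult[symmetric] exp_add[symmetric])
  ultimately show ?thesis by (simp add: density_density_eq density_1)
qed

section \<open>Gamma integrals\<close>

lemma has_bochner_integral_Gamma:
  fixes s :: real
  assumes s: "s > 0"
  shows "has_bochner_integral lborel (\<lambda>t. indicator {0<..} t * (t powr (s - 1) * exp (-t))) (Gamma s)"
proof (rule has_bochner_integral_nn_integral)
  show "(\<integral>\<^sup>+t. ennreal (indicator {0<..} t * (t powr (s - 1) * exp (-t))) \<partial>lborel) = ennreal (Gamma s)"
    unfolding Gamma_conv_nn_integral_real[OF s]
    by (rule nn_integral_cong) (auto simp: indicator_def exp_minus field_simps)
  show "0 \<le> Gamma s" using Gamma_real_pos[OF s] by simp
qed auto

lemma has_bochner_integral_powr_exp:
  fixes a c k :: real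
  assumes a: "a > 0" and c: "c > 0" and k: "k > 0"
  shows "has_bochner_integral lborel (\<lambda>y. indicator {0<..} y * (y powr (c - 1) * exp (-(k * y powr a))))
           (Gamma (c / a) / a * k powr (- (c / a)))"
proof -
  let ?f = "\<lambda>y. y powr (c - 1) * exp (-(k * y powr a))"
  \<comment> \<open>\<open>?g\<close> inverts the substitution \<open>r = k * y powr a\<close>,
    which reduces the integral to the Gamma integral.\<close>
  let ?g = "\<lambda>r. (r / k) powr (1 / a)"
  let ?g' = "\<lambda>r. (r / k) powr (1 / a - 1) / (a * k)"
  let ?K = "k powr (- (c / a)) / a"
  have eq: "?f (?g r) * ?g' r = ?K * (r powr (c / a - 1) * exp (-r))" if "r > 0" for r
  proof -
    have "?f (?g r) * ?g' r = (r / k) powr ((c - 1) / a + (1 / a - 1)) / (a * k) * exp (-r)"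
      using that k a by (simp add: powr_powr powr_add)
    also have "(c - 1) / a + (1 / a - 1) = c / a - 1" by (simp add: diff_divide_distrib)
    also have "(r / k) powr (c / a - 1) / (a * k) = ?K * r powr (c / a - 1)"
      using that k by (simp add: powr_divide powr_diff powr_minus field_simps)
    finally show ?thesis by simp
  qed
  have G: "has_bochner_integral lborel (\<lambda>r. indicator {0<..} r * (?f (?g r) * ?g' r)) (?K * Gamma (c / a))"
  proof -
    have "has_bochner_integral lborel (\<lambda>r. ?K * (indicator {0<..} r * (r powr (c / a - 1) * exp (-r)))) (?K * Gamma (c / a))"
      by (rule has_bochner_integral_mult_right) (use a c in \<open>auto intro!: has_bochner_integral_Gamma\<close>)
    moreover have "indicator {0<..} r * (?f (?g r) * ?g' r) = ?K * (indicator {0<..} r * (r powr (c / a - 1) * exp (-r)))" for r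
      using eq[of r] by (auto simp: indicator_def)
    ultimately show ?thesis by (simp only:)
  qed
  have ev: "einterval 0 \<infinity> = {0<..}" by (auto simp: einterval_def)
  have deriv: "DERIV ?g r :> ?g' r" if "r > 0" for r
    using that k a by (auto intro!: derivative_eq_intros simp: powr_diff field_simps)
  have lim0: "((ereal \<circ> ?g \<circ> real_of_ereal) \<longlongrightarrow> 0) (at_right 0)"
  proof -
    have "(?g \<longlongrightarrow> (0 / k) powr (1 / a)) (at_right 0)"
      by (intro tendsto_intros) (use a k in \<open>auto simp: eventually_at_filter\<close>)
    then have "((ereal \<circ> ?g) \<longlongrightarrow> ereal 0) (at_right 0)" by (simp add: o_def)
    then show ?thesis unfolding zero_ereal_def by (simp add: ereal_tendsto_simps1 o_assoc)
  qed
  have liminf: "((ereal \<circ> ?g \<circ> real_of_ereal) \<longlongrightarrow> \<infinity>) (at_left \<infinity>)"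
  proof -
    have "filterlim ?g at_top at_top"
      using a k by real_asymp
    then have "((ereal \<circ> ?g) \<longlongrightarrow> \<infinity>) at_top" by (simp add: o_def tendsto_PInfty_eq_at_top)
    then show ?thesis by (simp add: ereal_tendsto_simps1 o_assoc)
  qed
  have contf: "isCont ?f (?g r)" and contg: "isCont ?g' r" if "r > 0" for r
  proof -
    have "?g r > 0" using that k by simp
    then show "isCont ?f (?g r)" using a by (intro continuous_intros) auto
    show "isCont ?g' r" using that k a by (intro continuous_intros) auto
  qed
  have int: "set_integrable lborel (einterval 0 \<infinity>) (\<lambda>x. ?f (?g x) * ?g' x)"
    using G by (simp add: set_integrable_def ev has_bochner_integral_iff)
  note subst = interval_integral_substitution_nonneg
    [where f = ?f and g = ?g and g' = ?g' and a = 0 and b = \<infinity>, OF _ deriv contf contg _ _ lim0 liminf int]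
  have "set_integrable lborel (einterval 0 \<infinity>) ?f"
    by (rule subst(1)) (use a k in auto)
  moreover have "(LBINT x=0..\<infinity>. ?f x) = (LBINT x=0..\<infinity>. ?f (?g x) * ?g' x)"
    by (rule subst(2)) (use a k in auto)
  ultimately
  show ?thesis
    using G by (simp add: interval_lebesgue_integral_def set_integrable_def set_lebesgue_integral_def ev has_bochner_integral_iff mult_ac)
qed

text \<open>With the power \<open>y powr (c - 1)\<close> moved into the measure, the integral is the
  Laplace transform of \<open>y powr a\<close> at \<open>p\<close>. Analytic continuation from real
  \<open>p\<close> therefore replaces a rotation of the contour.\<close>

lemma has_bochner_integral_powr_cexp:
  fixes a c :: real and p :: complex
  assumes a: "a > 0" and c: "c > 0" and p: "Re p > 0"
  shows "has_bochner_integral lborel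
           (\<lambda>y. indicator {0<..} y *\<^sub>R (of_real (y powr (c - 1)) * exp (-(p * of_real (y powr a)))))
           (of_real (Gamma (c / a) / a) * p powr (- of_real (c / a)))"
proof -
  define w where "w y = indicator {0<..} y * y powr (c - 1)" for y :: real
  have w[measurable]: "w \<in> borel_measurable borel" and w0: "w y \<ge> 0" for y
    unfolding w_def by auto
  let ?g = "\<lambda>z. of_real (Gamma (c / a) / a) * z powr (- of_real (c / a)) :: complex"
  have "has_bochner_integral (density lborel w) (\<lambda>y. exp (-(p * of_real (y powr a)))) (?g p)"
  proof (rule complex_laplace_eqI[where I = "{0<..}"])
    show "has_bochner_integral (density lborel w) (\<lambda>y. exp (-(u * y powr a))) (Gamma (c / a) / a * u powr (- (c / a)))"
      if "u \<in> {0<..}" for u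
      using has_bochner_integral_powr_exp[OF a c, of u] that
      by (intro has_bochner_integral_density) (auto simp: w0 w_def mult.assoc)
    show "?g holomorphic_on {z. Re z \<in> {0<..}}"
      by (intro holomorphic_intros) (auto simp: complex_nonpos_Reals_iff)
    show "?g (of_real u) = of_real (Gamma (c / a) / a * u powr (- (c / a)))" if "u \<in> {0<..}" for u
      using that powr_of_real[of u "- (c / a)"] by simp
  qed (use p in auto)
  then show ?thesis
    unfolding has_bochner_integral_iff
    by (simp add: integrable_density integral_density w0)
       (simp add: w_def scaleR_conv_of_real mult.assoc)
qed

lemma powr_of_real_cis:
  fixes r s \<theta> :: real
  assumes "r > 0" "- pi < \<theta>" "\<theta> \<le> pi"
  shows "(of_real r * cis \<theta>) powr of_real s = of_real (r powr s) * cis (s * \<theta>)"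
proof -
  have "of_real r * cis \<theta> = exp (of_real (ln r) + \<i> * of_real \<theta>)"
    using assms by (simp add: exp_add cis_conv_exp exp_of_real)
  then have "ln (of_real r * cis \<theta>) = of_real (ln r) + \<i> * of_real \<theta>"
    using assms by simp
  moreover have "of_real r * cis \<theta> \<noteq> 0" using assms by simp
  ultimately have "(of_real r * cis \<theta>) powr of_real s = exp (of_real (s * ln r) + \<i> * of_real (s * \<theta>))"
    by (simp add: powr_def algebra_simps)
  then show ?thesis
    using assms by (simp add: exp_add cis_conv_exp powr_def flip: exp_of_real)
qed

section \<open>An eigenfunction of Airy type\<close>

locale stable_index =
  fixes \<alpha> :: real
  assumes \<alpha>: "1 < \<alpha>" "\<alpha> < 2"
begin

text \<open>For \<open>y > 0\<close> the branch used throughout is \<open>(\<i> y)\<^sup>\<alpha> = rot * y\<^sup>\<alpha>\<close>.\<close>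

definition rot :: complex where "rot = cis (pi * \<alpha> / 2)"

text \<open>This is \<open>exp ((\<i> * y) powr (\<alpha> + 1) / (q * (\<alpha> + 1)))\<close> on
  the chosen branch, because \<open>\<i> * rot * y powr (\<alpha> + 1)\<close> is the power of
  \<open>\<i> * y\<close> of exponent \<open>\<alpha> + 1\<close>.\<close>

definition weight :: "real \<Rightarrow> real \<Rightarrow> complex" where
  "weight q y = exp (\<i> * rot * of_real (y powr (\<alpha> + 1) / (q * (\<alpha> + 1))))"

definition cairy :: "real \<Rightarrow> real \<Rightarrow> complex" where
  "cairy q x = (\<integral>y. indicator {0<..} y *\<^sub>R (exp (-(\<i> * of_real (y * x))) * weight q y) \<partial>lborel)"

text \<open>At \<alpha> = 2 the formula would be the integral of cos (y x + y^3 / (3 q)) over y > 0,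
  which is pi q^(1/3) Ai (q^(1/3) x) with the classical Airy function Ai.\<close>

definition airy :: "real \<Rightarrow> real \<Rightarrow> real" where
  "airy q x = Re (cairy q x)"

text \<open>The angle \<open>pi * \<alpha> / 2\<close> lies in the second quadrant. The negative
  real part makes the characteristic function of an increment decay, and the positive imaginary part
  makes \<open>weight\<close> decay.\<close>

lemma Re_rot: "Re rot < 0" and Im_rot: "Im rot > 0"
proof -
  have "cos (pi * \<alpha> / 2) < 0"
    by (rule cos_lt_zero_pi) (use \<alpha> in \<open>auto simp: field_simps\<close>) 
  then show "Re rot < 0" by (simp add: rot_def)
  have "sin (pi * \<alpha> / 2) > 0"
    by (rule sin_gt_zero) (use \<alpha> in \<open>auto simp: field_simps\<close>)
  then show "Im rot > 0" by (simp add: rot_def)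
qed

lemma norm_rot [simp]: "norm rot = 1" by (simp add: rot_def)

lemma norm_weight: "norm (weight q y) = exp (-(Im rot / (q * (\<alpha> + 1)) * y powr (\<alpha> + 1)))"
  by (simp add: weight_def)

lemma weight_measurable [measurable]: "weight q \<in> borel_measurable borel"
  unfolding weight_def by measurable

lemma integrable_powr_weight:
  assumes "q > 0" "b > 0"
  shows "integrable lborel (\<lambda>y. indicator {0<..} y * (y powr (b - 1) * norm (weight q y)))"
  unfolding norm_weight
  using has_bochner_integral_powr_exp[of "\<alpha> + 1" b "Im rot / (q * (\<alpha> + 1))"] assms \<alpha> Im_rot
  by (simp add: has_bochner_integral_iff)

lemma integrable_norm_weight:
  assumes "q > 0"
  shows "integrable lborel (\<lambda>y. indicator {0<..} y * norm (weight q y))"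
proof -
  have "indicator {0<..} y * (y powr (1 - 1) * norm (weight q y)) = indicator {0<..} y * norm (weight q y)" for y
    by (auto simp: indicator_def)
  then show ?thesis using integrable_powr_weight[OF assms, of 1] by (simp only: zero_less_one)
qed

lemma integrable_cairy:
  assumes "q > 0"
  shows "integrable lborel (\<lambda>y. indicator {0<..} y *\<^sub>R (exp (-(\<i> * of_real (y * x))) * weight q y))"
  by (rule Bochner_Integration.integrable_bound[OF integrable_norm_weight[OF assms]])
     (auto simp: norm_mult)

definition airy_bound :: "real \<Rightarrow> real" where
  "airy_bound q = (\<integral>y. indicator {0<..} y * norm (weight q y) \<partial>lborel)"

lemma norm_cairy_le:
  assumes "q > 0"
  shows "norm (cairy q x) \<le> airy_bound q"
  unfolding cairy_def airy_bound_def
  by (rule Bochner_Integration.integral_norm_bound_integral[OF integrable_cairy[OF assms] integrable_norm_weight[OF assms]])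
     (auto simp: norm_mult)

lemma abs_airy_le: "q > 0 \<Longrightarrow> \<bar>airy q x\<bar> \<le> airy_bound q"
  unfolding airy_def using norm_cairy_le[of q x] abs_Re_le_cmod[of "cairy q x"] by linarith

lemma continuous_cairy:
  assumes q: "q > 0"
  shows "continuous_on UNIV (cairy q)"
  unfolding continuous_on_sequentially cairy_def o_def
proof (intro allI ballI impI, elim conjE)
  fix x :: real and s :: "nat \<Rightarrow> real" assume s: "s \<longlonglongrightarrow> x"
  show "(\<lambda>n. \<integral>y. indicator {0<..} y *\<^sub>R (exp (-(\<i> * of_real (y * s n))) * weight q y) \<partial>lborel)
      \<longlonglongrightarrow> (\<integral>y. indicator {0<..} y *\<^sub>R (exp (-(\<i> * of_real (y * x))) * weight q y) \<partial>lborel)"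
    by (rule integral_dominated_convergence[OF _ _ integrable_norm_weight[OF q]])
       (auto simp: norm_mult intro!: tendsto_intros s)
qed

lemma continuous_airy: "q > 0 \<Longrightarrow> continuous_on UNIV (airy q)"
  unfolding airy_def by (intro continuous_intros continuous_cairy)

lemma airy_measurable [measurable]: "q > 0 \<Longrightarrow> airy q \<in> borel_measurable borel"
  by (rule borel_measurable_continuous_onI[OF continuous_airy])

text \<open>Integration by parts against \<open>weight q\<close>, which satisfies \<open>q * G' = \<i> * rot * y\<^sup>\<alpha> * G\<close>: the
  generator of the stable process acts on \<open>airy q\<close> as multiplication by \<open>q * x\<close>.\<close>

lemma cairy_generator:
  assumes q: "q > 0"
  shows "has_bochner_integral lborel
    (\<lambda>y. indicator {0<..} y *\<^sub>R (rot * of_real (y powr \<alpha>) * exp (-(\<i> * of_real (y * x))) * weight q y))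
    (q * x * cairy q x + \<i> * q)"
proof -
  define F where "F y = exp (-(\<i> * of_real (y * x))) * weight q y" for y
  let ?J = "\<lambda>y. rot * of_real (y powr \<alpha>) * F y"
  let ?iF = "\<lambda>y. indicator {0<..} y *\<^sub>R F y" and ?iJ = "\<lambda>y. indicator {0<..} y *\<^sub>R ?J y"
  have ev: "einterval 0 \<infinity> = {0<..}" by (auto simp: einterval_def)
  have F[measurable]: "F \<in> borel_measurable borel" unfolding F_def by measurable
  have nF: "norm (F y) = norm (weight q y)" for y by (simp add: F_def norm_mult)
  have i1: "integrable lborel (\<lambda>y. ?iF y)"
    using integrable_cairy[OF q] by (simp add: F_def)
  have i2: "integrable lborel (\<lambda>y. ?iJ y)"
    by (rule Bochner_Integration.integrable_bound[OF integrable_powr_weight[OF q, of "\<alpha> + 1"]])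
       (use \<alpha> in \<open>auto simp: norm_mult nF\<close>)
  let ?F' = "\<lambda>y. - \<i> * x * F y + \<i> / q * ?J y"
  have i3: "integrable lborel (\<lambda>y. indicator {0<..} y *\<^sub>R ?F' y)"
  proof -
    have "indicator {0<..} y *\<^sub>R ?F' y = - \<i> * x * ?iF y + \<i> / q * ?iJ y" for y
      by (auto simp: indicator_def)
    then show ?thesis
      by (simp only:) (intro Bochner_Integration.integrable_add integrable_mult_right i1 i2)
  qed
  have deriv: "(F has_vector_derivative ?F' y) (at y)" if "y > 0" for y
  proof -
    have "((\<lambda>y. y powr (\<alpha> + 1) / (q * (\<alpha> + 1))) has_field_derivative y powr \<alpha> / q) (at y)"
      using that q \<alpha> by (auto intro!: derivative_eq_intros)
    moreover have "((\<lambda>y. y * x) has_field_derivative x) (at y)"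
      by (auto intro!: derivative_eq_intros)
    ultimately have E: "((\<lambda>y. -(\<i> * of_real (y * x)) + \<i> * rot * of_real (y powr (\<alpha> + 1) / (q * (\<alpha> + 1))))
        has_vector_derivative -(\<i> * of_real x) + \<i> * rot * of_real (y powr \<alpha> / q)) (at y)"
      by (intro has_vector_derivative_add has_vector_derivative_minus has_vector_derivative_mult_right
          has_vector_derivative_of_real)
    have "F = exp \<circ> (\<lambda>y. -(\<i> * of_real (y * x)) + \<i> * rot * of_real (y powr (\<alpha> + 1) / (q * (\<alpha> + 1))))"
      by (simp only: fun_eq_iff F_def weight_def exp_add o_def) simp
    then have "(F has_vector_derivative (-(\<i> * of_real x) + \<i> * rot * of_real (y powr \<alpha> / q)) * F y) (at y)"
      using field_vector_diff_chain_at[OF E DERIV_exp] by simp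
    then show ?thesis by (simp add: algebra_simps)
  qed
  \<comment> \<open>The boundary values of \<open>F\<close> are 0 at infinity and 1 at 0. The latter
    becomes the summand \<open>\<i> * q\<close> of the statement after multiplication by
    \<open>- \<i> * q\<close> below.\<close>
  have "(LBINT y=0..\<infinity>. ?F' y) = 0 - 1"
  proof (rule interval_integral_FTC_integrable[where F = F])
    show "isCont ?F' y" if "0 < ereal y" "ereal y < \<infinity>" for y
      unfolding F_def weight_def using that \<alpha> q by (intro continuous_intros) auto
    show "set_integrable lborel (einterval 0 \<infinity>) ?F'"
      using i3 by (simp add: set_integrable_def ev)
    have "(F \<longlongrightarrow> exp (-(\<i> * of_real (0 * x))) * exp (\<i> * rot * of_real (0 powr (\<alpha> + 1) / (q * (\<alpha> + 1)))))
        (at_right 0)"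
      unfolding F_def weight_def
      by (intro tendsto_intros) (use q \<alpha> in \<open>auto simp: eventually_at_filter\<close>)
    then have "(F \<longlongrightarrow> 1) (at_right 0)" by simp
    then show "((F \<circ> real_of_ereal) \<longlongrightarrow> 1) (at_right 0)"
      unfolding zero_ereal_def by (simp add: ereal_tendsto_simps1)
    have "((\<lambda>y. exp (-(k * y powr b))) \<longlongrightarrow> 0) at_top" if "k > 0" "b > 0" for k b :: real
      using that by real_asymp
    from this[of "Im rot / (q * (\<alpha> + 1))" "\<alpha> + 1"]
    have "((\<lambda>y. exp (-(Im rot / (q * (\<alpha> + 1)) * y powr (\<alpha> + 1)))) \<longlongrightarrow> 0) at_top"
      using q \<alpha> Im_rot by simp
    then have "((\<lambda>y. norm (F y)) \<longlongrightarrow> 0) at_top" by (simp add: nF norm_weight)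
    then show "((F \<circ> real_of_ereal) \<longlongrightarrow> 0) (at_left \<infinity>)"
      by (simp add: ereal_tendsto_simps1 tendsto_norm_zero_iff)
  qed (use deriv in auto)
  then have "(\<integral>y. - \<i> * x * ?iF y + \<i> / q * ?iJ y \<partial>lborel) = - 1"
    by (simp add: interval_lebesgue_integral_def set_lebesgue_integral_def ev algebra_simps scaleR_conv_of_real)
  moreover have "(\<integral>y. - \<i> * x * ?iF y + \<i> / q * ?iJ y \<partial>lborel) =
      - \<i> * x * (\<integral>y. ?iF y \<partial>lborel) + \<i> / q * (\<integral>y. ?iJ y \<partial>lborel)"
    by (simp only: Bochner_Integration.integral_add[OF integrable_mult_right[OF i1] integrable_mult_right[OF i2]]
        integral_mult_right_zero)
  moreover have "(\<integral>y. ?iF y \<partial>lborel) = cairy q x" by (simp add: cairy_def F_def)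
  ultimately have "- \<i> * x * cairy q x + \<i> / q * (\<integral>y. ?iJ y \<partial>lborel) = - 1"
    by (simp only:)
  then have "q * (- \<i>) * (- \<i> * x * cairy q x + \<i> / q * (\<integral>y. ?iJ y \<partial>lborel)) = q * (- \<i>) * - 1"
    by simp
  then have "(\<integral>y. ?iJ y \<partial>lborel) = q * x * cairy q x + \<i> * q"
    using q by (simp add: algebra_simps)
  then show ?thesis using i2 by (simp add: has_bochner_integral_iff F_def mult.assoc)
qed

definition airy_decay :: "real \<Rightarrow> real" where
  "airy_decay q = (\<integral>y. indicator {0<..} y * (y powr \<alpha> * norm (weight q y)) \<partial>lborel) / q"

text \<open>The integral in \<open>cairy_generator\<close> is bounded uniformly in \<open>x\<close>,
  since its oscillating factor has modulus 1, and its value has real part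
  \<open>q * x * airy q x\<close>.\<close>

lemma airy_decay: 
  assumes q: "q > 0"
  shows "\<bar>x * airy q x\<bar> \<le> airy_decay q"
proof -
  have i: "integrable lborel (\<lambda>y. indicator {0<..} y * (y powr \<alpha> * norm (weight q y)))"
    using integrable_powr_weight[OF q, of "\<alpha> + 1"] \<alpha> by simp
  have "norm (\<integral>y. indicator {0<..} y *\<^sub>R (rot * of_real (y powr \<alpha>) * exp (-(\<i> * of_real (y * x))) * weight q y) \<partial>lborel)
      \<le> (\<integral>y. indicator {0<..} y * (y powr \<alpha> * norm (weight q y)) \<partial>lborel)"
    by (rule Bochner_Integration.integral_norm_bound_integral) (use i cairy_generator[OF q] in \<open>auto simp: norm_mult has_bochner_integral_iff\<close>)
  then have "norm (of_real q * of_real x * cairy q x + \<i> * of_real q) \<le> (\<integral>y. indicator {0<..} y * (y powr \<alpha> * norm (weight q y)) \<partial>lborel)"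
    by (simp only: has_bochner_integral_integral_eq[OF cairy_generator[OF q, of x]])
  moreover have "\<bar>q * x * airy q x\<bar> \<le> norm (of_real q * of_real x * cairy q x + \<i> * of_real q)"
    using abs_Re_le_cmod[of "of_real q * of_real x * cairy q x + \<i> * of_real q"] by (simp add: airy_def)
  ultimately show ?thesis using q by (simp add: airy_decay_def field_simps abs_mult)
qed

text \<open>Rescaling \<open>y\<close> by the factor q^(1/(\<alpha>+1)) removes \<open>q\<close>
  from the weight. This trades the Laplace parameter \<open>q\<close> for the space variable, so
  that all values of \<open>q\<close> are encoded in the single function
  \<open>airy 1\<close>.\<close>

lemma cairy_scaling:
  assumes q: "q > 0"
  shows "cairy q x = of_real (q powr (1 / (\<alpha> + 1))) * cairy 1 (q powr (1 / (\<alpha> + 1)) * x)"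
proof -
  let ?c = "q powr (1 / (\<alpha> + 1))"
  have c: "?c > 0" using q by simp
  have "cairy q x = \<bar>?c\<bar> *\<^sub>R (\<integral>y. indicator {0<..} (0 + ?c * y) *\<^sub>R (exp (-(\<i> * of_real ((0 + ?c * y) * x))) * weight q (0 + ?c * y)) \<partial>lborel)"
    unfolding cairy_def by (rule lborel_integral_real_affine) (use c in simp)
  also have "\<dots> = ?c *\<^sub>R cairy 1 (?c * x)"
    unfolding cairy_def
  proof (rule arg_cong2[where f = scaleR], simp, rule Bochner_Integration.integral_cong)
    fix y
    show "indicator {0<..} (0 + ?c * y) *\<^sub>R (exp (-(\<i> * of_real ((0 + ?c * y) * x))) * weight q (0 + ?c * y)) =
        indicator {0<..} y *\<^sub>R (exp (-(\<i> * of_real (y * (?c * x)))) * weight 1 y)"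
      using c q \<alpha> by (auto simp: indicator_def zero_less_mult_iff weight_def powr_mult powr_powr mult_ac)
  qed simp
  finally show ?thesis by (simp add: scaleR_conv_of_real)
qed

lemma airy_scaling:
  "q > 0 \<Longrightarrow> airy q x = q powr (1 / (\<alpha> + 1)) * airy 1 (q powr (1 / (\<alpha> + 1)) * x)"
  by (subst (1) airy_def, subst cairy_scaling) (simp_all add: airy_def)

end

section \<open>Characteristic function and one-step estimate\<close>

lemma eq_in_law_integral_eq:
  fixes f :: "real \<Rightarrow> 'c::{banach, second_countable_topology}"
  assumes "eq_in_law M X N Y" and [measurable]: "f \<in> borel_measurable borel"
  shows "(\<integral>w. f (X w) \<partial>M) = (\<integral>w. f (Y w) \<partial>N)"
proof -
  from assms have [measurable]: "X \<in> borel_measurable M" "Y \<in> borel_measurable N"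
    and eq: "distr M borel X = distr N borel Y" by (auto simp: eq_in_law_def)
  have "(\<integral>w. f (X w) \<partial>M) = integral\<^sup>L (distr M borel X) f" by (simp add: integral_distr)
  also have "\<dots> = (\<integral>w. f (Y w) \<partial>N)" by (simp add: eq integral_distr)
  finally show ?thesis .
qed

locale stable_levy = stable_index \<alpha> + prob_space M for \<alpha> :: real and M :: "'a measure" +
  fixes L :: "real \<Rightarrow> 'a \<Rightarrow> real" and x :: real
  assumes levy: "spectrally_positive_stable_levy \<alpha> M L x"
begin

lemma L_measurable [measurable (raw)]: "t \<ge> 0 \<Longrightarrow> L t \<in> borel_measurable M"
  and AE_start: "AE w in M. L 0 w = x"
  and AE_cadlag: "AE w in M. cadlag (\<lambda>t. L t w)"
  and AE_no_negative_jumps: "AE w in M. no_negative_jumps (\<lambda>t. L t w)"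
  using levy by (auto simp: spectrally_positive_stable_levy_def levy_process_def)

lemma laplace_L1:
  assumes "u \<ge> 0"
  shows "has_bochner_integral M (\<lambda>w. exp (-(u * (L 1 w - L 0 w)))) (exp (u powr \<alpha>))"
proof -
  have "expectation (\<lambda>w. exp (- u * (L 1 w - L 0 w))) = exp (u powr \<alpha>)"
    using levy assms by (auto simp: spectrally_positive_stable_levy_def)
  moreover from this have "integrable M (\<lambda>w. exp (- u * (L 1 w - L 0 w)))"
    by (metis exp_not_eq_zero not_integrable_integral_eq)
  ultimately show ?thesis by (simp add: has_bochner_integral_iff)
qed

lemma imaginary_powr:
  assumes "y > 0"
  shows "(\<i> * complex_of_real y) powr of_real \<alpha> = rot * of_real (y powr \<alpha>)"
  using powr_of_real_cis[of y "pi / 2" \<alpha>] assms pi_gt_zero by (simp add: rot_def mult.commute)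

text \<open>The Laplace transform is continued to the open right half-plane; the imaginary axis is
  only its boundary and is reached as the limit of \<open>?z n\<close>. The real parts of these
  points are at most 1, so \<open>1 + exp (- X w)\<close> dominates whatever the sign of
  \<open>X w\<close>, and it is integrable because the Laplace transform is finite at 1.\<close>

lemma char_L1:
  assumes y: "y > 0"
  shows "(\<integral>w. exp (-(\<i> * of_real (y * (L 1 w - L 0 w)))) \<partial>M) = exp (rot * of_real (y powr \<alpha>))"
proof -
  define X where "X w = L 1 w - L 0 w" for w
  have X[measurable]: "X \<in> borel_measurable M" unfolding X_def by measurable
  let ?z = "\<lambda>n. of_real (1 / Suc n) + \<i> * of_real y"
  have "has_bochner_integral M (\<lambda>w. exp (-(z * of_real (X w)))) (exp (z powr of_real \<alpha>))"
    if z: "Re z \<in> {0<..}" for z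
  proof (rule complex_laplace_eqI[OF X, of "{0<..}"])
    show "has_bochner_integral M (\<lambda>w. exp (-(u * X w))) (exp (u powr \<alpha>))" if "u \<in> {0<..}" for u
      using laplace_L1[of u] that by (simp add: X_def)
    show "(\<lambda>z. exp (z powr of_real \<alpha>)) holomorphic_on {z. Re z \<in> {0<..}}"
      by (intro holomorphic_intros) (auto simp: complex_nonpos_Reals_iff)
    show "exp (complex_of_real u powr of_real \<alpha>) = of_real (exp (u powr \<alpha>))" if "u \<in> {0<..}" for u
      using that powr_of_real[of u \<alpha>] by (simp flip: exp_of_real)
  qed (use z in auto)
  then have eq: "(\<integral>w. exp (-(?z n * of_real (X w))) \<partial>M) = exp (?z n powr of_real \<alpha>)" for n
    by (auto simp: has_bochner_integral_iff)
  have z: "?z \<longlonglongrightarrow> 0 + \<i> * of_real y"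
  proof -
    have "(\<lambda>n. complex_of_real (inverse (real (Suc n))) + \<i> * of_real y) \<longlonglongrightarrow> of_real 0 + \<i> * of_real y"
      by (intro tendsto_intros LIMSEQ_inverse_real_of_nat)
    then show ?thesis by (simp only: inverse_eq_divide of_real_0)
  qed
  have "(\<lambda>n. \<integral>w. exp (-(?z n * of_real (X w))) \<partial>M) \<longlonglongrightarrow> (\<integral>w. exp (-((0 + \<i> * of_real y) * of_real (X w))) \<partial>M)"
  proof (rule integral_dominated_convergence[where w = "\<lambda>w. 1 + exp (- X w)"])
    show "integrable M (\<lambda>w. 1 + exp (- X w))"
      using laplace_L1[of 1] by (simp add: X_def has_bochner_integral_iff)
    have "exp (-(v / Suc n)) \<le> 1 + exp (- v)" for v :: real and n
    proof (cases "v \<ge> 0")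
      case True
      then have "exp (-(v / Suc n)) \<le> 1" by simp
      then show ?thesis using exp_ge_zero[of "-v"] by linarith
    next
      case False
      then have "- (v / Suc n) \<le> - v" by (simp add: field_simps mult_nonpos_nonneg)
      then have "exp (-(v / Suc n)) \<le> exp (- v)" by simp
      then show ?thesis by linarith
    qed
    then show "AE w in M. norm (exp (-(?z n * of_real (X w)))) \<le> 1 + exp (- X w)" for n
      by (intro AE_I2) (auto simp: field_simps)
    show "AE w in M. (\<lambda>n. exp (-(?z n * of_real (X w)))) \<longlonglongrightarrow> exp (-((0 + \<i> * of_real y) * of_real (X w)))"
      by (intro AE_I2 tendsto_intros z)
  qed auto
  moreover have "(\<lambda>n. exp (?z n powr of_real \<alpha>)) \<longlonglongrightarrow> exp ((0 + \<i> * of_real y) powr of_real \<alpha>)"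
    by (intro tendsto_intros z) (use y in \<open>auto simp: complex_nonpos_Reals_iff\<close>)
  ultimately have "(\<integral>w. exp (-((0 + \<i> * of_real y) * of_real (X w))) \<partial>M) = exp ((0 + \<i> * of_real y) powr of_real \<alpha>)"
    unfolding eq using LIMSEQ_unique by blast
  then show ?thesis using imaginary_powr[OF y] by (simp add: X_def mult.assoc)
qed

text \<open>Stationarity moves the increment to time 0, and strict stability turns the length
  \<open>h\<close> into the factor \<open>h powr (1 / \<alpha>)\<close> on \<open>y\<close>, whose
  power of exponent \<alpha> is \<open>h\<close>.\<close>

lemma char_increment:
  assumes y: "y > 0" and s: "s \<ge> 0" and h: "h > 0"
  shows "(\<integral>w. exp (-(\<i> * of_real (y * (L (s + h) w - L s w)))) \<partial>M) = exp (h * y powr \<alpha> * rot)"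
proof -
  have "eq_in_law M (\<lambda>w. L (s + h) w - L s w) M (\<lambda>w. L h w - L 0 w)"
    using levy s h by (auto simp: spectrally_positive_stable_levy_def levy_process_def)
  then have "(\<integral>w. exp (-(\<i> * of_real (y * (L (s + h) w - L s w)))) \<partial>M) =
      (\<integral>w. exp (-(\<i> * of_real (y * (L h w - L 0 w)))) \<partial>M)"
    by (rule eq_in_law_integral_eq) measurable
  also have "eq_in_law M (\<lambda>w. L (h * 1) w - L 0 w) M (\<lambda>w. h powr (1 / \<alpha>) * (L 1 w - L 0 w))"
    using levy h zero_le_one unfolding spectrally_positive_stable_levy_def strictly_stable_def by blast
  then have "(\<integral>w. exp (-(\<i> * of_real (y * (L h w - L 0 w)))) \<partial>M) =
      (\<integral>w. exp (-(\<i> * of_real (y * (h powr (1 / \<alpha>) * (L 1 w - L 0 w))))) \<partial>M)"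
    unfolding mult_1_right by (rule eq_in_law_integral_eq) measurable
  also have "\<dots> = exp (rot * of_real ((y * h powr (1 / \<alpha>)) powr \<alpha>))"
    using char_L1[of "y * h powr (1 / \<alpha>)"] y h by (simp add: mult.assoc)
  also have "(y * h powr (1 / \<alpha>)) powr \<alpha> = h * y powr \<alpha>"
    using y h \<alpha> by (simp add: powr_mult powr_powr)
  finally show ?thesis by (simp add: mult.commute)
qed

text \<open>The oscillating factor has modulus 1 and \<open>weight q\<close> is integrable, so
  Fubini applies without any moment of the increment.\<close>

lemma expectation_cairy_increment:
  assumes q: "q > 0" and s: "s \<ge> 0" and h: "h > 0"
  shows "(\<integral>w. cairy q (z + (L (s + h) w - L s w)) \<partial>M) =
    (\<integral>y. indicator {0<..} y *\<^sub>R (exp (-(\<i> * of_real (y * z))) * exp (h * y powr \<alpha> * rot) * weight q y) \<partial>lborel)"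
proof -
  interpret P: pair_sigma_finite lborel M ..
  define X where "X w = L (s + h) w - L s w" for w
  have X[measurable]: "X \<in> borel_measurable M" unfolding X_def using s h by (auto intro!: borel_measurable_diff L_measurable)
  let ?f = "\<lambda>y w. indicator {0<..} y *\<^sub>R (exp (-(\<i> * of_real (y * (z + X w)))) * weight q y)"
  have i: "integrable (lborel \<Otimes>\<^sub>M M) (case_prod ?f)"
  proof (rule P.Fubini_integrable)
    show "integrable lborel (\<lambda>y. \<integral>w. norm (case (y, w) of (y, w) \<Rightarrow> ?f y w) \<partial>M)"
      using integrable_norm_weight[OF q] by (simp add: norm_mult prob_space)
    show "AE y in lborel. integrable M (\<lambda>w. case (y, w) of (y, w) \<Rightarrow> ?f y w)"
      by (intro AE_I2) (auto intro!: integrable_const_bound[where B = "norm (weight q _)"] simp: norm_mult indicator_def)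
  qed measurable
  have "(\<integral>w. cairy q (z + X w) \<partial>M) = (\<integral>y. \<integral>w. ?f y w \<partial>M \<partial>lborel)"
    unfolding cairy_def by (rule P.Fubini_integral[OF i])
  also have "\<dots> = (\<integral>y. indicator {0<..} y *\<^sub>R (exp (-(\<i> * of_real (y * z))) * exp (h * y powr \<alpha> * rot) * weight q y) \<partial>lborel)"
  proof (rule Bochner_Integration.integral_cong)
    fix y :: real
    show "(\<integral>w. ?f y w \<partial>M) = indicator {0<..} y *\<^sub>R (exp (-(\<i> * of_real (y * z))) * exp (h * y powr \<alpha> * rot) * weight q y)"
    proof (cases "y > 0")
      case True
      have "(\<integral>w. ?f y w \<partial>M) = (\<integral>w. exp (-(\<i> * of_real (y * z))) * weight q y * exp (-(\<i> * of_real (y * X w))) \<partial>M)"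
        using True by (intro Bochner_Integration.integral_cong) (auto simp: algebra_simps simp flip: exp_add)
      also have "\<dots> = exp (-(\<i> * of_real (y * z))) * weight q y * exp (h * y powr \<alpha> * rot)"
        using char_increment[OF True s h] by (simp add: X_def)
      finally show ?thesis using True by simp
    qed simp
  qed simp
  finally show ?thesis by (simp add: X_def)
qed

definition step_error :: "real \<Rightarrow> real" where
  "step_error q = (\<integral>y. indicator {0<..} y * (y powr (2 * \<alpha>) * norm (weight q y)) \<partial>lborel)"

text \<open>In the Fourier representation the increment multiplies the integrand by
  \<open>exp (w y)\<close> with \<open>w y = h * y powr \<alpha> * rot\<close>. The constant term of
  its expansion returns \<open>airy q z\<close>, the linear term is \<open>h\<close> times the
  integral of \<open>cairy_generator\<close>, and the remainder is at most the square of
  \<open>norm (w y)\<close>. The error is uniform in \<open>z\<close>, since \<open>z\<close> enters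
  only through a factor of modulus 1; this matters because the positions of the walk are
  unbounded.\<close>

lemma airy_step:
  assumes q: "q > 0" and s: "s \<ge> 0" and h: "h > 0"
  shows "\<bar>(\<integral>w. airy q (z + (L (s + h) w - L s w)) \<partial>M) - (1 + q * h * z) * airy q z\<bar> \<le> step_error q * h\<^sup>2"
proof -
  define X where "X w = L (s + h) w - L s w" for w
  have X[measurable]: "X \<in> borel_measurable M" unfolding X_def using s h by (auto intro!: borel_measurable_diff L_measurable)
  define e where "e y = exp (-(\<i> * of_real (y * z)))" for y
  define w where "w y = h * y powr \<alpha> * rot" for y
  have Rew: "Re (w y) \<le> 0" for y using Re_rot h by (simp add: w_def mult_nonneg_nonpos)
  let ?A = "\<lambda>y. indicator {0<..} y *\<^sub>R (e y * exp (w y) * weight q y)"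
  let ?B = "\<lambda>y. indicator {0<..} y *\<^sub>R (e y * weight q y)"
  let ?C = "\<lambda>y. indicator {0<..} y *\<^sub>R (rot * of_real (y powr \<alpha>) * e y * weight q y)"
  have [measurable]: "e \<in> borel_measurable borel" "w \<in> borel_measurable borel"
    unfolding e_def w_def by measurable
  have ne: "norm (e y) = 1" for y by (simp add: e_def)
  have iA: "integrable lborel ?A"
    by (rule Bochner_Integration.integrable_bound[OF integrable_norm_weight[OF q]])
       (use Rew in \<open>auto simp: norm_mult ne intro!: AE_I2 mult_left_mono mult_left_le_one_le\<close>)
  have iB: "integrable lborel ?B" using integrable_cairy[OF q, of z] by (simp add: e_def)
  have C: "has_bochner_integral lborel ?C (q * z * cairy q z + \<i> * q)"
    using cairy_generator[OF q, of z] by (simp add: e_def)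
  then have iC: "integrable lborel ?C" by (simp add: has_bochner_integral_iff)
  have iE: "integrable lborel (\<lambda>y. h\<^sup>2 * (indicator {0<..} y * (y powr (2 * \<alpha>) * norm (weight q y))))"
    using integrable_powr_weight[OF q, of "2 * \<alpha> + 1"] \<alpha> by simp
  have "norm (\<integral>y. (?A y - ?B y) - of_real h * ?C y \<partial>lborel) \<le> 
     (\<integral>y. h\<^sup>2 * (indicator {0<..} y * (y powr (2 * \<alpha>) * norm (weight q y))) \<partial>lborel)"
  proof (rule Bochner_Integration.integral_norm_bound_integral[OF _ iE])
    show "integrable lborel (\<lambda>y. (?A y - ?B y) - of_real h * ?C y)"
      by (intro Bochner_Integration.integrable_diff integrable_mult_right iA iB iC)
    fix y :: real
    have "(?A y - ?B y) - of_real h * ?C y = indicator {0<..} y *\<^sub>R (e y * (exp (w y) - 1 - w y) * weight q y)"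
      by (auto simp: indicator_def w_def algebra_simps)
    then have "norm ((?A y - ?B y) - of_real h * ?C y) = indicator {0<..} y * (norm (exp (w y) - 1 - w y) * norm (weight q y))"
      by (simp add: norm_mult ne)
    also have "\<dots> \<le> indicator {0<..} y * ((norm (w y))\<^sup>2 * norm (weight q y))"
      by (intro mult_left_mono mult_right_mono norm_exp_minus_1_minus_le Rew) auto
    also have "\<dots> = h\<^sup>2 * (indicator {0<..} y * (y powr (2 * \<alpha>) * norm (weight q y)))"
      by (auto simp: w_def norm_mult power_mult_distrib indicator_def powr_power mult.commute)
    finally show "norm ((?A y - ?B y) - of_real h * ?C y) \<le> h\<^sup>2 * (indicator {0<..} y * (y powr (2 * \<alpha>) * norm (weight q y)))" .
  qed
  also have "\<dots> = step_error q * h\<^sup>2" by (simp add: step_error_def mult.commute)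
  also have "(\<integral>y. (?A y - ?B y) - of_real h * ?C y \<partial>lborel) =
      (\<integral>y. ?A y \<partial>lborel) - (\<integral>y. ?B y \<partial>lborel) - of_real h * (\<integral>y. ?C y \<partial>lborel)"
    by (simp only: Bochner_Integration.integral_diff[OF Bochner_Integration.integrable_diff[OF iA iB] integrable_mult_right[OF iC]]
      Bochner_Integration.integral_diff[OF iA iB] integral_mult_right_zero)
  also have "(\<integral>y. ?A y \<partial>lborel) = (\<integral>w. cairy q (z + X w) \<partial>M)"
    unfolding X_def expectation_cairy_increment[OF q s h] by (simp add: e_def w_def)
  also have "(\<integral>y. ?B y \<partial>lborel) = cairy q z" by (simp add: cairy_def e_def)
  also have "(\<integral>y. ?C y \<partial>lborel) = of_real q * of_real z * cairy q z + \<i> * of_real q"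
    using C by (simp add: has_bochner_integral_iff)
  \<comment> \<open>Passing to real parts discards the boundary contribution
    \<open>\<i> * q\<close>.\<close>
  finally have "\<bar>Re ((\<integral>w. cairy q (z + X w) \<partial>M) - cairy q z - of_real h * (of_real q * of_real z * cairy q z + \<i> * of_real q))\<bar> \<le> step_error q * h\<^sup>2"
    using abs_Re_le_cmod order_trans by blast
  moreover have "Re (\<integral>w. cairy q (z + X w) \<partial>M) = (\<integral>w. airy q (z + X w) \<partial>M)"
  proof -
    have [measurable]: "cairy q \<in> borel_measurable borel"
      using continuous_cairy[OF q] by (rule borel_measurable_continuous_onI)
    have "integrable M (\<lambda>w. cairy q (z + X w))"
      by (rule integrable_const_bound[where B = "airy_bound q"]) (auto simp: norm_cairy_le q)
    then show ?thesis by (simp add: airy_def)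
  qed
  ultimately show ?thesis by (simp add: airy_def[symmetric] X_def algebra_simps)
qed

end

section \<open>Stopping on a grid\<close>

text \<open>Along a sequence \<open>u\<close> of positions, \<open>alive e u k\<close> is the discounted indicator that none of
  \<open>u 0, \<dots>, u (k - 1)\<close> is negative, and \<open>stopped h e u k\<close> is the discounted value of \<open>h\<close> at the
  first negative position, or at \<open>u k\<close> if there is none up to then.\<close>

definition alive :: "real \<Rightarrow> (nat \<Rightarrow> real) \<Rightarrow> nat \<Rightarrow> real" where
  "alive e u k = (\<Prod>j<k. if u j \<ge> 0 then 1 / (1 + e * u j) else 0)"

definition stopped :: "(real \<Rightarrow> real) \<Rightarrow> real \<Rightarrow> (nat \<Rightarrow> real) \<Rightarrow> nat \<Rightarrow> real" where
  "stopped h e u k = (\<Sum>j\<le>k. alive e u j * (if u j < 0 then h (u j) else 0)) +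
     alive e u k * (if u k \<ge> 0 then h (u k) else 0)"

lemma alive_nonneg: "e \<ge> 0 \<Longrightarrow> alive e u k \<ge> 0"
  unfolding alive_def by (intro prod_nonneg) auto

lemma alive_le_1: "e \<ge> 0 \<Longrightarrow> alive e u k \<le> 1"
  unfolding alive_def
  by (intro prod_le_1) (auto simp: divide_le_eq_1 add_nonneg_nonneg mult_nonneg_nonneg intro: add_pos_nonneg)

lemma alive_Suc: "alive e u (Suc k) = alive e u k * (if u k \<ge> 0 then 1 / (1 + e * u k) else 0)"
  by (simp add: alive_def mult.commute)

lemma alive_eq_0: "u j < 0 \<Longrightarrow> j < k \<Longrightarrow> alive e u k = 0"
  unfolding alive_def by (intro prod_zero bexI[of _ j]) auto

text \<open>This cancellation is the reason for the discount \<open>1 / (1 + e * u j)\<close> in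
  place of an exponential. With \<open>e = q * d\<close> it removes exactly the factor
  \<open>1 + q * d * z\<close> of \<open>airy_step\<close>, and each step leaves only the quadratic
  error.\<close>

lemma alive_Suc_mult:
  assumes "e \<ge> 0"
  shows "alive e u (Suc k) * ((1 + e * u k) * y) = alive e u k * (if u k \<ge> 0 then y else 0)"
proof (cases "u k \<ge> 0")
  case True
  then have "1 + e * u k > 0" using assms by (simp add: add_pos_nonneg)
  then show ?thesis by (simp add: alive_Suc)
qed (simp add: alive_Suc)

lemma stopped_0: "stopped h e u 0 = h (u 0)"
  by (simp add: stopped_def alive_def)

lemma stopped_Suc:
  "stopped h e u (Suc k) = stopped h e u k + alive e u (Suc k) * h (u (Suc k)) -
     alive e u k * (if u k \<ge> 0 then h (u k) else 0)"
  by (simp add: stopped_def)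

lemma stopped_eq_hit:
  assumes "u j < 0" "\<And>i. i < j \<Longrightarrow> u i \<ge> 0" "j \<le> k"
  shows "stopped h e u k = alive e u j * h (u j)"
proof -
  have 0: "alive e u i = 0" if "j < i" for i by (rule alive_eq_0[of u j]) (use assms that in auto)
  have "(\<Sum>i\<le>k. alive e u i * (if u i < 0 then h (u i) else 0)) =
      (\<Sum>i\<in>{j}. alive e u i * (if u i < 0 then h (u i) else 0))"
  proof (rule sum.mono_neutral_right)
    show "\<forall>i\<in>{..k} - {j}. alive e u i * (if u i < 0 then h (u i) else 0) = 0"
    proof
      fix i assume "i \<in> {..k} - {j}"
      then consider "i < j" | "j < i" by fastforce
      then show "alive e u i * (if u i < 0 then h (u i) else 0) = 0"
        by cases (use assms(2)[of i] 0 in auto)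
    qed
  qed (use assms in auto)
  moreover have "alive e u k * (if u k \<ge> 0 then h (u k) else 0) = 0"
    using assms 0[of k] by (cases "j = k") auto
  ultimately show ?thesis using assms(1) by (simp add: stopped_def)
qed

lemma stopped_eq_alive:
  assumes "\<And>i. i \<le> k \<Longrightarrow> u i \<ge> 0"
  shows "stopped h e u k = alive e u k * h (u k)"
proof -
  have "(\<Sum>i\<le>k. alive e u i * (if u i < 0 then h (u i) else 0)) = 0"
    using assms by (intro sum.neutral) force
  then show ?thesis using assms by (simp add: stopped_def)
qed

text \<open>On each path the sum collapses to a single term, taken at the first negative position or
  at the horizon, and its discount is at most 1.\<close>

lemma abs_stopped_le:
  assumes "e \<ge> 0" "\<And>y. \<bar>h y\<bar> \<le> C"
  shows "\<bar>stopped h e u k\<bar> \<le> C"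
proof -
  have *: "\<bar>alive e u j * h y\<bar> \<le> C" for j y
  proof -
    have "\<bar>alive e u j * h y\<bar> = alive e u j * \<bar>h y\<bar>" using alive_nonneg[OF assms(1)] by (simp add: abs_mult)
    also have "\<dots> \<le> 1 * C" using alive_nonneg[OF assms(1)] alive_le_1[OF assms(1)] assms(2) by (intro mult_mono) auto
    finally show ?thesis by simp
  qed
  show ?thesis
  proof (cases "\<exists>j\<le>k. u j < 0")
    case True
    define j where "j = (LEAST j. u j < 0)"
    have "u j < 0" "j \<le> k" using True LeastI[of "\<lambda>j. u j < 0"] Least_le[of "\<lambda>j. u j < 0"] order_trans
      unfolding j_def by blast+
    moreover have "u i \<ge> 0" if "i < j" for i using not_less_Least[OF that[unfolded j_def]] by simp
    ultimately show ?thesis using * by (simp add: stopped_eq_hit)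
  next
    case False
    then show ?thesis using * by (subst stopped_eq_alive) (auto simp: not_less)
  qed
qed

lemma alive_measurable:
  assumes "\<And>j. j < k \<Longrightarrow> (\<lambda>v. u v j) \<in> borel_measurable M"
  shows "(\<lambda>v. alive e (u v) k) \<in> borel_measurable M"
  unfolding alive_def
proof (intro borel_measurable_prod)
  fix j assume "j \<in> {..<k}"
  then have [measurable]: "(\<lambda>v. u v j) \<in> borel_measurable M" using assms by simp
  show "(\<lambda>v. if u v j \<ge> 0 then 1 / (1 + e * u v j) else 0) \<in> borel_measurable M" by measurable
qed

lemma stopped_measurable:
  assumes u: "\<And>j. j \<le> k \<Longrightarrow> (\<lambda>v. u v j) \<in> borel_measurable M" and h[measurable]: "h \<in> borel_measurable borel"
  shows "(\<lambda>v. stopped h e (u v) k) \<in> borel_measurable M"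
proof -
  have [measurable]: "(\<lambda>v. alive e (u v) j) \<in> borel_measurable M" if "j \<le> k" for j
    using that by (intro alive_measurable u) auto
  have "(\<lambda>v. alive e (u v) j * (if u v j < 0 then h (u v j) else 0)) \<in> borel_measurable M"
       "(\<lambda>v. alive e (u v) j * (if u v j \<ge> 0 then h (u v j) else 0)) \<in> borel_measurable M" if j: "j \<le> k" for j
  proof -
    note [measurable] = u[OF j]
    have [measurable]: "(\<lambda>v. alive e (u v) j) \<in> borel_measurable M"
      using j by (intro alive_measurable u) auto
    show "(\<lambda>v. alive e (u v) j * (if u v j < 0 then h (u v j) else 0)) \<in> borel_measurable M"
       "(\<lambda>v. alive e (u v) j * (if u v j \<ge> 0 then h (u v j) else 0)) \<in> borel_measurable M"
      by measurable
  qed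
  then show ?thesis unfolding stopped_def by (intro borel_measurable_add borel_measurable_sum) auto
qed

section \<open>The expected stopped value along a grid\<close>

context stable_levy
begin

definition incr :: "real \<Rightarrow> nat \<Rightarrow> 'a \<Rightarrow> real" where
  "incr d i w = L (d * Suc i) w - L (d * i) w"

text \<open>Starting exactly at \<open>x\<close> makes the walk a function of the independent
  increments alone. It agrees with \<open>L\<close> on the grid only almost everywhere, because
  \<open>L 0 = x\<close> holds only almost everywhere.\<close>

definition walk :: "real \<Rightarrow> 'a \<Rightarrow> nat \<Rightarrow> real" where
  "walk d w j = x + (\<Sum>i<j. incr d i w)"

lemma walk_eq: "walk d w j = x + L (d * j) w - L 0 w"
  using sum_lessThan_telescope[of "\<lambda>i. L (d * real i) w" j] by (simp add: walk_def incr_def)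

lemma incr_measurable: "d \<ge> 0 \<Longrightarrow> incr d i \<in> borel_measurable M"
  unfolding incr_def[abs_def] by (auto intro!: borel_measurable_diff L_measurable)

lemma walk_measurable: "d \<ge> 0 \<Longrightarrow> (\<lambda>w. walk d w j) \<in> borel_measurable M"
  unfolding walk_def by (auto intro!: borel_measurable_add borel_measurable_sum incr_measurable)

text \<open>The past is kept as one random vector, so that independence from the next increment is
  independence of two variables and their joint law is a product measure. The next increment appears
  as a vector with the single coordinate \<open>k\<close>.\<close>

lemma indep_incr:
  assumes d: "d > 0"
  shows "indep_var (PiM {..<k} (\<lambda>_. borel)) (\<lambda>w. \<lambda>i\<in>{..<k}. incr d i w)
    (PiM {k} (\<lambda>_. borel)) (\<lambda>w. \<lambda>i\<in>{k}. incr d i w)"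
proof -
  have "indep_vars (\<lambda>_. borel) (\<lambda>i w. L (d * Suc i) w - L (d * i) w) {..<Suc k}"
  proof -
    have *: "\<And>n t. 0 \<le> t 0 \<and> (\<forall>i<n. t i < t (Suc i)) \<Longrightarrow>
        indep_vars (\<lambda>_. borel) (\<lambda>i w. L (t (Suc i)) w - L (t i) w) {..<n::nat}"
      using levy by (auto simp: spectrally_positive_stable_levy_def levy_process_def)
    show ?thesis using *[of "\<lambda>i. d * real i" "Suc k"] d by auto
  qed
  then have "indep_vars (\<lambda>_. borel) (incr d) {..<Suc k}" by (simp add: incr_def[abs_def])
  from indep_var_restrict[OF this, of "{..<k}" "{k}"] show ?thesis by auto
qed

text \<open>This is the martingale step without conditional expectations: the integral over the
  product law is evaluated with the past fixed, and \<open>airy_step\<close> bounds the inner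
  integral. The discount \<open>alive (q * d) (walk d w) (Suc k)\<close> involves only positions up
  to \<open>k\<close>, hence is constant in the inner integral.\<close>

lemma expectation_stopped_step:
  assumes q: "q > 0" and d: "d > 0"
  shows "\<bar>(\<integral>w. alive (q * d) (walk d w) (Suc k) * airy q (walk d w (Suc k)) -
      alive (q * d) (walk d w) k * (if walk d w k \<ge> 0 then airy q (walk d w k) else 0) \<partial>M)\<bar>
      \<le> step_error q * d\<^sup>2" (is "\<bar>?E\<bar> \<le> _")
proof -
  let ?P = "PiM {..<k} (\<lambda>_. borel :: real measure)"
  define V where "V w = (\<lambda>i\<in>{..<k}. incr d i w)" for w
  let ?Q = "PiM {k} (\<lambda>_. borel :: real measure)"
  define W where "W w = (\<lambda>i\<in>{k}. incr d i w)" for w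
  have Wk: "W w k = incr d k w" for w by (simp add: W_def)
  \<comment> \<open>The walk as a function of a deterministic vector of increments, needed to
    integrate over the law of the past.\<close>
  define u where "u v j = x + (\<Sum>i<j. v i)" for v :: "nat \<Rightarrow> real" and j
  have iv: "indep_var ?P V ?Q W" unfolding V_def W_def by (rule indep_incr[OF d])
  then have V[measurable]: "V \<in> measurable M ?P" and xi[measurable]: "W \<in> measurable M ?Q"
    and prod: "distr M ?P V \<Otimes>\<^sub>M distr M ?Q W = distr M (?P \<Otimes>\<^sub>M ?Q) (\<lambda>w. (V w, W w))"
    by (auto simp: indep_var_distribution_eq)
  interpret V: prob_space "distr M ?P V" by (rule prob_space_distr) simp
  interpret xi: prob_space "distr M ?Q W" by (rule prob_space_distr) simp
  interpret VX: pair_prob_space "distr M ?P V" "distr M ?Q W" ..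
  let ?A = "\<lambda>v. alive (q * d) (u v)"
  let ?F = "\<lambda>(v, r). ?A v (Suc k) * airy q (u v k + r k) - ?A v k * (if u v k \<ge> 0 then airy q (u v k) else 0)"
  have um: "(\<lambda>v. u v j) \<in> borel_measurable ?P" if "j \<le> k" for j
    unfolding u_def using that by (intro borel_measurable_add borel_measurable_sum measurable_component_singleton) auto
  note [measurable] = um[OF order_refl] airy_measurable[OF q]
  have [measurable]: "(\<lambda>v. ?A v k) \<in> borel_measurable ?P" "(\<lambda>v. ?A v (Suc k)) \<in> borel_measurable ?P"
    by (auto intro!: alive_measurable um)
  have F[measurable]: "?F \<in> borel_measurable (?P \<Otimes>\<^sub>M ?Q)" by measurable
  have e: "q * d \<ge> 0" using q d by simp
  have C0: "airy_bound q \<ge> 0" using abs_airy_le[OF q, of 0] by linarith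
  have ab: "\<bar>?A v j * y\<bar> \<le> airy_bound q" if "\<bar>y\<bar> \<le> airy_bound q" for v j y
  proof -
    have "\<bar>?A v j * y\<bar> = ?A v j * \<bar>y\<bar>" using alive_nonneg[OF e] by (simp add: abs_mult)
    also have "\<dots> \<le> 1 * airy_bound q" using alive_nonneg[OF e] alive_le_1[OF e] that by (intro mult_mono) auto
    finally show ?thesis by simp
  qed
  have Fb: "norm (?F p) \<le> 2 * airy_bound q" for p
  proof (cases p)
    case (Pair v r)
    have "\<bar>?A v (Suc k) * airy q (u v k + r k)\<bar> \<le> airy_bound q" by (intro ab abs_airy_le q)
    moreover have "\<bar>?A v k * (if u v k \<ge> 0 then airy q (u v k) else 0)\<bar> \<le> airy_bound q"
      using C0 abs_airy_le[OF q] by (intro ab) auto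
    ultimately show ?thesis unfolding Pair prod.case real_norm_def by linarith
  qed
  have iF: "integrable (distr M ?P V \<Otimes>\<^sub>M distr M ?Q W) ?F"
    by (rule VX.integrable_const_bound[where B = "2 * airy_bound q"]) (use Fb in auto)
  have "u (V w) j = walk d w j" if "j \<le> k" for j w
    unfolding u_def walk_def V_def using that by (intro arg_cong2[where f = "(+)"] sum.cong) auto
  then have walkV: "walk d w j = u (V w) j" if "j \<le> k" for j w using that by simp
  have aliveV: "alive (q * d) (walk d w) j = ?A (V w) j" if "j \<le> Suc k" for j w
    unfolding alive_def using that walkV by (intro prod.cong) auto
  have walkS: "walk d w (Suc k) = u (V w) k + incr d k w" for w
    using walkV[of k w] by (simp add: walk_def)
  have "?E =
      (\<integral>w. ?F (V w, W w) \<partial>M)"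
    by (simp add: walkS walkV aliveV Wk cong: if_cong)
  also have "\<dots> = (\<integral>p. ?F p \<partial>(distr M ?P V \<Otimes>\<^sub>M distr M ?Q W))"
    unfolding prod by (rule integral_distr[symmetric]) measurable
  also have "\<dots> = (\<integral>v. \<integral>r. ?F (v, r) \<partial>distr M ?Q W \<partial>distr M ?P V)"
    by (rule VX.integral_fst'[OF iF, symmetric])
  finally have eq: "?E =
      (\<integral>v. \<integral>r. ?F (v, r) \<partial>distr M ?Q W \<partial>distr M ?P V)" .
  have E: "\<bar>\<integral>r. ?F (v, r) \<partial>distr M ?Q W\<bar> \<le> step_error q * d\<^sup>2" for v
  proof -
    have [measurable]: "incr d k \<in> borel_measurable M" using d by (simp add: incr_measurable)
    have i: "integrable M (\<lambda>w. airy q (u v k + incr d k w))"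
      by (rule integrable_const_bound[where B = "airy_bound q"]) (auto simp: abs_airy_le q)
    have "(\<integral>r. ?F (v, r) \<partial>distr M ?Q W) = (\<integral>w. ?F (v, W w) \<partial>M)"
    proof (rule integral_distr[OF xi])
      have "(\<lambda>r. a * airy q (b + r k) - c) \<in> borel_measurable ?Q" for a b c by measurable
      then show "(\<lambda>r. ?F (v, r)) \<in> borel_measurable ?Q" by (simp only: prod.case)
    qed
    also have "\<dots> = ?A v (Suc k) * (\<integral>w. airy q (u v k + incr d k w) \<partial>M) - ?A v k * (if u v k \<ge> 0 then airy q (u v k) else 0)"
      using i by (simp add: prob_space Wk)
    \<comment> \<open>Here \<open>alive_Suc_mult\<close>, read backwards, gives the subtracted term
      the factor \<open>?A v (Suc k)\<close> as well, so that it can be pulled out.\<close>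
    also have "\<dots> = ?A v (Suc k) * ((\<integral>w. airy q (u v k + incr d k w) \<partial>M) - (1 + q * d * u v k) * airy q (u v k))"
      unfolding alive_Suc_mult[OF e, symmetric] by (simp add: algebra_simps)
    also have "\<bar>\<dots>\<bar> = ?A v (Suc k) * \<bar>(\<integral>w. airy q (u v k + incr d k w) \<partial>M) - (1 + q * d * u v k) * airy q (u v k)\<bar>"
      using alive_nonneg[OF e] by (simp add: abs_mult)
    also have "\<dots> \<le> 1 * (step_error q * d\<^sup>2)"
    proof (intro mult_mono alive_le_1 e)
      show "\<bar>(\<integral>w. airy q (u v k + incr d k w) \<partial>M) - (1 + q * d * u v k) * airy q (u v k)\<bar> \<le> step_error q * d\<^sup>2"
        using airy_step[OF q, of "d * real k" d "u v k"] d by (simp add: incr_def algebra_simps)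
    qed auto
    finally show ?thesis by simp
  qed
  define I where "I v = (\<integral>r. ?F (v, r) \<partial>distr M ?Q W)" for v
  have "integrable (distr M ?P V) I" unfolding I_def by (rule VX.integrable_fst'[OF iF])
  moreover have "\<bar>I v\<bar> \<le> step_error q * d\<^sup>2" for v unfolding I_def by (rule E)
  ultimately have "(\<integral>v. \<bar>I v\<bar> \<partial>distr M ?P V) \<le> step_error q * d\<^sup>2"
    by (intro V.integral_le_const) auto
  then have "\<bar>\<integral>v. I v \<partial>distr M ?P V\<bar> \<le> step_error q * d\<^sup>2"
    using integral_abs_bound[of "distr M ?P V" I] by linarith
  then show ?thesis by (simp only: eq I_def)
qed

lemma expectation_stopped_walk:
  assumes q: "q > 0" and d: "d > 0"
  shows "\<bar>(\<integral>w. stopped (airy q) (q * d) (walk d w) k \<partial>M) - airy q x\<bar> \<le> k * (step_error q * d\<^sup>2)"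
proof (induction k)
  case 0
  then show ?case by (simp add: stopped_0 walk_def prob_space)
next
  case (Suc k)
  have e: "q * d \<ge> 0" using q d by simp
  note [measurable] = airy_measurable[OF q]
  have wm: "\<And>j. (\<lambda>w. walk d w j) \<in> borel_measurable M" using d by (simp add: walk_measurable)
  let ?S = "\<lambda>k w. stopped (airy q) (q * d) (walk d w) k"
  let ?D = "\<lambda>w. alive (q * d) (walk d w) (Suc k) * airy q (walk d w (Suc k)) -
      alive (q * d) (walk d w) k * (if walk d w k \<ge> 0 then airy q (walk d w k) else 0)"
  have iS: "integrable M (?S k)" for k
    by (rule integrable_const_bound[where B = "airy_bound q"])
       (auto intro!: stopped_measurable wm abs_stopped_le e abs_airy_le q)
  have D: "?D = (\<lambda>w. ?S (Suc k) w - ?S k w)" by (auto simp: stopped_Suc)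
  have "\<bar>(\<integral>w. ?S (Suc k) w \<partial>M) - (\<integral>w. ?S k w \<partial>M)\<bar> \<le> step_error q * d\<^sup>2"
    using expectation_stopped_step[OF q d, of k] unfolding D Bochner_Integration.integral_diff[OF iS iS] .
  then have "\<bar>(\<integral>w. ?S (Suc k) w \<partial>M) - airy q x\<bar> \<le> step_error q * d\<^sup>2 + k * (step_error q * d\<^sup>2)"
    using Suc by linarith
  then show ?case by (simp add: algebra_simps)
qed

lemma expectation_stopped:
  fixes d :: real
  assumes q: "q > 0" and d: "d > 0"
  shows "\<bar>(\<integral>w. stopped (airy q) (q * d) (\<lambda>j. L (d * j) w) k \<partial>M) - airy q x\<bar> \<le> k * (step_error q * d\<^sup>2)"
proof -
  have "(\<integral>w. stopped (airy q) (q * d) (\<lambda>j. L (d * j) w) k \<partial>M) = (\<integral>w. stopped (airy q) (q * d) (walk d w) k \<partial>M)"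
  proof (rule integral_cong_AE)
    show "AE w in M. stopped (airy q) (q * d) (\<lambda>j. L (d * j) w) k = stopped (airy q) (q * d) (walk d w) k"
      using AE_start
    proof eventually_elim
      case (elim w)
      then have "walk d w = (\<lambda>j. L (d * j) w)" by (simp add: fun_eq_iff walk_eq)
      then show ?case by simp
    qed
  qed (use d q in \<open>auto intro!: stopped_measurable walk_measurable L_measurable airy_measurable\<close>)
  then show ?thesis using expectation_stopped_walk[OF q d] by simp
qed

end

section \<open>Cadlag paths\<close>

lemma cadlag_right_continuous:
  assumes "cadlag f" "t \<ge> 0"
  shows "continuous (at t within {t..}) f"
proof -
  have "(f \<longlongrightarrow> f t) (at_right t)" using assms by (auto simp: cadlag_def)
  then show ?thesis by (simp add: continuous_within at_within_Ici_at_right)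
qed

lemma cadlag_tendsto_right:
  assumes "cadlag f" "t \<ge> 0" "\<And>n. t \<le> s n" "s \<longlonglongrightarrow> t"
  shows "(\<lambda>n. f (s n)) \<longlonglongrightarrow> f t"
  using continuous_within_tendsto_compose'[OF cadlag_right_continuous[OF assms(1,2)], of s sequentially] assms(3,4)
  by auto

lemma cadlag_left_limit:
  assumes "cadlag f" "t > 0"
  obtains l where "(f \<longlongrightarrow> l) (at_left t)"
  using assms by (auto simp: cadlag_def)

lemma cadlag_locally_bounded:
  assumes "cadlag f" "t \<ge> 0"
  obtains B U where "open U" "t \<in> U" "\<And>s. s \<in> U \<Longrightarrow> s \<ge> 0 \<Longrightarrow> \<bar>f s\<bar> \<le> B"
proof -
  have lim_bound: "\<exists>B. \<forall>\<^sub>F s in F. \<bar>f s\<bar> \<le> B" if "(f \<longlongrightarrow> l) F" for l F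
  proof -
    have "\<forall>\<^sub>F s in F. dist (f s) l < 1" using that by (rule tendstoD) simp
    then have "\<forall>\<^sub>F s in F. \<bar>f s\<bar> \<le> \<bar>l\<bar> + 1" by eventually_elim (auto simp: dist_real_def)
    then show ?thesis by blast
  qed
  have "(f \<longlongrightarrow> f t) (at_right t)" using assms by (auto simp: cadlag_def)
  from lim_bound[OF this] obtain B1 where B1: "\<forall>\<^sub>F s in at_right t. \<bar>f s\<bar> \<le> B1" by blast
  have "\<exists>B. \<forall>\<^sub>F s in at_left t. s \<ge> 0 \<longrightarrow> \<bar>f s\<bar> \<le> B"
  proof (cases "t > 0")
    case True
    then obtain l where "(f \<longlongrightarrow> l) (at_left t)" using cadlag_left_limit[OF assms(1)] by blast
    then show ?thesis using lim_bound by (metis (mono_tags, lifting) eventually_mono)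
  next
    case False
    then have "\<forall>\<^sub>F s in at_left t. s \<ge> 0 \<longrightarrow> \<bar>f s\<bar> \<le> 0"
      using assms(2) by (auto simp: eventually_at_filter intro!: always_eventually)
    then show ?thesis by blast
  qed
  then obtain B2 where B2: "\<forall>\<^sub>F s in at_left t. s \<ge> 0 \<longrightarrow> \<bar>f s\<bar> \<le> B2" by blast
  let ?B = "max \<bar>f t\<bar> (max B1 B2)"
  have "\<forall>\<^sub>F s in at t. s \<ge> 0 \<longrightarrow> \<bar>f s\<bar> \<le> ?B"
    unfolding eventually_at_split using B1 B2 by (auto elim!: eventually_mono)
  then have "\<forall>\<^sub>F s in nhds t. s \<ge> 0 \<longrightarrow> \<bar>f s\<bar> \<le> ?B"
    unfolding eventually_at_filter by (rule eventually_mono) auto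
  then show thesis using that unfolding eventually_nhds by blast
qed

lemma cadlag_bounded:
  assumes "cadlag f"
  obtains B where "\<And>t. t \<in> {0..m} \<Longrightarrow> \<bar>f t\<bar> \<le> B"
proof -
  have "\<exists>U B. open U \<and> t \<in> U \<and> (\<forall>s\<in>U. s \<ge> 0 \<longrightarrow> \<bar>f s\<bar> \<le> B)" if "t \<in> {0..m}" for t
    using cadlag_locally_bounded[OF assms, of t] that by (metis atLeastAtMost_iff)
  then obtain U B where U: "\<And>t. t \<in> {0..m} \<Longrightarrow> open (U t) \<and> t \<in> U t \<and> (\<forall>s\<in>U t. s \<ge> 0 \<longrightarrow> \<bar>f s\<bar> \<le> B t)"
    by metis
  obtain C where C: "C \<subseteq> {0..m}" "finite C" "{0..m} \<subseteq> (\<Union>c\<in>C. U c)"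
    by (rule compactE_image[of "{0..m}" "{0..m}" U]) (use U in auto)
  have "\<bar>f t\<bar> \<le> (\<Sum>c\<in>C. \<bar>B c\<bar>)" if t: "t \<in> {0..m}" for t
  proof -
    obtain c where c: "c \<in> C" "t \<in> U c" using C t by blast
    then have "\<bar>f t\<bar> \<le> B c" using U C(1) t by auto
    also have "\<dots> \<le> (\<Sum>c\<in>C. \<bar>B c\<bar>)"
      using member_le_sum[OF c(1), of "\<lambda>c. \<bar>B c\<bar>"] C(2) by auto
    finally show ?thesis .
  qed
  then show thesis by (rule that)
qed

text \<open>Meaningful only for paths that become negative; otherwise it is the infimum of the empty
  set. The results about it therefore assume a time \<open>t\<close> with
  \<open>f t < 0\<close>.\<close>

definition first_neg :: "(real \<Rightarrow> real) \<Rightarrow> real" where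
  "first_neg f = Inf {t. t \<ge> 0 \<and> f t < 0}"

lemma first_neg_less_iff:
  assumes "t \<ge> 0" "f t < 0"
  shows "first_neg f < m \<longleftrightarrow> (\<exists>s. 0 \<le> s \<and> s < m \<and> f s < 0)"
proof -
  have "{t. t \<ge> 0 \<and> f t < 0} \<noteq> {}" "bdd_below {t. t \<ge> 0 \<and> f t < 0}"
    using assms by (auto intro: bdd_belowI[of _ 0])
  from cInf_less_iff[OF this, of m] show ?thesis by (auto simp: first_neg_def)
qed

lemma nonneg_at_left_limit:
  assumes "cadlag f" "no_negative_jumps f" "t > 0" "\<And>s. 0 \<le> s \<Longrightarrow> s < t \<Longrightarrow> f s \<ge> 0"
  shows "f t \<ge> 0"
proof -
  obtain l where l: "(f \<longlongrightarrow> l) (at_left t)" using cadlag_left_limit assms by blast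
  have "\<forall>\<^sub>F s in at_left t. f s \<ge> 0"
    using assms(3,4) by (auto simp: eventually_at_left[of 0] intro!: exI[of _ 0])
  then have "l \<ge> 0" using l by (intro tendsto_lowerbound[OF l]) auto
  also have "l \<le> f t" using l assms by (auto simp: no_negative_jumps_def)
  finally show ?thesis .
qed

text \<open>The two halves of \<open>f (first_neg f) = 0\<close> have different reasons. The value
  is not negative because the left limit is not and there is no downward jump. It is not positive
  because right continuity would then keep the path positive for a while, although negative values
  occur arbitrarily soon afterwards.\<close>

lemma first_neg:
  assumes f: "cadlag f" "no_negative_jumps f" "f 0 > 0" and ex: "t \<ge> 0" "f t < 0"
  shows first_neg_pos: "first_neg f > 0"
    and nonneg_before_first_neg: "\<And>s. 0 \<le> s \<Longrightarrow> s < first_neg f \<Longrightarrow> f s \<ge> 0"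
    and at_first_neg: "f (first_neg f) = 0"
    and neg_after_first_neg: "\<And>s. s > first_neg f \<Longrightarrow> \<exists>t. first_neg f < t \<and> t < s \<and> f t < 0"
proof -
  note less_iff = first_neg_less_iff[of t f, OF ex]
  show before: "f s \<ge> 0" if "0 \<le> s" "s < first_neg f" for s
    using less_iff[of "first_neg f"] that by (meson not_less order_less_irrefl)
  have "\<forall>\<^sub>F s in at_right 0. f s > 0"
    using f by (intro order_tendstoD[where y = "f 0"]) (auto simp: cadlag_def)
  then obtain b where b: "b > 0" "\<And>s. 0 < s \<Longrightarrow> s < b \<Longrightarrow> f s > 0"
    by (auto simp: eventually_at_right[of 0 1])
  have "\<not> first_neg f < b"
    unfolding less_iff using b f(3) by (metis less_eq_real_def not_less_iff_gr_or_eq)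
  then show pos: "first_neg f > 0" using b by linarith
  have nonneg: "f (first_neg f) \<ge> 0"
    by (rule nonneg_at_left_limit[OF f(1,2) pos before])
  show after: "\<exists>t. first_neg f < t \<and> t < s \<and> f t < 0" if s: "s > first_neg f" for s
  proof -
    obtain t where t: "0 \<le> t" "t < s" "f t < 0" using less_iff s by blast
    then have "first_neg f \<le> t" using before not_less by blast
    moreover have "t \<noteq> first_neg f" using nonneg t by auto
    ultimately show ?thesis using t by force
  qed
  have "f (first_neg f) \<le> 0"
  proof (rule ccontr)
    assume "\<not> ?thesis"
    then have "\<forall>\<^sub>F s in at_right (first_neg f). f s > 0"
      using f pos by (intro order_tendstoD[where y = "f (first_neg f)"]) (auto simp: cadlag_def)
    then obtain b where "b > first_neg f" "\<And>s. first_neg f < s \<Longrightarrow> s < b \<Longrightarrow> f s > 0"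
      by (auto simp: eventually_at_right[of _ "first_neg f + 1"])
    then show False using after by (meson not_less_iff_gr_or_eq)
  qed
  with nonneg show "f (first_neg f) = 0" by simp
qed

text \<open>Times are rounded up, not down, because cadlag paths are right continuous: the value at
  the rounded time then converges to the value at \<open>s\<close> for every
  \<open>s\<close>.\<close>

lemma
  fixes s :: real
  shows ceiling_grid: "s \<le> (1/2)^n * \<lceil>s * 2^n\<rceil>" "(1/2)^n * \<lceil>s * 2^n\<rceil> \<le> s + (1/2)^n"
    and ceiling_grid_tendsto: "(\<lambda>n. (1/2)^n * of_int \<lceil>s * 2^n\<rceil>) \<longlonglongrightarrow> s"
proof -
  show 1: "s \<le> (1/2)^n * \<lceil>s * 2^n\<rceil>" for n
    using le_of_int_ceiling[of "s * 2^n"] by (simp add: power_one_over field_simps)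
  show 2: "(1/2)^n * \<lceil>s * 2^n\<rceil> \<le> s + (1/2)^n" for n
    using of_int_ceiling_le_add_one[of "s * 2^n"] by (simp add: power_one_over field_simps)
  have "(\<lambda>n. s + (1/2)^n) \<longlonglongrightarrow> s + 0"
    by (intro tendsto_intros LIMSEQ_power_zero) simp
  then have "(\<lambda>n. s + (1/2)^n) \<longlonglongrightarrow> s" by simp
  from tendsto_sandwich[OF _ _ tendsto_const this]
  show "(\<lambda>n. (1/2)^n * of_int \<lceil>s * 2^n\<rceil>) \<longlonglongrightarrow> s"
    using 1 2 by auto
qed

lemma ceiling_grid_measurable:
  fixes f :: "real \<Rightarrow> real"
  shows "(\<lambda>s :: real. f ((1/2)^n * of_int \<lceil>s * 2^n\<rceil>)) \<in> borel_measurable borel"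
proof -
  have "(\<lambda>s::real. \<lceil>s * 2^n\<rceil>) \<in> measurable borel (count_space UNIV)" by measurable
  then show ?thesis by (rule measurable_compose) simp
qed

lemma cadlag_restrict_measurable:
  assumes "cadlag f"
  shows "(\<lambda>s. indicator {0<..<b} s * f s) \<in> borel_measurable borel"
proof (rule borel_measurable_LIMSEQ_real)
  show "(\<lambda>n. indicator {0<..<b} s * f ((1/2)^n * of_int \<lceil>s * 2^n\<rceil>)) \<longlonglongrightarrow> indicator {0<..<b} s * f s" for s
  proof (cases "s \<in> {0<..<b}")
    case True
    then show ?thesis
      by (intro tendsto_intros cadlag_tendsto_right[OF assms] ceiling_grid ceiling_grid_tendsto) auto
  qed simp
qed (intro borel_measurable_times borel_measurable_indicator ceiling_grid_measurable; simp)

lemma cadlag_integrable: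
  assumes "cadlag f"
  shows "integrable lborel (\<lambda>s. indicator {0<..<b} s * f s)"
proof -
  obtain B where B: "\<And>t. t \<in> {0..b} \<Longrightarrow> \<bar>f t\<bar> \<le> B" using cadlag_bounded[OF assms] by blast
  have "integrable lborel (\<lambda>s. indicator {0<..<b} s * B)"
    by (cases "0 \<le> b") auto
  then show ?thesis
  proof (rule Bochner_Integration.integrable_bound)
    show "(\<lambda>s. indicator {0<..<b} s * f s) \<in> borel_measurable lborel"
      using cadlag_restrict_measurable[OF assms] by simp
    have "norm (indicator {0<..<b} s * f s) \<le> norm (indicator {0<..<b} s * B)" for s
      using B[of s] by (cases "s \<in> {0<..<b}") auto
    then show "AE s in lborel. norm (indicator {0<..<b} s * f s) \<le> norm (indicator {0<..<b} s * B)"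
      by simp
  qed
qed

text \<open>The sum of right endpoint values is the integral of the step function obtained by
  rounding the time up, so that convergence of Riemann sums becomes dominated convergence.\<close>

lemma grid_sum_eq_integral:
  fixes f :: "real \<Rightarrow> real"
  shows "has_bochner_integral lborel
    (\<lambda>s. indicator {0<..(1/2)^n * real k} s * f ((1/2)^n * of_int \<lceil>s * 2^n\<rceil>)) ((1/2)^n * (\<Sum>j=1..k. f ((1/2)^n * real j)))"
proof (induction k)
  case 0
  then show ?case by (simp add: has_bochner_integral_zero)
next
  case (Suc k)
  let ?d = "(1/2)^n :: real"
  let ?I = "{?d * real k<..?d * real (Suc k)}"
  have d: "?d > 0" by simp
  let ?f = "\<lambda>s. f (?d * of_int \<lceil>s * 2^n\<rceil>)"
  have "has_bochner_integral lborel (\<lambda>s. indicator ?I s * f (?d * real (Suc k))) (measure lborel ?I * f (?d * real (Suc k)))"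
    by (intro has_bochner_integral_mult_left has_bochner_integral_real_indicator) auto
  also have "measure lborel ?I = ?d" by (simp add: algebra_simps)
  also have "(\<lambda>s. indicator ?I s * f (?d * real (Suc k))) = (\<lambda>s. indicator ?I s * ?f s)"
  proof
    fix s
    have "\<lceil>s * 2^n\<rceil> = int (Suc k)" if "s \<in> ?I"
      using that by (intro ceiling_unique) (auto simp: power_one_over field_simps)
    then show "indicator ?I s * f (?d * real (Suc k)) = indicator ?I s * ?f s"
      by (auto simp: indicator_def simp del: of_nat_Suc)
  qed
  finally have "has_bochner_integral lborel (\<lambda>s. indicator ?I s * ?f s) (?d * f (?d * real (Suc k)))" .
  from has_bochner_integral_add[OF Suc.IH this]
  have "has_bochner_integral lborel (\<lambda>s. indicator {0<..?d * real k} s * ?f s +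
      indicator ?I s * ?f s) (?d * (\<Sum>j=1..Suc k. f (?d * real j)))"
    by (simp add: algebra_simps)
  also have "(\<lambda>s. indicator {0<..?d * real k} s * ?f s + indicator ?I s * ?f s) =
      (\<lambda>s. indicator {0<..?d * real (Suc k)} s * ?f s)"
  proof
    fix s
    have ind: "indicator {0<..a} s * y + indicator {a<..b} s * y = indicator {0<..b} s * y"
      if "0 \<le> a" "a \<le> b" for a b y :: real
      using that by (auto simp: indicator_def)
    show "indicator {0<..?d * real k} s * ?f s + indicator ?I s * ?f s =
      indicator {0<..?d * real (Suc k)} s * ?f s"
      by (rule ind; intro mult_nonneg_nonneg mult_left_mono; simp)
  qed
  finally show ?case .
qed

lemma grid_sum_tendsto:
  fixes k :: "nat \<Rightarrow> nat"
  assumes f: "cadlag f" and k: "(\<lambda>n. (1/2)^n * real (k n)) \<longlonglongrightarrow> b" and km: "\<And>n. (1/2)^n * real (k n) \<le> m"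
  shows "(\<lambda>n. (1/2)^n * (\<Sum>j=1..k n. f ((1/2)^n * real j))) \<longlonglongrightarrow> (\<integral>s. indicator {0<..<b} s * f s \<partial>lborel)"
proof -
  \<comment> \<open>Rounding a time up may exceed \<open>m\<close> by one mesh, which is at most
    1.\<close>
  obtain B where B: "\<And>t. t \<in> {0..m + 1} \<Longrightarrow> \<bar>f t\<bar> \<le> B" using cadlag_bounded[OF f] by blast
  let ?c = "\<lambda>n s. (1/2)^n * of_int \<lceil>s * 2^n\<rceil>"
  let ?g = "\<lambda>n s. indicator {0<..(1/2)^n * real (k n)} s * f (?c n s)"
  have "(\<lambda>n. \<integral>s. ?g n s \<partial>lborel) \<longlonglongrightarrow> (\<integral>s. indicator {0<..<b} s * f s \<partial>lborel)"
  proof (rule integral_dominated_convergence[where w = "\<lambda>s. indicator {0<..m} s * B"])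
    show "integrable lborel (\<lambda>s. indicator {0<..m} s * B)" by (cases "0 \<le> m") auto
    \<comment> \<open>At \<open>s = b\<close> the indicators need not converge, because the grid
      endpoints may approach \<open>b\<close> from either side.\<close>
    have "AE s in lborel. s \<noteq> b" by (rule AE_lborel_singleton)
    then show "AE s in lborel. (\<lambda>n. ?g n s) \<longlonglongrightarrow> indicator {0<..<b} s * f s"
    proof eventually_elim
      case (elim s)
      have "(\<lambda>n. indicator {0<..(1/2)^n * real (k n)} s :: real) \<longlonglongrightarrow> indicator {0<..<b} s"
      proof (rule tendsto_eventually)
        show "\<forall>\<^sub>F n in sequentially. indicator {0<..(1/2)^n * real (k n)} s = (indicator {0<..<b} s :: real)"
        proof (cases "s < b")
          case True
          from order_tendstoD(1)[OF k True] show ?thesis by eventually_elim (use True in \<open>auto simp: indicator_def\<close>)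
        next
          case False
          then have "b < s" using elim by simp
          from order_tendstoD(2)[OF k this] show ?thesis by eventually_elim (use False in \<open>auto simp: indicator_def\<close>)
        qed
      qed
      then show ?case
      proof (cases "s > 0")
        case True
        then show ?thesis
          by (intro tendsto_mult \<open>(\<lambda>n. indicator {0<..(1/2)^n * real (k n)} s :: real) \<longlonglongrightarrow> indicator {0<..<b} s\<close>
            cadlag_tendsto_right[OF f] ceiling_grid ceiling_grid_tendsto) auto
      qed auto
    qed
    show "AE s in lborel. norm (?g n s) \<le> indicator {0<..m} s * B" for n
    proof (intro AE_I2)
      fix s
      show "norm (?g n s) \<le> indicator {0<..m} s * B"
      proof (cases "0 < s \<and> s \<le> (1/2)^n * real (k n)")
        case True
        have "(1/2)^n \<le> (1::real)" by (simp add: power_le_one)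
        then have "?c n s \<in> {0..m+1}"
          using ceiling_grid[where s = s and n = n] True km[of n] by auto
        then show ?thesis using B[of "?c n s"] True km[of n] by (auto simp: indicator_def)
      next
        case False
        have "0 \<le> B" if "0 < s" "s \<le> m" using abs_ge_zero[of "f s"] B[of s] that by (simp only: atLeastAtMost_iff) linarith
        then show ?thesis using False by (auto simp: indicator_def)
      qed
    qed
    show "(\<lambda>s. indicator {0<..<b} s * f s) \<in> borel_measurable lborel"
      using cadlag_restrict_measurable[OF f] by simp
    show "?g n \<in> borel_measurable lborel" for n
      unfolding measurable_lborel2
      by (intro borel_measurable_times borel_measurable_indicator ceiling_grid_measurable) simp
  qed
  then show ?thesis by (simp add: has_bochner_integral_integral_eq[OF grid_sum_eq_integral])
qed

definition area_before_neg :: "(real \<Rightarrow> real) \<Rightarrow> real" where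
  "area_before_neg f = (\<integral>s. indicator {0<..<first_neg f} s * f s \<partial>lborel)"

lemma grid_point_exists:
  fixes s b :: real
  assumes "0 \<le> s" "s < b"
  shows "\<forall>\<^sub>F n in sequentially. \<exists>j::nat. s < (1/2)^n * real j \<and> (1/2)^n * real j < b"
proof -
  have "(\<lambda>n. (1/2)^n :: real) \<longlonglongrightarrow> 0" by (rule LIMSEQ_power_zero) simp
  then have "\<forall>\<^sub>F n in sequentially. (1/2)^n < b - s" by (rule order_tendstoD(2)) (use assms in simp)
  then show ?thesis
  proof eventually_elim
    case (elim n)
    let ?j = "nat (\<lfloor>s * 2^n\<rfloor> + 1)"
    have r: "real ?j = of_int \<lfloor>s * 2^n\<rfloor> + 1" using assms by simp
    have "s * 2^n < real ?j" "real ?j \<le> s * 2^n + 1" unfolding r by linarith+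
    then have "s < (1/2)^n * real ?j" "(1/2)^n * real ?j \<le> s + (1/2)^n"
      by (simp_all add: power_one_over field_simps)
    then show ?case using elim by (intro exI[of _ ?j]) linarith
  qed
qed

text \<open>By right continuity one negative value forces negative values on an interval to its
  right, which contains a point of every sufficiently fine grid.\<close>

lemma grid_neg_exists:
  assumes f: "cadlag f" and t: "0 \<le> t" "t < b" "f t < 0"
  shows "\<forall>\<^sub>F n in sequentially. \<exists>j::nat. t < (1/2)^n * real j \<and> (1/2)^n * real j < b \<and> f ((1/2)^n * real j) < 0"
proof -
  have "\<forall>\<^sub>F s in at_right t. f s < 0"
    using f t by (intro order_tendstoD(2)[where y = "f t"]) (auto simp: cadlag_def)
  then obtain c where c: "c > t" "\<And>s. t < s \<Longrightarrow> s < c \<Longrightarrow> f s < 0"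
    by (auto simp: eventually_at_right[of t "t + 1"])
  have "t < min b c" using t c by simp
  from grid_point_exists[OF t(1) this] show ?thesis
    by eventually_elim (use c(2) in auto)
qed

section \<open>Limit of the stopped value under refinement of the grid\<close>

lemma ln_sum_approx:
  fixes v :: "nat \<Rightarrow> real"
  assumes "\<And>j. j < k \<Longrightarrow> 0 \<le> v j" "\<And>j. j < k \<Longrightarrow> v j \<le> c" "c \<le> 1"
  shows "\<bar>(\<Sum>j<k. ln (1 + v j)) - (\<Sum>j<k. v j)\<bar> \<le> k * c\<^sup>2"
proof -
  have "\<bar>(\<Sum>j<k. ln (1 + v j)) - (\<Sum>j<k. v j)\<bar> = \<bar>\<Sum>j<k. ln (1 + v j) - v j\<bar>"
    by (simp add: sum_subtractf)
  also have "\<dots> \<le> (\<Sum>j<k. \<bar>ln (1 + v j) - v j\<bar>)" by (rule sum_abs)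
  also have "\<dots> \<le> (\<Sum>j<k. c\<^sup>2)"
  proof (rule sum_mono)
    fix j assume "j \<in> {..<k}"
    then have v: "0 \<le> v j" "v j \<le> c" using assms by auto
    have "\<bar>ln (1 + v j) - v j\<bar> \<le> (v j)\<^sup>2"
      using abs_ln_one_plus_x_minus_x_bound_nonneg[of "v j"] v assms(3) by linarith
    also have "\<dots> \<le> c\<^sup>2" using v by (intro power_mono) auto
    finally show "\<bar>ln (1 + v j) - v j\<bar> \<le> c\<^sup>2" .
  qed
  finally show ?thesis by simp
qed

lemma alive_eq_exp:
  assumes "e \<ge> 0" "\<And>j. j < k \<Longrightarrow> u j \<ge> 0"
  shows "alive e u k = exp (- (\<Sum>j<k. ln (1 + e * u j)))"
proof -
  have "alive e u k = (\<Prod>j<k. exp (- ln (1 + e * u j)))"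
    unfolding alive_def
  proof (rule prod.cong)
    fix j assume "j \<in> {..<k}"
    then have "u j \<ge> 0" "1 + e * u j > 0" using assms by (auto intro: add_pos_nonneg)
    then show "(if u j \<ge> 0 then 1 / (1 + e * u j) else 0) = exp (- ln (1 + e * u j))"
      by (simp add: exp_minus inverse_eq_divide)
  qed simp
  then show ?thesis by (simp add: exp_sum sum_negf[symmetric])
qed

text \<open>The first negative grid time lies strictly after \<open>first_neg f\<close>, where the
  path is 0, and converges to it. By right continuity the position there tends to 0, so the payoff
  tends to \<open>h 0\<close>. The logarithm of the discount is, up to an error of the order of the
  mesh, \<open>- q\<close> times a Riemann sum of the area.\<close>

lemma stopped_tendsto_hit:
  fixes m :: nat
  assumes f: "cadlag f" "no_negative_jumps f" "f 0 > 0" and t: "0 \<le> t" "t < real m" "f t < 0"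
    and q: "q > 0" and h: "isCont h 0"
  shows "(\<lambda>n. stopped h (q * (1/2)^n) (\<lambda>j. f ((1/2)^n * real j)) (m * 2^n))
    \<longlonglongrightarrow> exp (-(q * area_before_neg f)) * h 0"
proof -
  let ?d = "\<lambda>n. (1/2)^n :: real"
  let ?S = "first_neg f"
  let ?u = "\<lambda>n j. f (?d n * real j)"
  define J where "J n = (LEAST j. ?u n j < 0)" for n
  note S_pos = first_neg_pos[OF f t(1,3)] and S_nonneg = nonneg_before_first_neg[OF f t(1,3)]
    and S_at = at_first_neg[OF f t(1,3)] and S_after = neg_after_first_neg[OF f t(1,3)]
  have d0: "?d \<longlonglongrightarrow> 0" by (rule LIMSEQ_power_zero) simp
  have "?S < real m" using first_neg_less_iff[of t f "real m"] t by auto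
  have ex: "\<forall>\<^sub>F n in sequentially. \<exists>j::nat. ?S < ?d n * real j \<and> ?d n * real j < b \<and> ?u n j < 0" if b: "?S < b" for b
  proof -
    obtain s where s: "?S < s" "s < b" "f s < 0" using S_after[OF b] by blast
    have "0 \<le> s" using s S_pos by linarith
    from grid_neg_exists[OF f(1) this s(2,3)] show ?thesis
      by eventually_elim (use s in force)
  qed
  have J: "\<forall>\<^sub>F n in sequentially. ?u n (J n) < 0 \<and> (\<forall>i<J n. ?u n i \<ge> 0) \<and> ?S < ?d n * real (J n) \<and> ?d n * real (J n) < b"
    if b: "?S < b" for b
    using ex[OF b]
  proof eventually_elim
    case (elim n)
    then obtain j :: nat where j: "?d n * real j < b" "?u n j < 0" by blast
    have 1: "?u n (J n) < 0" unfolding J_def by (rule LeastI[of _ j]) (rule j)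
    have 2: "?u n i \<ge> 0" if "i < J n" for i using not_less_Least[OF that[unfolded J_def]] by simp
    have "J n \<le> j" unfolding J_def by (rule Least_le) (rule j)
    then have "?d n * real (J n) \<le> ?d n * real j" by (intro mult_left_mono) auto
    then have "?d n * real (J n) < b" using j(1) by linarith
    moreover have "\<not> ?d n * real (J n) < ?S" using S_nonneg[of "?d n * real (J n)"] 1 by force
    moreover have "?d n * real (J n) \<noteq> ?S" using S_at 1 by auto
    ultimately show ?case using 1 2 j(1) by auto
  qed
  have Jlim: "(\<lambda>n. ?d n * real (J n)) \<longlonglongrightarrow> ?S"
  proof (rule order_tendstoI)
    show "\<forall>\<^sub>F n in sequentially. a < ?d n * real (J n)" if "a < ?S" for a
      using J[OF \<open>?S < real m\<close>] by eventually_elim (use that in auto)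
    show "\<forall>\<^sub>F n in sequentially. ?d n * real (J n) < b" if "?S < b" for b
      using J[OF that] by eventually_elim auto
  qed
  have J_ge_1: "J n \<ge> 1" if "?u n (J n) < 0" for n using that f(3) by (cases "J n") auto
  obtain B where B: "\<And>t. t \<in> {0..real m} \<Longrightarrow> \<bar>f t\<bar> \<le> B" using cadlag_bounded[OF f(1)] by blast
  have B0: "B \<ge> 0" using B[of 0] by simp
  have lim_h: "(\<lambda>n. h (?u n (J n))) \<longlonglongrightarrow> h 0"
  proof -
    \<comment> \<open>The grid time exceeds \<open>?S\<close> only eventually; the maximum puts
      every term of the sequence to the right of \<open>?S\<close>.\<close>
    have "(\<lambda>n. f (max ?S (?d n * real (J n)))) \<longlonglongrightarrow> f ?S"
    proof (rule cadlag_tendsto_right[OF f(1)])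
      show "(\<lambda>n. max ?S (?d n * real (J n))) \<longlonglongrightarrow> ?S"
        using tendsto_max[OF tendsto_const Jlim, of ?S] by simp
    qed (use S_pos in auto)
    then have "(\<lambda>n. ?u n (J n)) \<longlonglongrightarrow> 0"
      unfolding S_at
    proof (rule Lim_transform_eventually)
      show "\<forall>\<^sub>F n in sequentially. f (max ?S (?d n * real (J n))) = ?u n (J n)"
        using J[OF \<open>?S < real m\<close>] by eventually_elim (auto simp: max_def)
    qed
    then show ?thesis by (rule isCont_tendsto_compose[OF h])
  qed
  have lim_sum: "(\<lambda>n. ?d n * (\<Sum>j<J n. ?u n j)) \<longlonglongrightarrow> area_before_neg f"
  proof -
    \<comment> \<open>The discount runs over \<open>j < J n\<close>, the Riemann sums over
      \<open>j = 1..k\<close>, whence the shift by one; the missing term \<open>?d n * f 0\<close>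
      vanishes in the limit. The minimum enforces for every \<open>n\<close> a bound that holds for
      \<open>J n\<close> only eventually.\<close>
    define k where "k n = min (J n - 1) (m * 2^n)" for n
    have keq: "\<forall>\<^sub>F n in sequentially. Suc (k n) = J n"
      using J[OF \<open>?S < real m\<close>]
    proof eventually_elim
      case (elim n)
      then have "real (J n) \<le> real (m * 2^n)" by (simp add: power_one_over field_simps)
      then have "J n \<le> m * 2^n" by (simp only: of_nat_le_iff)
      then show ?case using J_ge_1[of n] elim by (simp add: k_def)
    qed
    have "(\<lambda>n. ?d n * (\<Sum>j=1..k n. ?u n j)) \<longlonglongrightarrow> area_before_neg f"
      unfolding area_before_neg_def
    proof (rule grid_sum_tendsto[OF f(1), of k _ "real m"])
      have "(\<lambda>n. ?d n * real (J n) - ?d n) \<longlonglongrightarrow> ?S - 0" by (intro tendsto_intros Jlim d0)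
      then have "(\<lambda>n. ?d n * real (J n) - ?d n) \<longlonglongrightarrow> ?S" by simp
      then show "(\<lambda>n. ?d n * real (k n)) \<longlonglongrightarrow> ?S"
      proof (rule Lim_transform_eventually)
        show "\<forall>\<^sub>F n in sequentially. ?d n * real (J n) - ?d n = ?d n * real (k n)"
          using keq
        proof eventually_elim
          case (elim n)
          then show ?case by (simp flip: elim add: algebra_simps)
        qed
      qed
      show "?d n * real (k n) \<le> real m" for n
      proof -
        have "real (k n) \<le> real (m * 2^n)" by (simp only: of_nat_le_iff k_def)
        then show ?thesis by (simp add: power_one_over field_simps)
      qed
    qed
    then have "(\<lambda>n. ?d n * f 0 + ?d n * (\<Sum>j=1..k n. ?u n j)) \<longlonglongrightarrow> 0 * f 0 + area_before_neg f"
      by (intro tendsto_intros d0)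
    then have "(\<lambda>n. ?d n * f 0 + ?d n * (\<Sum>j=1..k n. ?u n j)) \<longlonglongrightarrow> area_before_neg f" by simp
    then show ?thesis
    proof (rule Lim_transform_eventually)
      show "\<forall>\<^sub>F n in sequentially. ?d n * f 0 + ?d n * (\<Sum>j=1..k n. ?u n j) = ?d n * (\<Sum>j<J n. ?u n j)"
        using keq
      proof eventually_elim
        case (elim n)
        have "(\<Sum>j<Suc (k n). ?u n j) = f 0 + (\<Sum>j=1..k n. ?u n j)"
          by (subst sum.lessThan_Suc_shift) (simp add: sum.atLeast1_atMost_eq lessThan_atLeast0)
        then show ?case unfolding elim by (simp add: algebra_simps)
      qed
    qed
  qed
  let ?v = "\<lambda>n j. q * ?d n * ?u n j"
  have lim_ln: "(\<lambda>n. \<Sum>j<J n. ln (1 + ?v n j)) \<longlonglongrightarrow> q * area_before_neg f"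
  proof -
    have c0: "(\<lambda>n. q * ?d n * B) \<longlonglongrightarrow> 0" using tendsto_mult[OF tendsto_mult[OF tendsto_const d0] tendsto_const, of q B] by simp
    then have c1: "\<forall>\<^sub>F n in sequentially. q * ?d n * B < 1" by (rule order_tendstoD) simp
    have "(\<lambda>n. (\<Sum>j<J n. ln (1 + ?v n j)) - (\<Sum>j<J n. ?v n j)) \<longlonglongrightarrow> 0"
    proof (rule Lim_null_comparison)
      show "\<forall>\<^sub>F n in sequentially. norm ((\<Sum>j<J n. ln (1 + ?v n j)) - (\<Sum>j<J n. ?v n j)) \<le> (?d n * real (J n)) * (?d n * (q * B)\<^sup>2)"
        using J[OF \<open>?S < real m\<close>] c1
      proof eventually_elim
        case (elim n)
        have "\<bar>(\<Sum>j<J n. ln (1 + ?v n j)) - (\<Sum>j<J n. ?v n j)\<bar> \<le> J n * (q * ?d n * B)\<^sup>2"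
        proof (rule ln_sum_approx)
          fix j assume j: "j < J n"
          then have u: "?u n j \<ge> 0" using elim by blast
          then show "0 \<le> ?v n j" using q by simp
          have "?d n * real j \<le> ?d n * real (J n)" using j by (intro mult_left_mono) auto
          moreover have "?d n * real (J n) < real m" using elim by blast
          ultimately have "?d n * real j \<le> real m" by linarith
          then have "?u n j \<le> B" using B[of "?d n * real j"] by auto
          then show "?v n j \<le> q * ?d n * B" using q by (intro mult_left_mono) auto
        qed (use elim in simp)
        also have "J n * (q * ?d n * B)\<^sup>2 = (?d n * real (J n)) * (?d n * (q * B)\<^sup>2)"
          by (simp add: power2_eq_square)
        finally show ?case by simp
      qed
      have "(\<lambda>n. (?d n * real (J n)) * (?d n * (q * B)\<^sup>2)) \<longlonglongrightarrow> ?S * (0 * (q * B)\<^sup>2)"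
        by (intro tendsto_intros Jlim d0)
      then show "(\<lambda>n. (?d n * real (J n)) * (?d n * (q * B)\<^sup>2)) \<longlonglongrightarrow> 0" by simp
    qed
    from tendsto_add[OF this tendsto_mult[OF tendsto_const lim_sum, of q]]
    show ?thesis by (simp add: sum_distrib_left mult.assoc)
  qed
  have "(\<lambda>n. exp (- (\<Sum>j<J n. ln (1 + ?v n j))) * h (?u n (J n))) \<longlonglongrightarrow> exp (- (q * area_before_neg f)) * h 0"
    by (rule tendsto_mult[OF tendsto_exp[OF tendsto_minus[OF lim_ln]] lim_h])
  then show ?thesis
  proof (rule Lim_transform_eventually)
    show "\<forall>\<^sub>F n in sequentially. exp (- (\<Sum>j<J n. ln (1 + ?v n j))) * h (?u n (J n)) = stopped h (q * ?d n) (?u n) (m * 2^n)"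
      using J[OF \<open>?S < real m\<close>]
    proof eventually_elim
      case (elim n)
      then have "real (J n) \<le> real (m * 2^n)" by (simp add: power_one_over field_simps)
      then have "J n \<le> m * 2^n" by (simp only: of_nat_le_iff)
      then have "stopped h (q * ?d n) (?u n) (m * 2^n) = alive (q * ?d n) (?u n) (J n) * h (?u n (J n))"
        using elim by (intro stopped_eq_hit) auto
      also have "alive (q * ?d n) (?u n) (J n) = exp (- (\<Sum>j<J n. ln (1 + ?v n j)))"
        using elim q by (intro alive_eq_exp) auto
      finally show ?case by simp
    qed
  qed
qed

text \<open>Nonnegativity is assumed strictly before \<open>m\<close>; at \<open>m\<close> itself it
  follows from the absence of negative jumps. Only the value at the horizon then
  contributes.\<close>

lemma abs_stopped_no_hit:
  fixes m :: nat
  assumes f: "cadlag f" "no_negative_jumps f" and m: "m > 0" and q: "q > 0"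
    and nonneg: "\<And>t. 0 \<le> t \<Longrightarrow> t < real m \<Longrightarrow> f t \<ge> 0"
  shows "\<bar>stopped h (q * (1/2)^n) (\<lambda>j. f ((1/2)^n * real j)) (m * 2^n)\<bar> \<le> \<bar>h (f m)\<bar>"
proof -
  let ?u = "\<lambda>j. f ((1/2)^n * real j)"
  have fm: "f m \<ge> 0" by (rule nonneg_at_left_limit[OF f _ nonneg]) (use m in auto)
  have "?u i \<ge> 0" if "i \<le> m * 2^n" for i
  proof -
    have "real i \<le> real (m * 2^n)" using that by (simp only: of_nat_le_iff)
    then have "(1/2)^n * real i \<le> real m" by (simp add: power_one_over field_simps)
    then show ?thesis using nonneg[of "(1/2)^n * real i"] fm by (cases "(1/2)^n * real i = real m") auto
  qed
  then have "stopped h (q * (1/2)^n) ?u (m * 2^n) = alive (q * (1/2)^n) ?u (m * 2^n) * h (?u (m * 2^n))"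
    by (rule stopped_eq_alive)
  also have "?u (m * 2^n) = f m" by (simp add: power_one_over)
  finally have "\<bar>stopped h (q * (1/2)^n) ?u (m * 2^n)\<bar> = alive (q * (1/2)^n) ?u (m * 2^n) * \<bar>h (f m)\<bar>"
    using alive_nonneg[of "q * (1/2)^n"] q by (simp add: abs_mult)
  also have "\<dots> \<le> 1 * \<bar>h (f m)\<bar>" using q by (intro mult_right_mono alive_le_1) auto
  finally show ?thesis by simp
qed

section \<open>Decay of the expected absolute value of \<open>airy\<close> at large times\<close>

lemma integrable_exp_minus:
  "integrable lborel (\<lambda>y. indicator {0<..} y * exp (-y) :: real)"
proof -
  have "integrable lborel (\<lambda>y. indicator {0<..} y * (y powr (1 - 1) * exp (-y)) :: real)"
    by (rule integrable.intros[OF has_bochner_integral_Gamma]) simp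
  also have "(\<lambda>y. indicator {0<..} y * (y powr (1 - 1) * exp (-y)) :: real) = (\<lambda>y. indicator {0<..} y * exp (-y))"
    by (auto simp: indicator_def)
  finally show ?thesis .
qed

context stable_levy
begin

text \<open>1/(1 + v^2) is the real part of 1/(1 + i v), which is the integral of exp (-(1 + i v) y)
  over y > 0. After Fubini the characteristic function of the increment supplies the bound, so the
  spreading of \<open>L\<close> is seen without its density.\<close>

lemma Cauchy_expectation_le:
  assumes h: "h > 0"
  shows "(\<integral>w. 1 / (1 + (z + (L h w - L 0 w))\<^sup>2) \<partial>M) \<le>
    (\<integral>y. indicator {0<..} y * (exp (-y) * exp (h * y powr \<alpha> * Re rot)) \<partial>lborel)"
proof -
  interpret P: pair_sigma_finite lborel M ..
  define X where "X w = L h w - L 0 w" for w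
  have X[measurable]: "X \<in> borel_measurable M" unfolding X_def using h by (auto intro!: borel_measurable_diff L_measurable)
  note E = integrable_exp_minus
  let ?f = "\<lambda>y w. indicator {0<..} y *\<^sub>R exp (-((1 + \<i> * of_real (z + X w)) * of_real y))"
  have f_eq: "(\<integral>y. ?f y w \<partial>lborel) = 1 / (1 + \<i> * of_real (z + X w))" for w
  proof -
    have hb: "has_bochner_integral lborel
           (\<lambda>y. indicator {0<..} y *\<^sub>R (of_real (y powr (1 - 1)) * exp (-((1 + \<i> * of_real (z + X w)) * of_real (y powr 1)))))
           (of_real (Gamma (1 / 1) / 1) * (1 + \<i> * of_real (z + X w)) powr (- of_real (1 / 1)))"
      by (rule has_bochner_integral_powr_cexp) auto
    have eqf: "indicator {0<..} y *\<^sub>R (of_real (y powr (1 - 1)) * exp (-((1 + \<i> * of_real (z + X w)) * of_real (y powr 1)))) = ?f y w" for y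
      by (auto simp: indicator_def)
    have "1 + \<i> * complex_of_real (z + X w) \<noteq> 0" by (auto simp: complex_eq_iff)
    then show ?thesis
      using has_bochner_integral_integral_eq[OF hb[unfolded eqf]]
      by (simp add: powr_minus powr_to_1 inverse_eq_divide)
  qed
  have i: "integrable (lborel \<Otimes>\<^sub>M M) (case_prod ?f)"
  proof (rule P.Fubini_integrable)
    show "integrable lborel (\<lambda>y. \<integral>w. norm (case (y, w) of (y, w) \<Rightarrow> ?f y w) \<partial>M)"
      using E by (simp add: prob_space)
    show "AE y in lborel. integrable M (\<lambda>w. case (y, w) of (y, w) \<Rightarrow> ?f y w)"
      by (intro AE_I2) (auto intro!: integrable_const_bound[where B = "exp (- _)"] simp: indicator_def)
  qed measurable
  have "(\<integral>w. 1 / (1 + (z + X w)\<^sup>2) \<partial>M) = (\<integral>w. Re (1 / (1 + \<i> * of_real (z + X w))) \<partial>M)"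
    by (simp add: Re_divide power2_eq_square)
  also have "\<dots> = Re (\<integral>w. 1 / (1 + \<i> * of_real (z + X w)) \<partial>M)"
  proof (rule integral_Re)
    show "integrable M (\<lambda>w. 1 / (1 + \<i> * of_real (z + X w)))"
      using P.integrable_snd[OF i] by (simp only: prod.case f_eq)
  qed
  also have "\<dots> = Re (\<integral>w. \<integral>y. ?f y w \<partial>lborel \<partial>M)" unfolding f_eq ..
  also have "\<dots> = Re (\<integral>y. \<integral>w. ?f y w \<partial>M \<partial>lborel)" by (simp only: P.Fubini_integral[OF i])
  also have "\<dots> \<le> norm (\<integral>y. \<integral>w. ?f y w \<partial>M \<partial>lborel)" by (rule complex_Re_le_cmod)
  also have "\<dots> \<le> (\<integral>y. indicator {0<..} y * (exp (-y) * exp (h * y powr \<alpha> * Re rot)) \<partial>lborel)"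
  proof (rule Bochner_Integration.integral_norm_bound_integral)
    show "integrable lborel (\<lambda>y. \<integral>w. ?f y w \<partial>M)"
      using P.integrable_fst[OF i] by simp
    show "integrable lborel (\<lambda>y. indicator {0<..} y * (exp (-y) * exp (h * y powr \<alpha> * Re rot)))"
      by (rule Bochner_Integration.integrable_bound[OF E])
        (use Re_rot h in \<open>auto simp: indicator_def mult_nonneg_nonpos intro!: AE_I2\<close>)
    fix y :: real
    show "norm (\<integral>w. ?f y w \<partial>M) \<le> indicator {0<..} y * (exp (-y) * exp (h * y powr \<alpha> * Re rot))"
    proof (cases "y > 0")
      case True
      have "(\<integral>w. ?f y w \<partial>M) = (\<integral>w. exp (-(of_real y + \<i> * of_real (y * z))) * exp (-(\<i> * of_real (y * X w))) \<partial>M)"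
        using True by (intro Bochner_Integration.integral_cong) (auto simp: algebra_simps simp flip: exp_add)
      also have "\<dots> = exp (-(of_real y + \<i> * of_real (y * z))) * exp (h * y powr \<alpha> * rot)"
        using char_increment[OF True order_refl h] by (simp add: X_def)
      finally have "(\<integral>w. ?f y w \<partial>M) = exp (-(of_real y + \<i> * of_real (y * z))) * exp (h * y powr \<alpha> * rot)" .
      then show ?thesis using True by (simp only: norm_mult norm_exp_eq_Re) simp
    qed simp
  qed
  finally show ?thesis by (simp add: X_def)
qed

lemma Cauchy_bound_tendsto_0:
  "(\<lambda>m. \<integral>y. indicator {0<..} y * (exp (-y) * exp (real m * y powr \<alpha> * Re rot)) \<partial>lborel) \<longlonglongrightarrow> 0"
proof -
  note E = integrable_exp_minus
  have "(\<lambda>m. \<integral>y. indicator {0<..} y * (exp (-y) * exp (real m * y powr \<alpha> * Re rot)) \<partial>lborel) \<longlonglongrightarrow> (\<integral>y. 0 \<partial>(lborel :: real measure))"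
  proof (rule integral_dominated_convergence[OF _ _ E])
    show "AE y in lborel. (\<lambda>m. indicator {0<..} y * (exp (-y) * exp (real m * y powr \<alpha> * Re rot))) \<longlonglongrightarrow> 0"
    proof (intro AE_I2)
      fix y :: real
      show "(\<lambda>m. indicator {0<..} y * (exp (-y) * exp (real m * y powr \<alpha> * Re rot))) \<longlonglongrightarrow> 0"
      proof (cases "y > 0")
        case True
        have "(\<lambda>m. exp (y powr \<alpha> * Re rot) ^ m) \<longlonglongrightarrow> 0"
          using True Re_rot by (intro LIMSEQ_power_zero) (auto simp: mult_pos_neg)
        then have "(\<lambda>m. exp (real m * y powr \<alpha> * Re rot)) \<longlonglongrightarrow> 0"
          by (simp add: exp_of_nat_mult[symmetric] mult.assoc)
        then have "(\<lambda>m. exp (-y) * exp (real m * y powr \<alpha> * Re rot)) \<longlonglongrightarrow> exp (-y) * 0"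
          by (rule tendsto_mult_left)
        then show ?thesis using True by simp
      qed simp
    qed
    show "AE y in lborel. norm (indicator {0<..} y * (exp (-y) * exp (real m * y powr \<alpha> * Re rot))) \<le> indicator {0<..} y * exp (-y)" for m
      using Re_rot by (intro AE_I2) (auto simp: indicator_def mult_nonneg_nonpos)
  qed auto
  then show ?thesis by simp
qed

text \<open>Boundedness and \<open>airy_decay\<close> together bound the square of
  \<open>airy q v\<close> by a multiple of 1/(1 + v^2), whose expectation tends to 0.\<close>

lemma expectation_abs_airy_tendsto_0:
  assumes q: "q > 0"
  shows "(\<lambda>m. \<integral>w. \<bar>airy q (L (real m) w)\<bar> \<partial>M) \<longlonglongrightarrow> 0"
proof -
  note [measurable] = airy_measurable[OF q]
  define K where "K = (airy_bound q)\<^sup>2 + (airy_decay q)\<^sup>2"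
  define c where "c m = (\<integral>y. indicator {0<..} y * (exp (-y) * exp (real m * y powr \<alpha> * Re rot)) \<partial>lborel)" for m
  have K0: "K \<ge> 0" by (simp add: K_def)
  have sq: "(airy q v)\<^sup>2 \<le> K * (1 / (1 + v\<^sup>2))" for v
  proof -
    have "(airy q v)\<^sup>2 \<le> (airy_bound q)\<^sup>2"
      using abs_airy_le[OF q, of v] by (rule power2_le_iff_abs_le[THEN iffD2, rotated]) (use abs_airy_le[OF q, of v] in linarith)
    moreover have "(v * airy q v)\<^sup>2 \<le> (airy_decay q)\<^sup>2"
      using airy_decay[OF q, of v] by (rule power2_le_iff_abs_le[THEN iffD2, rotated]) (use airy_decay[OF q, of v] in linarith)
    ultimately have "(airy q v)\<^sup>2 * (1 + v\<^sup>2) \<le> K" by (simp add: K_def power_mult_distrib algebra_simps)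
    moreover have "1 + v\<^sup>2 > 0" by (simp add: add_pos_nonneg)
    ultimately show ?thesis by (simp add: field_simps)
  qed
  have bound: "(\<integral>w. \<bar>airy q (L (real m) w)\<bar> \<partial>M) \<le> e + K / e * c m" if m: "m > 0" and e: "e > 0" for m e
  proof -
    have Lm[measurable]: "L (real m) \<in> borel_measurable M" by (simp add: L_measurable)
    \<comment> \<open>Passage from the absolute value to the square: e a is at most e^2 + a^2,
      divided by e. The free parameter is later half of the target accuracy.\<close>
    have ineq: "\<bar>airy q v\<bar> \<le> e + K / e * (1 / (1 + v\<^sup>2))" for v
    proof -
      have "0 \<le> (e - \<bar>airy q v\<bar>)\<^sup>2" "0 \<le> e * \<bar>airy q v\<bar>" using e by auto
      then have "e * \<bar>airy q v\<bar> \<le> e\<^sup>2 + (airy q v)\<^sup>2" by (simp add: power2_eq_square algebra_simps)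
      then have "\<bar>airy q v\<bar> \<le> e + (airy q v)\<^sup>2 / e" using e by (simp add: field_simps power2_eq_square)
      also have "(airy q v)\<^sup>2 / e \<le> K * (1 / (1 + v\<^sup>2)) / e" using e by (intro divide_right_mono sq) auto
      finally show ?thesis by (simp add: mult.commute)
    qed
    have iC: "integrable M (\<lambda>w. 1 / (1 + (L (real m) w)\<^sup>2))"
    proof (rule integrable_const_bound[where B = 1])
      have "norm (1 / (1 + v\<^sup>2)) \<le> 1" for v :: real by (simp add: divide_le_eq_1 add_pos_nonneg)
      then show "AE w in M. norm (1 / (1 + (L (real m) w)\<^sup>2)) \<le> 1" by simp
    qed measurable
    have "(\<integral>w. \<bar>airy q (L (real m) w)\<bar> \<partial>M) \<le> (\<integral>w. e + K / e * (1 / (1 + (L (real m) w)\<^sup>2)) \<partial>M)"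
    proof (rule integral_mono)
      show "integrable M (\<lambda>w. \<bar>airy q (L (real m) w)\<bar>)"
        by (rule integrable_const_bound[where B = "airy_bound q"]) (auto simp: abs_airy_le q)
      show "integrable M (\<lambda>w. e + K / e * (1 / (1 + (L (real m) w)\<^sup>2)))"
        by (intro Bochner_Integration.integrable_add integrable_mult_right iC) simp
    qed (rule ineq)
    also have "\<dots> = (\<integral>w. e \<partial>M) + (\<integral>w. K / e * (1 / (1 + (L (real m) w)\<^sup>2)) \<partial>M)"
      by (intro Bochner_Integration.integral_add integrable_mult_right iC) simp
    also have "\<dots> = e + K / e * (\<integral>w. 1 / (1 + (L (real m) w)\<^sup>2) \<partial>M)"
      by (simp only: integral_mult_right_zero) (simp add: prob_space)
    also have "(\<integral>w. 1 / (1 + (L (real m) w)\<^sup>2) \<partial>M) = (\<integral>w. 1 / (1 + (x + (L (real m) w - L 0 w))\<^sup>2) \<partial>M)"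
      by (rule integral_cong_AE) (use AE_start in \<open>auto intro!: L_measurable elim!: eventually_mono\<close>)
    also have "e + K / e * (\<integral>w. 1 / (1 + (x + (L (real m) w - L 0 w))\<^sup>2) \<partial>M) \<le> e + K / e * c m"
      unfolding c_def by (intro add_left_mono mult_left_mono Cauchy_expectation_le) (use m e K0 in auto)
    finally show ?thesis .
  qed
  have c: "c \<longlonglongrightarrow> 0" unfolding c_def by (rule Cauchy_bound_tendsto_0)
  show ?thesis
  proof (rule order_tendstoI)
    fix a :: real assume "a < 0"
    then have "a < (\<integral>w. \<bar>airy q (L (real m) w)\<bar> \<partial>M)" for m
      by (rule less_le_trans) (rule integral_nonneg_AE, simp)
    then show "\<forall>\<^sub>F m in sequentially. a < (\<integral>w. \<bar>airy q (L (real m) w)\<bar> \<partial>M)" by simp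
  next
    fix a :: real assume a: "0 < a"
    have "(\<lambda>m. a / 2 + K / (a / 2) * c m) \<longlonglongrightarrow> a / 2 + K / (a / 2) * 0" by (intro tendsto_add tendsto_mult tendsto_const c)
    then have "\<forall>\<^sub>F m in sequentially. a / 2 + K / (a / 2) * c m < a"
      by (rule order_tendstoD) (use a in simp)
    then show "\<forall>\<^sub>F m in sequentially. (\<integral>w. \<bar>airy q (L (real m) w)\<bar> \<partial>M) < a"
      using eventually_gt_at_top[of 0]
    proof eventually_elim
      case (elim m)
      then show ?case using bound[of m "a / 2"] a by linarith
    qed
  qed
qed

end

section \<open>Passage below zero\<close>

context stable_index
begin

text \<open>Since \<open>\<i> * rot = - cis ?\<theta>\<close> with an angle strictly between 0 and
  pi/2, the weight is exp (-p y^(\<alpha>+1)) with \<open>Re p > 0\<close>, and the complex Gamma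
  integral applies. The phase of the result comes from the power of p.\<close>

lemma weight_Mellin:
  assumes q: "q > 0" and c: "c > 0"
  shows "has_bochner_integral lborel (\<lambda>y. indicator {0<..} y *\<^sub>R (of_real (y powr (c - 1)) * weight q y))
    (of_real (Gamma (c / (\<alpha> + 1)) / (\<alpha> + 1) * (q * (\<alpha> + 1)) powr (c / (\<alpha> + 1))) *
      cis (- (c / (\<alpha> + 1) * (pi * (\<alpha> - 1) / 2))))"
proof -
  let ?r = "1 / (q * (\<alpha> + 1))" and ?\<theta> = "pi * (\<alpha> - 1) / 2"
  have r: "?r > 0" using q \<alpha> by simp
  have \<theta>: "0 < ?\<theta>" "?\<theta> < pi / 2" using \<alpha> by (auto simp: field_simps)
  have rot: "\<i> * rot = - cis ?\<theta>"
  proof -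
    have "rot = \<i> * cis ?\<theta>"
      unfolding rot_def cis_pi_half[symmetric] cis_mult by (simp add: field_simps)
    then show ?thesis by simp
  qed
  have w: "weight q y = exp (-((of_real ?r * cis ?\<theta>) * of_real (y powr (\<alpha> + 1))))" for y
    unfolding weight_def rot by (simp add: field_simps)
  have Re: "Re (of_real ?r * cis ?\<theta>) > 0"
    using r \<theta> by (simp add: cos_gt_zero)
  have "(of_real ?r * cis ?\<theta>) powr (- of_real (c / (\<alpha> + 1))) =
      (of_real ?r * cis ?\<theta>) powr of_real (- (c / (\<alpha> + 1)))" by simp
  also have "\<dots> = of_real (?r powr (- (c / (\<alpha> + 1)))) * cis (- (c / (\<alpha> + 1)) * ?\<theta>)"
    by (rule powr_of_real_cis) (use r \<theta> pi_gt_zero in linarith)+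
  also have "?r powr (- (c / (\<alpha> + 1))) = (q * (\<alpha> + 1)) powr (c / (\<alpha> + 1))"
    using q \<alpha> by (simp add: powr_minus powr_divide)
  finally have p: "(of_real ?r * cis ?\<theta>) powr (- of_real (c / (\<alpha> + 1))) =
      of_real ((q * (\<alpha> + 1)) powr (c / (\<alpha> + 1))) * cis (- (c / (\<alpha> + 1) * ?\<theta>))" by simp
  show ?thesis
    using has_bochner_integral_powr_cexp[of "\<alpha> + 1" c, OF _ c Re] \<alpha> unfolding p w by (simp add: mult.assoc)
qed

lemma airy_0:
  assumes q: "q > 0"
  shows "airy q 0 = Gamma (1 / (\<alpha> + 1)) / (\<alpha> + 1) * (q * (\<alpha> + 1)) powr (1 / (\<alpha> + 1)) * sin (pi / (\<alpha> + 1))"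
proof -
  have "(\<lambda>y. indicator {0<..} y *\<^sub>R (of_real (y powr (1 - 1)) * weight q y)) =
      (\<lambda>y. indicator {0<..} y *\<^sub>R (exp (-(\<i> * of_real (y * 0))) * weight q y))"
    by (auto simp: indicator_def)
  then have "cairy q 0 = of_real (Gamma (1 / (\<alpha> + 1)) / (\<alpha> + 1) * (q * (\<alpha> + 1)) powr (1 / (\<alpha> + 1))) *
      cis (- (1 / (\<alpha> + 1) * (pi * (\<alpha> - 1) / 2)))"
    using weight_Mellin[OF q, of 1] by (simp add: cairy_def has_bochner_integral_iff)
  moreover have "1 / (\<alpha> + 1) * (pi * (\<alpha> - 1) / 2) = pi / 2 - pi / (\<alpha> + 1)"
    using \<alpha> by (simp add: field_simps)
  then have "cos (1 / (\<alpha> + 1) * (pi * (\<alpha> - 1) / 2)) = sin (pi / (\<alpha> + 1))"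
    by (simp add: sin_cos_eq)
  ultimately show ?thesis by (simp add: airy_def)
qed

lemma airy_0_pos:
  assumes "q > 0"
  shows "airy q 0 > 0"
proof -
  have "Gamma (1 / (\<alpha> + 1)) > 0" using \<alpha> by (intro Gamma_real_pos) auto
  moreover have "sin (pi / (\<alpha> + 1)) > 0" using \<alpha> by (intro sin_gt_zero) (auto simp: field_simps)
  ultimately show ?thesis using \<alpha> assms by (simp add: airy_0 zero_less_mult_iff zero_less_divide_iff)
qed

end

text \<open>Reduces an uncountable union over times to countably many dyadic ones, which makes the
  event of becoming negative before \<open>b\<close> measurable.\<close>

lemma neg_grid_iff:
  assumes "cadlag f"
  shows "(\<exists>n (j::nat). (1/2)^n * real j < b \<and> f ((1/2)^n * real j) < 0) \<longleftrightarrow> (\<exists>t\<ge>0. t < b \<and> f t < 0)"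
proof
  assume "\<exists>n (j::nat). (1/2)^n * real j < b \<and> f ((1/2)^n * real j) < 0"
  then obtain n and j :: nat where "(1/2)^n * real j < b" "f ((1/2)^n * real j) < 0" by blast
  then show "\<exists>t\<ge>0. t < b \<and> f t < 0" by (intro exI[of _ "(1/2)^n * real j"]) auto
next
  assume "\<exists>t\<ge>0. t < b \<and> f t < 0"
  then obtain t where t: "0 \<le> t" "t < b" "f t < 0" by blast
  from eventually_happens'[OF sequentially_bot grid_neg_exists[OF assms t]]
  show "\<exists>n (j::nat). (1/2)^n * real j < b \<and> f ((1/2)^n * real j) < 0" by blast
qed

lemma area_before_neg_nonneg:
  assumes f: "cadlag f" "no_negative_jumps f" "f 0 > 0" and ex: "t \<ge> 0" "f t < 0"
  shows "area_before_neg f \<ge> 0"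
  unfolding area_before_neg_def
  using nonneg_before_first_neg[OF f ex] by (intro Bochner_Integration.integral_nonneg) (auto simp: indicator_def)

context stable_levy
begin

text \<open>Optional stopping with two limits. The mesh is refined first, with the horizon
  \<open>m\<close> fixed; then \<open>m\<close> tends to infinity. Paths that never become negative
  contribute nothing to \<open>V\<close>, so no passage has to be assumed. \<open>V\<close> stands
  in for the exponential of the area, whose measurability is not presupposed.\<close>

lemma laplace_area_before_neg:
  assumes x: "x > 0" and q: "q > 0"
  obtains V where "V \<in> borel_measurable M"
    and "AE w in M. V w = (if \<exists>t\<ge>0. L t w < 0 then exp (-(q * area_before_neg (\<lambda>t. L t w))) else 0)"
    and "airy q 0 * (\<integral>w. V w \<partial>M) = airy q x"
proof -
  note [measurable] = airy_measurable[OF q]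
  define d where "d n = ((1/2)^n :: real)" for n :: nat
  have d: "d n > 0" for n by (simp add: d_def)
  have Lm[measurable]: "L (d n * real j) \<in> borel_measurable M" for n j
    using d[of n] by (intro L_measurable) simp
  define hit where "hit m w \<longleftrightarrow> (\<exists>n (j::nat). d n * real j < real m \<and> L (d n * real j) w < 0)" for m :: nat and w
  have hitm[measurable]: "Measurable.pred M (hit m)" for m
    unfolding hit_def by measurable
  define D where "D h m n w = stopped h (q * d n) (\<lambda>j. L (d n * real j) w) (m * 2^n)" for h m n w
  have Dm[measurable]: "D h m n \<in> borel_measurable M" if "h \<in> borel_measurable borel" for h m n
    unfolding D_def[abs_def] using that by (intro stopped_measurable Lm)
  \<comment> \<open>With payoff 1 the stopped value is the bare discount, which tends to
    \<open>E w\<close> on paths that become negative before \<open>m\<close>. As limits of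
    measurable functions, \<open>V m\<close> and \<open>W\<close> are measurable.\<close>
  define U where "U m n w = (if hit m w then D (\<lambda>_. 1) m n w else 0)" for m n w
  have [measurable]: "U m n \<in> borel_measurable M" for m n unfolding U_def[abs_def] by measurable
  define V where "V m w = lim (\<lambda>n. U m n w)" for m w
  have [measurable]: "V m \<in> borel_measurable M" for m unfolding V_def[abs_def] by measurable
  define W where "W w = lim (\<lambda>m. V m w)" for w
  have W[measurable]: "W \<in> borel_measurable M" unfolding W_def[abs_def] by measurable
  define E where "E w = exp (-(q * area_before_neg (\<lambda>t. L t w)))" for w
  define good where "good w \<longleftrightarrow> cadlag (\<lambda>t. L t w) \<and> no_negative_jumps (\<lambda>t. L t w) \<and> L 0 w = x" for w
  have AE_good: "AE w in M. good w"
    using AE_cadlag AE_no_negative_jumps AE_start by eventually_elim (simp add: good_def)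
  have hit_iff: "hit m w \<longleftrightarrow> (\<exists>t\<ge>0. t < real m \<and> L t w < 0)" if "good w" for m w
    using neg_grid_iff[of "\<lambda>t. L t w" "real m"] that by (simp add: hit_def d_def good_def)
  have D_lim: "(\<lambda>n. D h m n w) \<longlonglongrightarrow> E w * h 0" if g: "good w" and "hit m w" and h: "isCont h 0" for h m w
  proof -
    obtain t where "t \<ge> 0" "t < real m" "L t w < 0" using hit_iff[OF g] \<open>hit m w\<close> by blast
    then show ?thesis
      using stopped_tendsto_hit[of "\<lambda>t. L t w" t m q h] g h q x unfolding D_def E_def d_def good_def by simp
  qed
  have V_eq: "V m w = (if hit m w then E w else 0)" if g: "good w" for m w
  proof (cases "hit m w")
    case True
    from limI[OF D_lim[OF g this, of "\<lambda>_. 1"]] show ?thesis using True by (simp add: V_def U_def)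
  next
    case False
    then show ?thesis by (simp add: V_def U_def limI)
  qed
  have V_lim: "(\<lambda>m. V m w) \<longlonglongrightarrow> (if \<exists>t\<ge>0. L t w < 0 then E w else 0)" if g: "good w" for w
  proof (cases "\<exists>t\<ge>0. L t w < 0")
    case True
    then obtain t where t: "t \<ge> 0" "L t w < 0" by blast
    obtain k :: nat where k: "t < real k" using reals_Archimedean2 by blast
    have "\<forall>\<^sub>F m in sequentially. V m w = E w"
      using eventually_ge_at_top[of k]
    proof eventually_elim
      case (elim m)
      then have "t < real m" using k by linarith
      then show ?case using t by (auto simp: V_eq[OF g] hit_iff[OF g])
    qed
    then show ?thesis using True by (simp add: tendsto_eventually)
  next
    case False
    then have "V m w = 0" for m by (auto simp: V_eq[OF g] hit_iff[OF g])
    then show ?thesis by (simp only: False if_False tendsto_const)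
  qed
  have W_eq: "W w = (if \<exists>t\<ge>0. L t w < 0 then E w else 0)" if g: "good w" for w
    unfolding W_def by (rule limI[OF V_lim[OF g]])
  have V_le: "\<bar>V m w\<bar> \<le> 1" if g: "good w" for m w
  proof (cases "hit m w")
    case True
    then obtain t where "t \<ge> 0" "L t w < 0" using hit_iff[OF g] by blast
    then have "area_before_neg (\<lambda>t. L t w) \<ge> 0"
      using g x by (intro area_before_neg_nonneg[of _ t]) (auto simp: good_def)
    then show ?thesis using q by (auto simp: V_eq[OF g] E_def)
  qed (simp add: V_eq[OF g])
  have cont: "isCont (airy q) 0"
    using continuous_airy[OF q] continuous_on_eq_continuous_at by blast
  have D_le: "\<bar>D (airy q) m n w\<bar> \<le> airy_bound q" for m n w
    unfolding D_def using q d[of n] by (intro abs_stopped_le abs_airy_le) auto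
  have D_int: "integrable M (D (airy q) m n)" for m n
    by (rule integrable_const_bound[where B = "airy_bound q"]) (auto simp: D_le)
  let ?R = "\<lambda>m. (\<integral>w. \<bar>airy q (L (real m) w)\<bar> \<partial>M)" and ?D = "\<lambda>m n. (\<integral>w. D (airy q) m n w \<partial>M)"
    and ?H = "\<lambda>m n. (\<integral>w. (if hit m w then D (airy q) m n w else 0) \<partial>M)" and ?V = "\<lambda>m. (\<integral>w. V m w * airy q 0 \<partial>M)"
  have D_hit_int: "integrable M (\<lambda>w. if hit m w then D (airy q) m n w else 0)" for m n
    by (rule integrable_const_bound[where B = "airy_bound q"]) (use D_le abs_airy_le[OF q, of 0] in \<open>auto intro: order_trans[OF abs_ge_zero]\<close>)
  have D_exp: "(\<lambda>n. ?D m n) \<longlonglongrightarrow> airy q x" for m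
  proof -
    have "(\<lambda>n. ?D m n - airy q x) \<longlonglongrightarrow> 0"
    proof (rule Lim_null_comparison)
      \<comment> \<open>There are \<open>m * 2^n\<close> steps, each with an error proportional to
        the square of the mesh \<open>(1/2)^n\<close>.\<close>
      have "norm (?D m n - airy q x) \<le> real m * step_error q * (1/2)^n" for n
      proof -
        have "norm (?D m n - airy q x) \<le> real (m * 2^n) * (step_error q * (d n)\<^sup>2)"
          using expectation_stopped[OF q d, of n "m * 2^n"] unfolding D_def real_norm_def .
        also have "\<dots> = real m * step_error q * (1/2)^n"
          by (simp add: d_def power2_eq_square power_one_over field_simps)
        finally show ?thesis .
      qed
      then show "\<forall>\<^sub>F n in sequentially. norm (?D m n - airy q x) \<le> real m * step_error q * (1/2)^n"
        by simp
      show "(\<lambda>n. real m * step_error q * (1/2)^n) \<longlonglongrightarrow> 0"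
        by (intro tendsto_mult_right_zero LIMSEQ_power_zero) simp
    qed
    then show ?thesis by (simp add: LIM_zero_iff)
  qed
  have D_hit_lim: "(\<lambda>n. ?H m n) \<longlonglongrightarrow> ?V m" for m
  proof (rule integral_dominated_convergence[where w = "\<lambda>_. airy_bound q"])
    show "AE w in M. (\<lambda>n. if hit m w then D (airy q) m n w else 0) \<longlonglongrightarrow> V m w * airy q 0"
      using AE_good
    proof eventually_elim
      case (elim w)
      then show ?case using D_lim[OF elim _ cont, of m] by (cases "hit m w") (auto simp: V_eq)
    qed
    show "AE w in M. norm (if hit m w then D (airy q) m n w else 0) \<le> airy_bound q" for n
      using D_le abs_airy_le[OF q, of 0] by (auto intro: order_trans[OF abs_ge_zero])
  qed auto
  \<comment> \<open>The integrands differ only on paths without passage before \<open>m\<close>,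
    where the stopped value is a discounted value at the horizon. The bound does not depend on
    \<open>n\<close>.\<close>
  have diff: "\<bar>?D m n - ?H m n\<bar>
      \<le> ?R m" if m: "m > 0" for m n
  proof -
    have [measurable]: "L (real m) \<in> borel_measurable M" by (simp add: L_measurable)
    have "\<bar>?D m n - ?H m n\<bar> =
        \<bar>\<integral>w. D (airy q) m n w - (if hit m w then D (airy q) m n w else 0) \<partial>M\<bar>"
      by (subst Bochner_Integration.integral_diff[OF D_int D_hit_int]) simp
    also have "\<dots> \<le> (\<integral>w. \<bar>D (airy q) m n w - (if hit m w then D (airy q) m n w else 0)\<bar> \<partial>M)"
      by (rule integral_abs_bound)
    also have "\<dots> \<le> ?R m"
    proof (rule integral_mono_AE)
      show "integrable M (\<lambda>w. \<bar>D (airy q) m n w - (if hit m w then D (airy q) m n w else 0)\<bar>)"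
        by (intro integrable_abs Bochner_Integration.integrable_diff D_int D_hit_int)
      show "integrable M (\<lambda>w. \<bar>airy q (L (real m) w)\<bar>)"
        by (rule integrable_const_bound[where B = "airy_bound q"]) (auto simp: abs_airy_le q)
      show "AE w in M. \<bar>D (airy q) m n w - (if hit m w then D (airy q) m n w else 0)\<bar> \<le> \<bar>airy q (L (real m) w)\<bar>"
        using AE_good
      proof eventually_elim
        case (elim w)
        show ?case
        proof (cases "hit m w")
          case False
          then have "\<And>t. 0 \<le> t \<Longrightarrow> t < real m \<Longrightarrow> L t w \<ge> 0" using hit_iff[OF elim] not_less by blast
          then have "\<bar>D (airy q) m n w\<bar> \<le> \<bar>airy q (L (real m) w)\<bar>"
            unfolding D_def d_def using elim m q
            by (intro abs_stopped_no_hit[of "\<lambda>t. L t w"]) (auto simp: good_def)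
          then show ?thesis using False by simp
        qed simp
      qed
    qed
    finally show ?thesis .
  qed
  have V_bound: "\<bar>airy q x - ?V m\<bar> \<le> ?R m" if m: "m > 0" for m
    by (rule tendsto_upperbound[OF tendsto_rabs[OF tendsto_diff[OF D_exp D_hit_lim]]]) (auto intro!: always_eventually diff m)
  have "(\<lambda>m. ?V m) \<longlonglongrightarrow> (\<integral>w. W w * airy q 0 \<partial>M)"
  proof (rule integral_dominated_convergence[where w = "\<lambda>_. 1 * \<bar>airy q 0\<bar>"])
    show "AE w in M. (\<lambda>m. V m w * airy q 0) \<longlonglongrightarrow> W w * airy q 0"
      using AE_good
    proof eventually_elim
      case (elim w)
      from tendsto_mult[OF V_lim[OF elim] tendsto_const] show ?case unfolding W_eq[OF elim] .
    qed
    show "AE w in M. norm (V m w * airy q 0) \<le> 1 * \<bar>airy q 0\<bar>" for m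
      using AE_good
    proof eventually_elim
      case (elim w)
      show ?case unfolding real_norm_def abs_mult by (intro mult_right_mono V_le elim) simp
    qed
  qed auto
  moreover have "(\<lambda>m. ?V m) \<longlonglongrightarrow> airy q x"
  proof -
    have "(\<lambda>m. airy q x - ?V m) \<longlonglongrightarrow> 0"
    proof (rule Lim_null_comparison[OF _ expectation_abs_airy_tendsto_0[OF q]])
      show "\<forall>\<^sub>F m in sequentially. norm (airy q x - ?V m) \<le> ?R m"
        using eventually_gt_at_top[of 0] by eventually_elim (use V_bound in simp)
    qed
    from tendsto_diff[OF tendsto_const this, of "airy q x"] show ?thesis by simp
  qed
  ultimately have "(\<integral>w. W w * airy q 0 \<partial>M) = airy q x" by (rule LIMSEQ_unique)
  then have "airy q 0 * (\<integral>w. W w \<partial>M) = airy q x" by (simp add: mult.commute)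
  moreover have "AE w in M. W w = (if \<exists>t\<ge>0. L t w < 0 then exp (-(q * area_before_neg (\<lambda>t. L t w))) else 0)"
    using AE_good by eventually_elim (simp add: W_eq E_def)
  ultimately show thesis using that W by blast
qed

end

section \<open>The hitting time of zero\<close>

lemma cadlag_diff_const:
  assumes "cadlag f"
  shows "cadlag (\<lambda>t. f t - c)"
  unfolding cadlag_def
proof (intro conjI allI impI)
  show "((\<lambda>t. f t - c) \<longlongrightarrow> f t - c) (at_right t)" if "t \<ge> 0" for t
    using assms that by (intro tendsto_diff tendsto_const) (simp add: cadlag_def)
  show "\<exists>l. ((\<lambda>t. f t - c) \<longlongrightarrow> l) (at_left t)" if t: "t > 0" for t
  proof -
    obtain l where "(f \<longlongrightarrow> l) (at_left t)" using cadlag_left_limit[OF assms t] by blast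
    from tendsto_diff[OF this tendsto_const, of c] show ?thesis by blast
  qed
qed

lemma no_negative_jumps_diff_const:
  assumes "no_negative_jumps f"
  shows "no_negative_jumps (\<lambda>t. f t - c)"
  unfolding no_negative_jumps_def
proof (intro allI impI)
  fix t l assume "0 < t" "((\<lambda>t. f t - c) \<longlongrightarrow> l) (at_left t)"
  moreover from tendsto_add[OF this(2) tendsto_const, of c] have "(f \<longlongrightarrow> l + c) (at_left t)" by simp
  ultimately show "l \<le> f t - c" using assms by (fastforce simp: no_negative_jumps_def)
qed

text \<open>The hitting time of 0 lies between the passage times below \<open>e > 0\<close> and below 0.\<close>

lemma area_until_zero_bounds:
  assumes f: "cadlag f" "no_negative_jumps f" and e: "0 < e" "e < f 0" and ex: "t \<ge> 0" "f t < 0"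
  shows "area_before_neg (\<lambda>t. f t - e) \<le> area_until_zero f" "area_until_zero f \<le> area_before_neg f"
proof -
  let ?g = "\<lambda>t. f t - e"
  let ?R = "first_neg ?g" and ?S = "first_neg f"
  have g: "cadlag ?g" "no_negative_jumps ?g" "?g 0 > 0" and ex': "?g t < 0"
    using f e ex by (auto intro: cadlag_diff_const no_negative_jumps_diff_const)
  have f0: "f 0 > 0" using e by linarith
  note fS = first_neg_pos[OF f f0 ex] nonneg_before_first_neg[OF f f0 ex] at_first_neg[OF f f0 ex]
  note gR = first_neg_pos[OF g ex(1) ex']
  have lower: "ereal ?R \<le> hitting_time_zero f"
    unfolding hitting_time_zero_def
  proof (rule INF_greatest)
    fix s assume "s \<in> {t. 0 < t \<and> f t = 0}"
    then have "0 \<le> s" "?g s < 0" using e by auto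
    then have "\<not> s < ?R" using nonneg_before_first_neg[OF g ex(1) ex', of s] by linarith
    then show "ereal ?R \<le> ereal s" by simp
  qed
  have upper: "hitting_time_zero f \<le> ereal ?S"
    unfolding hitting_time_zero_def by (rule INF_lower) (use fS in simp)
  obtain r where r: "hitting_time_zero f = ereal r" using lower upper by (cases "hitting_time_zero f") auto
  have rR: "?R \<le> r" and rS: "r \<le> ?S" using lower upper r by auto
  have A: "area_until_zero f = (\<integral>s. indicator {0<..<r} s * f s \<partial>lborel)"
    unfolding area_until_zero_def r zero_ereal_def interval_lebesgue_integral_def set_lebesgue_integral_def
    using rR gR by simp
  show "area_before_neg ?g \<le> area_until_zero f"
    unfolding A area_before_neg_def
  proof (rule integral_mono[OF cadlag_integrable[OF g(1)] cadlag_integrable[OF f(1)]])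
    fix s
    show "indicator {0<..<?R} s * (f s - e) \<le> indicator {0<..<r} s * f s"
      using fS(2)[of s] rR rS e by (auto simp: indicator_def)
  qed
  show "area_until_zero f \<le> area_before_neg f"
    unfolding A area_before_neg_def
  proof (rule integral_mono[OF cadlag_integrable[OF f(1)] cadlag_integrable[OF f(1)]])
    fix s
    show "indicator {0<..<r} s * f s \<le> indicator {0<..<?S} s * f s"
      using fS(2)[of s] rS by (auto simp: indicator_def)
  qed
qed

text \<open>The infimum of the \<open>X n\<close> has integral 0, hence vanishes almost everywhere.
  The conclusion quantifies over pointwise lower bounds \<open>c\<close> because it is applied to a
  minorant that depends on the path through \<open>area_until_zero\<close> and is not assumed
  measurable.\<close>

lemma (in prob_space) AE_le_0_if_integral_tendsto_0:
  fixes X :: "nat \<Rightarrow> 'a \<Rightarrow> real"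
  assumes i: "\<And>n. integrable M (X n)" and nonneg: "AE w in M. \<forall>n. 0 \<le> X n w"
    and lim: "(\<lambda>n. \<integral>w. X n w \<partial>M) \<longlonglongrightarrow> 0"
  shows "AE w in M. \<forall>c. (\<forall>n. c \<le> X n w) \<longrightarrow> c \<le> 0"
proof -
  note [measurable] = borel_measurable_integrable[OF i]
  have "(\<integral>\<^sup>+w. (INF n. ennreal (X n w)) \<partial>M) \<le> 0"
  proof (rule tendsto_lowerbound)
    show "(\<lambda>n. ennreal (\<integral>w. X n w \<partial>M)) \<longlonglongrightarrow> 0"
      using tendsto_ennrealI[OF lim] by simp
    have "(\<integral>\<^sup>+w. (INF n. ennreal (X n w)) \<partial>M) \<le> ennreal (\<integral>w. X n w \<partial>M)" for n
    proof -
      have "(\<integral>\<^sup>+w. (INF n. ennreal (X n w)) \<partial>M) \<le> (\<integral>\<^sup>+w. ennreal (X n w) \<partial>M)"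
        by (intro nn_integral_mono INF_lower) simp
      also have "\<dots> = ennreal (\<integral>w. X n w \<partial>M)"
        by (rule nn_integral_eq_integral[OF i]) (use nonneg in eventually_elim, simp)
      finally show ?thesis .
    qed
    then show "\<forall>\<^sub>F n in sequentially. (\<integral>\<^sup>+w. (INF n. ennreal (X n w)) \<partial>M) \<le> ennreal (\<integral>w. X n w \<partial>M)"
      by simp
  qed simp
  then have "AE w in M. (INF n. ennreal (X n w)) = 0"
    by (subst (asm) le_zero_eq, subst (asm) nn_integral_0_iff_AE) auto
  then show ?thesis
  proof eventually_elim
    case (elim w)
    show ?case
    proof (intro allI impI)
      fix c assume "\<forall>n. c \<le> X n w"
      then have "ennreal c \<le> (INF n. ennreal (X n w))" by (intro INF_greatest ennreal_leI) auto
      then show "c \<le> 0" using elim by (simp add: ennreal_eq_0_iff)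
    qed
  qed
qed

context stable_levy
begin

text \<open>Apart from the starting value, all distributional conditions concern increments. Passage
  below level \<open>c\<close> is thus passage below 0 of the shifted process.\<close>

lemma stable_levy_diff_const: "stable_levy \<alpha> M (\<lambda>t w. L t w - c) (x - c)"
proof -
  have "levy_process M L x" "strictly_stable \<alpha> M L"
    and e: "\<forall>u\<ge>0. expectation (\<lambda>w. exp (- u * (L 1 w - L 0 w))) = exp (u powr \<alpha>)"
    using levy by (auto simp: spectrally_positive_stable_levy_def)
  have "levy_process M (\<lambda>t w. L t w - c) (x - c)"
  proof -
    have "AE w in M. cadlag (\<lambda>t. L t w - c)" using AE_cadlag by eventually_elim (rule cadlag_diff_const)
    moreover have "AE w in M. L 0 w - c = x - c" using AE_start by eventually_elim simp
    moreover have "\<forall>t\<ge>0. (\<lambda>w. L t w - c) \<in> borel_measurable M" by (simp add: L_measurable)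
    moreover have "(L s w - c) - (L t w - c) = L s w - L t w" for s t w by simp
    ultimately show ?thesis using \<open>levy_process M L x\<close> by (simp only: levy_process_def) blast
  qed
  moreover have "strictly_stable \<alpha> M (\<lambda>t w. L t w - c)"
    using \<open>strictly_stable \<alpha> M L\<close> by (simp add: strictly_stable_def)
  moreover have "AE w in M. no_negative_jumps (\<lambda>t. L t w - c)"
    using AE_no_negative_jumps by eventually_elim (rule no_negative_jumps_diff_const)
  ultimately have "spectrally_positive_stable_levy \<alpha> M (\<lambda>t w. L t w - c) (x - c)"
    using e by (simp add: spectrally_positive_stable_levy_def)
  then show ?thesis by unfold_locales
qed

lemma tendsto_airy: "q > 0 \<Longrightarrow> s \<longlonglongrightarrow> v \<Longrightarrow> (\<lambda>n. airy q (s n)) \<longlonglongrightarrow> airy q v"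
  using continuous_airy by (auto simp: continuous_on_eq_continuous_at intro: isCont_tendsto_compose)

text \<open>The Laplace transform restricted to paths that become negative tends to 1 as q tends to
  0, by scaling and continuity of \<open>airy 1\<close> at 0. On a path that never becomes negative
  every \<open>1 - V n w\<close> equals 1, so such paths form a null set.\<close>

lemma AE_becomes_negative:
  assumes x: "x > 0"
  shows "AE w in M. \<exists>t\<ge>0. L t w < 0"
proof -
  define q where "q n = (1/2::real)^n" for n :: nat
  have q: "q n > 0" for n by (simp add: q_def)
  have q0: "q \<longlonglongrightarrow> 0" unfolding q_def by (rule LIMSEQ_power_zero) simp
  have "\<exists>V. V \<in> borel_measurable M \<and>
      (AE w in M. V w = (if \<exists>t\<ge>0. L t w < 0 then exp (-(q n * area_before_neg (\<lambda>t. L t w))) else 0)) \<and>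
      airy (q n) 0 * (\<integral>w. V w \<partial>M) = airy (q n) x" for n
    by (rule laplace_area_before_neg[OF x q[of n]]) blast
  from choice[OF allI[OF this]]
  obtain V where VV: "\<forall>n. V n \<in> borel_measurable M \<and>
      (AE w in M. V n w = (if \<exists>t\<ge>0. L t w < 0 then exp (-(q n * area_before_neg (\<lambda>t. L t w))) else 0)) \<and>
      airy (q n) 0 * (\<integral>w. V n w \<partial>M) = airy (q n) x" ..
  note V[measurable] = VV[THEN spec, THEN conjunct1]
  note V_eq = VV[THEN spec, THEN conjunct2, THEN conjunct1] and V_int = VV[THEN spec, THEN conjunct2, THEN conjunct2]
  have AE_V: "AE w in M. \<forall>n. V n w = (if \<exists>t\<ge>0. L t w < 0 then exp (-(q n * area_before_neg (\<lambda>t. L t w))) else 0)"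
    using V_eq by (simp add: AE_all_countable)
  have V_bound: "AE w in M. \<forall>n. 0 \<le> V n w \<and> V n w \<le> 1"
    using AE_V AE_cadlag AE_no_negative_jumps AE_start
  proof eventually_elim
    case (elim w)
    show ?case
    proof (cases "\<exists>t\<ge>0. L t w < 0")
      case True
      then obtain t where "t \<ge> 0" "L t w < 0" by blast
      then have "area_before_neg (\<lambda>t. L t w) \<ge> 0"
        using elim x by (intro area_before_neg_nonneg[of _ t]) auto
      then show ?thesis using True elim(1) q by (simp add: less_imp_le)
    next
      case False
      then show ?thesis using elim(1) by (simp only: if_False) simp
    qed
  qed
  have V_i: "integrable M (V n)" for n
  proof (rule integrable_const_bound[where B = 1])
    show "AE w in M. norm (V n w) \<le> 1" using V_bound by eventually_elim simp
  qed (rule V)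
  have lim1: "(\<lambda>n. \<integral>w. V n w \<partial>M) \<longlonglongrightarrow> 1"
  proof -
    have "(\<integral>w. V n w \<partial>M) = airy 1 (q n powr (1 / (\<alpha> + 1)) * x) / airy 1 0" for n
      using V_int[of n] airy_scaling[OF q[of n], of 0] airy_scaling[OF q[of n], of x] q[of n] airy_0_pos[of 1]
      by (simp add: field_simps)
    moreover have "(\<lambda>n. airy 1 (q n powr (1 / (\<alpha> + 1)) * x) / airy 1 0) \<longlonglongrightarrow> airy 1 0 / airy 1 0"
    proof (intro tendsto_divide tendsto_airy tendsto_const)
      have "(\<lambda>n. q n powr (1 / (\<alpha> + 1)) * x) \<longlonglongrightarrow> 0 powr (1 / (\<alpha> + 1)) * x"
        by (intro tendsto_intros q0) (use \<alpha> q in \<open>auto intro!: always_eventually simp: less_imp_le\<close>)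
      then show "(\<lambda>n. q n powr (1 / (\<alpha> + 1)) * x) \<longlonglongrightarrow> 0" by simp
    qed (use airy_0_pos[of 1] in auto)
    ultimately show ?thesis using airy_0_pos[of 1] by simp
  qed
  have lim: "(\<lambda>n. \<integral>w. 1 - V n w \<partial>M) \<longlonglongrightarrow> 0"
  proof -
    have "(\<integral>w. 1 - V n w \<partial>M) = 1 - (\<integral>w. V n w \<partial>M)" for n
      using V_i by (simp add: prob_space)
    then show ?thesis using tendsto_diff[OF tendsto_const lim1, of 1] by simp
  qed
  have "AE w in M. \<forall>c. (\<forall>n. c \<le> 1 - V n w) \<longrightarrow> c \<le> 0"
  proof (rule AE_le_0_if_integral_tendsto_0[OF _ _ lim])
    show "AE w in M. \<forall>n. 0 \<le> 1 - V n w" using V_bound by eventually_elim simp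
  qed (use V_i in simp)
  then show ?thesis
    using AE_V
  proof eventually_elim
    case (elim w)
    show ?case
    proof (rule ccontr)
      assume neg: "\<not> ?thesis"
      have "V n w = 0" for n using elim(2) unfolding if_not_P[OF neg] by simp
      then show False using elim(1)[THEN spec, of 1] by simp
    qed
  qed
qed

text \<open>Write T for the area up to the hitting time. Then exp (-T) is squeezed between
  \<open>V 1\<close> and every \<open>W n\<close>, the transforms for passage below 0 and below
  \<open>e n\<close>. The expectations of the \<open>W n\<close> converge to that of
  \<open>V 1\<close> by continuity of \<open>airy 1\<close>, which forces T to equal the area up to
  passage below 0 almost everywhere.\<close>

lemma laplace_area_until_zero:
  assumes x: "x > 0"
  obtains Y where "Y \<in> borel_measurable M" "AE w in M. area_until_zero (\<lambda>t. L t w) = Y w" "AE w in M. 0 \<le> Y w"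
    "\<And>q. q > 0 \<Longrightarrow> (\<integral>w. exp (-(q * Y w)) \<partial>M) = airy q x / airy q 0"
proof -
  define A where "A w = area_before_neg (\<lambda>t. L t w)" for w
  \<comment> \<open>The shift by 2 keeps every level strictly below the starting point
    \<open>x\<close>.\<close>
  define e where "e n = x / (real n + 2)" for n :: nat
  have e: "0 < e n" "e n < x" for n using x by (auto simp: e_def field_simps intro: add_pos_nonneg)
  define B where "B n w = area_before_neg (\<lambda>t. L t w - e n)" for n w
  have A0: "AE w in M. 0 \<le> A w"
    using AE_becomes_negative[OF x] AE_cadlag AE_no_negative_jumps AE_start
  proof eventually_elim
    case (elim w)
    then obtain t where "t \<ge> 0" "L t w < 0" by blast
    then show ?case using elim x unfolding A_def by (intro area_before_neg_nonneg[of _ t]) auto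
  qed
  have "\<exists>V. q > 0 \<longrightarrow> V \<in> borel_measurable M \<and> (AE w in M. V w = exp (-(q * A w))) \<and> airy q 0 * (\<integral>w. V w \<partial>M) = airy q x" for q
  proof (cases "q > 0")
    case q: True
    obtain V where V: "V \<in> borel_measurable M"
      "AE w in M. V w = (if \<exists>t\<ge>0. L t w < 0 then exp (-(q * area_before_neg (\<lambda>t. L t w))) else 0)"
      "airy q 0 * (\<integral>w. V w \<partial>M) = airy q x" using laplace_area_before_neg[OF x q] by blast
    have "AE w in M. V w = exp (-(q * A w))"
      using V(2) AE_becomes_negative[OF x] by eventually_elim (simp only: if_True A_def)
    then show ?thesis using V(1,3) by blast
  qed blast
  from choice[OF allI[OF this]]
  obtain V where VV: "\<forall>q. q > 0 \<longrightarrow> V q \<in> borel_measurable M \<and> (AE w in M. V q w = exp (-(q * A w))) \<and>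
      airy q 0 * (\<integral>w. V q w \<partial>M) = airy q x" ..
  note V = VV[THEN spec, THEN mp, THEN conjunct1]
    and V_eq = VV[THEN spec, THEN mp, THEN conjunct2, THEN conjunct1]
    and V_int = VV[THEN spec, THEN mp, THEN conjunct2, THEN conjunct2]
  have "\<forall>n. \<exists>W. W \<in> borel_measurable M \<and> (AE w in M. W w = exp (- B n w)) \<and> airy 1 0 * (\<integral>w. W w \<partial>M) = airy 1 (x - e n)"
  proof
    fix n
    interpret S: stable_levy \<alpha> M "\<lambda>t w. L t w - e n" "x - e n" by (rule stable_levy_diff_const)
    have xe: "x - e n > 0" using e by simp
    obtain W where W: "W \<in> borel_measurable M"
      "AE w in M. W w = (if \<exists>t\<ge>0. L t w - e n < 0 then exp (-(1 * area_before_neg (\<lambda>t. L t w - e n))) else 0)"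
      "airy 1 0 * (\<integral>w. W w \<partial>M) = airy 1 (x - e n)" using S.laplace_area_before_neg[OF xe zero_less_one] by blast
    have "AE w in M. W w = exp (- B n w)"
      using W(2) S.AE_becomes_negative[OF xe] by eventually_elim (simp only: if_True B_def mult_1)
    then show "\<exists>W. W \<in> borel_measurable M \<and> (AE w in M. W w = exp (- B n w)) \<and> airy 1 0 * (\<integral>w. W w \<partial>M) = airy 1 (x - e n)"
      using W(1,3) by blast
  qed
  from choice[OF this]
  obtain W where WW: "\<forall>n. W n \<in> borel_measurable M \<and> (AE w in M. W n w = exp (- B n w)) \<and>
      airy 1 0 * (\<integral>w. W n w \<partial>M) = airy 1 (x - e n)" ..
  note W[measurable] = WW[THEN spec, THEN conjunct1]
  note W_eq = WW[THEN spec, THEN conjunct2, THEN conjunct1] and W_int = WW[THEN spec, THEN conjunct2, THEN conjunct2]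
  have AE_W: "AE w in M. \<forall>n. W n w = exp (- B n w)" using W_eq by (simp add: AE_all_countable)
  have V1[measurable]: "V 1 \<in> borel_measurable M" by (rule V) simp
  have AE_V1: "AE w in M. V 1 w = exp (- A w)" using V_eq[of 1] by simp
  have sandwich: "AE w in M. \<forall>n. B n w \<le> area_until_zero (\<lambda>t. L t w) \<and> area_until_zero (\<lambda>t. L t w) \<le> A w"
    using AE_becomes_negative[OF x] AE_cadlag AE_no_negative_jumps AE_start
  proof eventually_elim
    case (elim w)
    then obtain t where "t \<ge> 0" "L t w < 0" by blast
    then show ?case
      using area_until_zero_bounds[of "\<lambda>t. L t w" "e _" t] elim e unfolding A_def B_def by blast
  qed
  have B0: "AE w in M. \<forall>n. 0 \<le> B n w"
  proof -
    have "AE w in M. 0 \<le> B n w" for n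
    proof -
      interpret S: stable_levy \<alpha> M "\<lambda>t w. L t w - e n" "x - e n" by (rule stable_levy_diff_const)
      have xe: "x - e n > 0" using e by simp
      show ?thesis using S.AE_becomes_negative[OF xe] S.AE_cadlag S.AE_no_negative_jumps S.AE_start
      proof eventually_elim
        case (elim w)
        then obtain t where "t \<ge> 0" "L t w - e n < 0" by blast
        then show ?case using elim xe unfolding B_def by (intro area_before_neg_nonneg[of _ t]) auto
      qed
    qed
    then show ?thesis by (simp add: AE_all_countable)
  qed
  have W_i: "integrable M (W n)" for n
  proof (rule integrable_const_bound[where B = 1])
    show "AE w in M. norm (W n w) \<le> 1" using AE_W B0 by eventually_elim simp
  qed simp
  have V_i: "integrable M (V 1)"
  proof (rule integrable_const_bound[where B = 1])
    show "AE w in M. norm (V 1 w) \<le> 1" using AE_V1 A0 by eventually_elim simp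
  qed simp
  have lim: "(\<lambda>n. \<integral>w. W n w - V 1 w \<partial>M) \<longlonglongrightarrow> 0"
  proof -
    have "(\<integral>w. W n w - V 1 w \<partial>M) = airy 1 (x - e n) / airy 1 0 - airy 1 x / airy 1 0" for n
      using W_i V_i W_int[of n] V_int[of 1] airy_0_pos[of 1] by (simp add: field_simps)
    moreover have "(\<lambda>n. airy 1 (x - e n) / airy 1 0 - airy 1 x / airy 1 0) \<longlonglongrightarrow> airy 1 (x - 0) / airy 1 0 - airy 1 x / airy 1 0"
    proof (intro tendsto_intros tendsto_airy)
      show "e \<longlonglongrightarrow> 0" unfolding e_def by real_asymp
    qed (use airy_0_pos[of 1] in auto)
    ultimately show ?thesis by simp
  qed
  have le: "AE w in M. \<forall>n. 0 \<le> W n w - V 1 w"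
    using AE_W AE_V1 sandwich by eventually_elim (auto intro: order_trans)
  have inf0: "AE w in M. \<forall>c. (\<forall>n. c \<le> W n w - V 1 w) \<longrightarrow> c \<le> 0"
    by (rule AE_le_0_if_integral_tendsto_0[OF _ le lim]) (use W_i V_i in simp)
  have eqA: "AE w in M. area_until_zero (\<lambda>t. L t w) = A w"
    using inf0 AE_W AE_V1 sandwich
  proof eventually_elim
    case (elim w)
    let ?T = "area_until_zero (\<lambda>t. L t w)"
    have "\<forall>n. exp (- ?T) - exp (- A w) \<le> W n w - V 1 w" using elim(2-4) by auto
    then have "exp (- ?T) - exp (- A w) \<le> 0" using elim(1) by blast
    then show ?case using elim(4) by force
  qed
  \<comment> \<open>\<open>V 1\<close> is measurable and equals \<open>exp (- A)\<close> almost
    everywhere, so its negative logarithm is one measurable version of the area that serves all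
    \<open>q\<close> simultaneously.\<close>
  show thesis
  proof (rule that[of "\<lambda>w. - ln (V 1 w)"])
    show "AE w in M. area_until_zero (\<lambda>t. L t w) = - ln (V 1 w)"
      using eqA AE_V1 by eventually_elim simp
    show "AE w in M. 0 \<le> - ln (V 1 w)" using AE_V1 A0 by eventually_elim simp
    fix q :: real assume q: "q > 0"
    have "(\<integral>w. exp (-(q * - ln (V 1 w))) \<partial>M) = (\<integral>w. V q w \<partial>M)"
    proof (rule integral_cong_AE)
      show "AE w in M. exp (-(q * - ln (V 1 w))) = V q w"
        using AE_V1 V_eq[OF q] by eventually_elim simp
    qed (use V[OF q] in auto)
    then show "(\<integral>w. exp (-(q * - ln (V 1 w))) \<partial>M) = airy q x / airy q 0"
      using V_int[OF q] airy_0_pos[OF q] by (simp add: field_simps)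
  qed measurable
qed

end

section \<open>Mellin transforms and moments\<close>

lemma Gamma_reflection_real:
  fixes u :: real
  shows "Gamma u * Gamma (1 - u) = pi / sin (pi * u)"
proof -
  have "Gamma (complex_of_real u) = of_real (Gamma u)" by (rule Gamma_complex_of_real)
  moreover have "Gamma (1 - complex_of_real u) = of_real (Gamma (1 - u))"
    using Gamma_complex_of_real[of "1 - u"] by simp
  moreover have "sin (complex_of_real pi * of_real u) = of_real (sin (pi * u))"
    using sin_of_real[of "pi * u"] by simp
  ultimately have "complex_of_real (Gamma u * Gamma (1 - u)) = complex_of_real (pi / sin (pi * u))"
    using Gamma_reflection_complex[of "of_real u"] by simp
  then show ?thesis by (simp only: of_real_eq_iff)
qed

lemma norm_powr_of_real:
  fixes z :: complex
  assumes "z \<noteq> 0"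
  shows "norm (z powr of_real r) = norm z powr r"
  using assms by (simp add: powr_def norm_exp_eq_Re)

section \<open>The Mellin transform of \<open>airy\<close>\<close>

context stable_index
begin

text \<open>The factor \<open>exp (-(e * v))\<close> makes the double integral absolutely convergent.\<close>

lemma cairy_Mellin_regularized:
  assumes w: "0 < w" and e: "e > 0"
  shows "has_bochner_integral lborel (\<lambda>v. indicator {0<..} v *\<^sub>R (of_real (v powr (w - 1) * exp (-(e * v))) * cairy 1 v))
    (of_real (Gamma w) * (\<integral>y. indicator {0<..} y *\<^sub>R ((of_real e + \<i> * of_real y) powr (- of_real w) * weight 1 y) \<partial>lborel))"
proof -
  define k where "k v = indicator {0<..} v * (v powr (w - 1) * exp (-(e * v)))" for v
  have k[measurable]: "k \<in> borel_measurable borel" unfolding k_def by measurable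
  have k0: "k v \<ge> 0" for v by (simp add: k_def)
  have k_eq: "k v = indicator {0<..} v * (v powr (w - 1) * exp (-(e * v powr 1)))" for v
    by (auto simp: k_def indicator_def)
  have ki: "integrable lborel k"
    using has_bochner_integral_powr_exp[of 1 w e] w e by (simp add: k_eq[abs_def] has_bochner_integral_iff)
  define g where "g y = indicator {0<..} y *\<^sub>R weight 1 y" for y :: real
  have g[measurable]: "g \<in> borel_measurable borel" unfolding g_def by measurable
  have gi: "integrable lborel (\<lambda>y. norm (g y))"
    using integrable_norm_weight[of 1] by (simp add: g_def)
  let ?f = "\<lambda>y v. of_real (k v) * (exp (-(\<i> * of_real (y * v))) * g y)"
  have i: "integrable (lborel \<Otimes>\<^sub>M lborel) (case_prod ?f)"
  proof (rule lborel_pair.Fubini_integrable)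
    have "norm (?f y v) = k v * norm (g y)" for y v using k0 by (simp add: norm_mult)
    then show "integrable lborel (\<lambda>y. \<integral>v. norm (case (y, v) of (y, v) \<Rightarrow> ?f y v) \<partial>lborel)"
      using gi by simp
    show "AE y in lborel. integrable lborel (\<lambda>v. case (y, v) of (y, v) \<Rightarrow> ?f y v)"
    proof (intro AE_I2)
      fix y :: real
      have "integrable lborel (\<lambda>v. k v * norm (g y))" using ki by simp
      then have "integrable lborel (\<lambda>v. ?f y v)"
        by (rule Bochner_Integration.integrable_bound) (use k0 in \<open>auto simp: norm_mult\<close>)
      then show "integrable lborel (\<lambda>v. case (y, v) of (y, v) \<Rightarrow> ?f y v)" by simp
    qed
  qed measurable
  have inner: "(\<integral>y. ?f y v \<partial>lborel) = indicator {0<..} v *\<^sub>R (of_real (v powr (w - 1) * exp (-(e * v))) * cairy 1 v)" for v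
  proof -
    have "(\<integral>y. ?f y v \<partial>lborel) = of_real (k v) * (\<integral>y. exp (-(\<i> * of_real (y * v))) * g y \<partial>lborel)" by simp
    also have "(\<integral>y. exp (-(\<i> * of_real (y * v))) * g y \<partial>lborel) = cairy 1 v"
      unfolding cairy_def g_def by (rule Bochner_Integration.integral_cong) auto
    finally show ?thesis by (simp add: k_def scaleR_conv_of_real)
  qed
  have outer: "(\<integral>v. ?f y v \<partial>lborel) = of_real (Gamma w) * (indicator {0<..} y *\<^sub>R ((of_real e + \<i> * of_real y) powr (- of_real w) * weight 1 y))" for y
  proof -
    have "(\<integral>v. ?f y v \<partial>lborel) = (\<integral>v. g y * (indicator {0<..} v *\<^sub>R (of_real (v powr (w - 1)) * exp (-((of_real e + \<i> * of_real y) * of_real (v powr 1))))) \<partial>lborel)"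
    proof (rule Bochner_Integration.integral_cong)
      fix v :: real
      have "exp (-((of_real e + \<i> * of_real y) * of_real v)) = of_real (exp (-(e * v))) * exp (-(\<i> * of_real (y * v)))"
        unfolding exp_of_real[symmetric] exp_add[symmetric] by (simp add: algebra_simps)
      then show "?f y v = g y * (indicator {0<..} v *\<^sub>R (of_real (v powr (w - 1)) * exp (-((of_real e + \<i> * of_real y) * of_real (v powr 1)))))"
        by (cases "v > 0") (simp_all add: k_def)
    qed simp
    also have "\<dots> = g y * (of_real (Gamma (w / 1) / 1) * (of_real e + \<i> * of_real y) powr (- of_real (w / 1)))"
      using has_bochner_integral_powr_cexp[of 1 w "of_real e + \<i> * of_real y"] w e
      by (simp only: integral_mult_right_zero) (simp add: has_bochner_integral_iff)
    finally show ?thesis by (simp add: g_def scaleR_conv_of_real)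
  qed
  have "integrable lborel (\<lambda>v. \<integral>y. ?f y v \<partial>lborel)"
    using lborel_pair.integrable_snd[OF i] by simp
  moreover have "(\<integral>v. \<integral>y. ?f y v \<partial>lborel \<partial>lborel) = (\<integral>y. \<integral>v. ?f y v \<partial>lborel \<partial>lborel)"
    by (rule lborel_pair.Fubini_integral[OF i])
  ultimately show ?thesis
    unfolding inner outer by (simp only: has_bochner_integral_iff integral_mult_right_zero)
qed

text \<open>Integrating the power \<open>v powr (w - 1)\<close> against the oscillating exponential
  gives \<open>Gamma w\<close> times the power of \<open>\<i> * y\<close> of exponent
  \<open>- w\<close>. The remaining factors are \<open>weight_Mellin\<close> at
  \<open>c = 1 - w\<close>, and the sine collects both phases.\<close>

definition airy_Mellin :: "real \<Rightarrow> real" where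
  "airy_Mellin w = Gamma w * (Gamma ((1 - w) / (\<alpha> + 1)) / (\<alpha> + 1) * (\<alpha> + 1) powr ((1 - w) / (\<alpha> + 1)) * sin (pi * (1 - w) / (\<alpha> + 1)))"

text \<open>The regularization is removed differently on the two sides. In the space variable
  monotone convergence applies since \<open>airy 1\<close> is nonnegative, and it yields
  integrability as well. In the Fourier variable the domination by \<open>y powr (- w)\<close> uses
  that adding a positive real part to \<open>\<i> * y\<close> increases the modulus; integrability
  at 0 requires \<open>w < 1\<close>.\<close>

lemma airy_Mellin:
  assumes w: "0 < w" "w < 1" and nonneg: "\<And>v. v > 0 \<Longrightarrow> airy 1 v \<ge> 0"
  shows "has_bochner_integral lborel (\<lambda>v. indicator {0<..} v * (v powr (w - 1) * airy 1 v)) (airy_Mellin w)"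
proof -
  let ?I = "\<lambda>y. indicator {0<..} y *\<^sub>R ((\<i> * of_real y) powr (- of_real w) * weight 1 y)"
  let ?e = "\<lambda>n. 1 / real (Suc n)"
  let ?z = "\<lambda>n y. of_real (?e n) + \<i> * of_real y"
  have e0: "?e \<longlonglongrightarrow> 0" using LIMSEQ_inverse_real_of_nat by (simp add: inverse_eq_divide)
  define F where "F n v = indicator {0<..} v * (v powr (w - 1) * exp (-(?e n * v)) * airy 1 v)" for n v
  define I where "I n = (\<integral>y. indicator {0<..} y *\<^sub>R (?z n y powr (- of_real w) * weight 1 y) \<partial>lborel)" for n
  have F: "has_bochner_integral lborel (F n) (Gamma w * Re (I n))" for n
  proof -
    have "has_bochner_integral lborel (\<lambda>v. Re (indicator {0<..} v *\<^sub>R (of_real (v powr (w - 1) * exp (-(?e n * v))) * cairy 1 v)))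
       (Re (of_real (Gamma w) * I n))"
      unfolding I_def by (intro has_bochner_integral_Re cairy_Mellin_regularized w) simp
    moreover have "Re (indicator {0<..} v *\<^sub>R (of_real (v powr (w - 1) * exp (-(?e n * v))) * cairy 1 v)) = F n v" for v
      by (simp add: F_def airy_def)
    ultimately show ?thesis by simp
  qed
  have I_lim: "I \<longlonglongrightarrow> (\<integral>y. ?I y \<partial>lborel)"
    unfolding I_def
  proof (rule integral_dominated_convergence[where w = "\<lambda>y. indicator {0<..} y * (y powr ((1 - w) - 1) * norm (weight 1 y))"])
    show "integrable lborel (\<lambda>y. indicator {0<..} y * (y powr ((1 - w) - 1) * norm (weight 1 y)))"
      by (rule integrable_powr_weight) (use w in auto)
    show "AE y in lborel. (\<lambda>n. indicator {0<..} y *\<^sub>R (?z n y powr (- of_real w) * weight 1 y)) \<longlonglongrightarrow>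
        ?I y"
    proof (intro AE_I2)
      fix y :: real
      show "(\<lambda>n. indicator {0<..} y *\<^sub>R (?z n y powr (- of_real w) * weight 1 y)) \<longlonglongrightarrow>
        ?I y"
      proof (cases "y > 0")
        case True
        have "(\<lambda>n. ?z n y) \<longlonglongrightarrow> of_real 0 + \<i> * of_real y"
          by (intro tendsto_intros e0)
        then have "(\<lambda>n. ?z n y) \<longlonglongrightarrow> \<i> * of_real y" by (simp only: of_real_0 add_0)
        moreover have "\<i> * complex_of_real y \<notin> \<real>\<^sub>\<le>\<^sub>0" using True by (auto simp: complex_nonpos_Reals_iff)
        ultimately have "(\<lambda>n. ?z n y powr (- of_real w)) \<longlonglongrightarrow> (\<i> * of_real y) powr (- of_real w)"
          by (intro tendsto_powr_complex tendsto_const)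
        then show ?thesis by (intro tendsto_scaleR tendsto_mult tendsto_const)
      qed simp
    qed
    show "AE y in lborel. norm (indicator {0<..} y *\<^sub>R (?z n y powr (- of_real w) * weight 1 y)) \<le>
        indicator {0<..} y * (y powr ((1 - w) - 1) * norm (weight 1 y))" for n
    proof (intro AE_I2)
      fix y :: real
      show "norm (indicator {0<..} y *\<^sub>R (?z n y powr (- of_real w) * weight 1 y)) \<le>
        indicator {0<..} y * (y powr ((1 - w) - 1) * norm (weight 1 y))"
      proof (cases "y > 0")
        case True
        have "Im (?z n y) = y" by simp
        then have ny: "y \<le> norm (?z n y)" using abs_Im_le_cmod[of "?z n y"] True by linarith
        have "?z n y \<noteq> 0" using True by (auto simp: complex_eq_iff)
        from norm_powr_of_real[OF this, of "- w"]
        have "norm (?z n y powr (- of_real w)) = norm (?z n y) powr (- w)" by simp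
        also have "\<dots> \<le> y powr (- w)" using ny True w by (intro powr_mono2') auto
        finally have "norm (?z n y powr (- of_real w)) * norm (weight 1 y) \<le> y powr (- w) * norm (weight 1 y)"
          by (rule mult_right_mono) simp
        then show ?thesis using True by (simp add: norm_mult)
      qed simp
    qed
  qed measurable
  have I_val: "(\<integral>y. ?I y \<partial>lborel) =
      cis (- (w * (pi / 2))) * (of_real (Gamma ((1 - w) / (\<alpha> + 1)) / (\<alpha> + 1) * (1 * (\<alpha> + 1)) powr ((1 - w) / (\<alpha> + 1))) *
      cis (- ((1 - w) / (\<alpha> + 1) * (pi * (\<alpha> - 1) / 2))))"
  proof -
    have I_eq: "?I y =
        cis (- (w * (pi / 2))) * (indicator {0<..} y *\<^sub>R (of_real (y powr ((1 - w) - 1)) * weight 1 y))" for y :: real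
    proof (cases "y > 0")
      case True
      from powr_of_real_cis[OF this, of "pi / 2" "- w"] pi_gt_zero
      have "(of_real y * cis (pi / 2)) powr of_real (- w) = of_real (y powr (- w)) * cis (- w * (pi / 2))" by simp
      then show ?thesis using True by (simp add: mult.commute mult.left_commute)
    qed simp
    then have "(\<integral>y. ?I y \<partial>lborel) =
        (\<integral>y. cis (- (w * (pi / 2))) * (indicator {0<..} y *\<^sub>R (of_real (y powr ((1 - w) - 1)) * weight 1 y)) \<partial>lborel)"
      by (simp only:)
    also have "\<dots> = cis (- (w * (pi / 2))) * (\<integral>y. indicator {0<..} y *\<^sub>R (of_real (y powr ((1 - w) - 1)) * weight 1 y) \<partial>lborel)"
      by (rule integral_mult_right_zero)
    also have "(\<integral>y. indicator {0<..} y *\<^sub>R (of_real (y powr ((1 - w) - 1)) * weight 1 y) \<partial>lborel) =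
      of_real (Gamma ((1 - w) / (\<alpha> + 1)) / (\<alpha> + 1) * (1 * (\<alpha> + 1)) powr ((1 - w) / (\<alpha> + 1))) *
      cis (- ((1 - w) / (\<alpha> + 1) * (pi * (\<alpha> - 1) / 2)))"
      by (rule has_bochner_integral_integral_eq[OF weight_Mellin]) (use w in auto)
    finally show ?thesis .
  qed
  have Re_val: "Gamma w * Re (\<integral>y. ?I y \<partial>lborel) = airy_Mellin w"
  proof -
    \<comment> \<open>Sum of the phase of the power of \<open>\<i> * y\<close> and the phase from
      \<open>weight_Mellin\<close>. Its distance from pi/2 turns the cosine into the sine of
      \<open>airy_Mellin\<close>.\<close>
    have "w * (pi / 2) + (1 - w) / (\<alpha> + 1) * (pi * (\<alpha> - 1) / 2) = pi / 2 - pi * (1 - w) / (\<alpha> + 1)"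
      using \<alpha> by (simp add: field_simps)
    then have "cos (w * (pi / 2) + (1 - w) / (\<alpha> + 1) * (pi * (\<alpha> - 1) / 2)) = sin (pi * (1 - w) / (\<alpha> + 1))"
      by (simp add: sin_cos_eq)
    moreover have "Re (cis (- s) * (of_real r * cis (- t))) = r * cos (s + t)" for r s t :: real
      by (simp add: cos_add algebra_simps)
    ultimately show ?thesis by (simp only: I_val airy_Mellin_def mult_1)
  qed
  show ?thesis
  proof (rule has_bochner_integral_monotone_convergence[where f = F])
    show "integrable lborel (F n)" for n using F by (simp add: has_bochner_integral_iff)
    show "AE v in lborel. mono (\<lambda>n. F n v)"
    proof (intro AE_I2 monoI)
      fix v :: real and m n :: nat assume mn: "m \<le> n"
      show "F m v \<le> F n v"
      proof (cases "v > 0")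
        case True
        have "?e n \<le> ?e m" using mn by (simp add: frac_le)
        then have "?e n * v \<le> ?e m * v" using True by (intro mult_right_mono) auto
        then have "exp (-(?e m * v)) \<le> exp (-(?e n * v))" by (simp only: exp_le_cancel_iff neg_le_iff_le)
        then show ?thesis unfolding F_def
          by (intro mult_left_mono mult_right_mono nonneg True) auto
      qed (simp add: F_def)
    qed
    show "AE v in lborel. (\<lambda>n. F n v) \<longlonglongrightarrow> indicator {0<..} v * (v powr (w - 1) * airy 1 v)"
    proof (intro AE_I2)
      fix v :: real
      have "(\<lambda>n. indicator {0<..} v * (v powr (w - 1) * exp (-(?e n * v)) * airy 1 v)) \<longlonglongrightarrow>
         indicator {0<..} v * (v powr (w - 1) * exp (-(0 * v)) * airy 1 v)"
        by (intro tendsto_mult tendsto_exp tendsto_minus tendsto_const e0)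
      then show "(\<lambda>n. F n v) \<longlonglongrightarrow> indicator {0<..} v * (v powr (w - 1) * airy 1 v)" by (simp add: F_def)
    qed
    have "(\<lambda>n. Gamma w * Re (I n)) \<longlonglongrightarrow> airy_Mellin w"
      unfolding Re_val[symmetric] by (intro tendsto_mult tendsto_const tendsto_Re I_lim)
    then show "(\<lambda>n. integral\<^sup>L lborel (F n)) \<longlonglongrightarrow> airy_Mellin w"
      using F by (simp add: has_bochner_integral_iff)
    show "(\<lambda>v. indicator {0<..} v * (v powr (w - 1) * airy 1 v)) \<in> borel_measurable lborel"
      using airy_measurable[of 1] by measurable
  qed
qed

end

text \<open>For fixed \<open>w\<close>, the integral of
  \<open>v powr (c - 1) * exp (-(Y w * v powr a))\<close> over \<open>v > 0\<close> is
  \<open>Y w powr (-(c / a))\<close> up to a Gamma factor. Tonelli exchanges it with the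
  expectation, so finiteness of the moment is a conclusion. The exponent \<open>a\<close>
  accommodates the scaling q = v^(\<alpha>+1) of the area; the stable variable uses
  \<open>a = 1\<close>.\<close>

lemma moment_from_laplace:
  fixes Y :: "'a \<Rightarrow> real"
  assumes "prob_space M" and Y[measurable]: "Y \<in> borel_measurable M" and pos: "AE w in M. Y w > 0"
    and a: "a > 0" and c: "c > 0"
    and \<phi>: "\<And>v. v > 0 \<Longrightarrow> (\<integral>w. exp (-(v powr a * Y w)) \<partial>M) = \<phi> v"
    and m: "has_bochner_integral lborel (\<lambda>v. indicator {0<..} v * (v powr (c - 1) * \<phi> v)) m"
  shows "has_bochner_integral M (\<lambda>w. Y w powr (-(c / a))) (m * a / Gamma (c / a))"
proof -
  interpret prob_space M by fact
  interpret P: pair_sigma_finite M lborel ..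
  let ?K = "Gamma (c / a) / a"
  have K: "?K > 0" using a c by (simp add: Gamma_real_pos)
  have \<phi>_i: "integrable M (\<lambda>w. exp (-(v powr a * Y w)))" for v
  proof (rule integrable_const_bound[where B = 1])
    show "AE w in M. norm (exp (-(v powr a * Y w))) \<le> 1" using pos by eventually_elim simp
  qed simp
  have \<phi>0: "\<phi> v \<ge> 0" if "v > 0" for v
    unfolding \<phi>[OF that, symmetric] by (intro Bochner_Integration.integral_nonneg) simp
  have "(\<integral>\<^sup>+w. ennreal (?K * Y w powr (-(c / a))) \<partial>M) =
      (\<integral>\<^sup>+w. (\<integral>\<^sup>+v. ennreal (indicator {0<..} v * (v powr (c - 1) * exp (-(Y w * v powr a)))) \<partial>lborel) \<partial>M)"
  proof (rule nn_integral_cong_AE)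
    show "AE w in M. ennreal (?K * Y w powr (-(c / a))) =
        (\<integral>\<^sup>+v. ennreal (indicator {0<..} v * (v powr (c - 1) * exp (-(Y w * v powr a)))) \<partial>lborel)"
      using pos
    proof eventually_elim
      case (elim w)
      from has_bochner_integral_powr_exp[OF a c elim] show ?case
        by (subst nn_integral_eq_integral) (auto simp: has_bochner_integral_iff)
    qed
  qed
  also have "\<dots> = (\<integral>\<^sup>+v. (\<integral>\<^sup>+w. ennreal (indicator {0<..} v * (v powr (c - 1) * exp (-(Y w * v powr a)))) \<partial>M) \<partial>lborel)"
    by (rule P.Fubini'[symmetric]) measurable
  also have "\<dots> = (\<integral>\<^sup>+v. ennreal (indicator {0<..} v * (v powr (c - 1) * \<phi> v)) \<partial>lborel)"
  proof (rule nn_integral_cong)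
    fix v :: real
    show "(\<integral>\<^sup>+w. ennreal (indicator {0<..} v * (v powr (c - 1) * exp (-(Y w * v powr a)))) \<partial>M) =
        ennreal (indicator {0<..} v * (v powr (c - 1) * \<phi> v))"
    proof (cases "v > 0")
      case True
      have "(\<integral>\<^sup>+w. ennreal (v powr (c - 1) * exp (-(v powr a * Y w))) \<partial>M) =
          ennreal (\<integral>w. v powr (c - 1) * exp (-(v powr a * Y w)) \<partial>M)"
        by (intro nn_integral_eq_integral integrable_mult_right \<phi>_i) simp
      also have "(\<integral>w. v powr (c - 1) * exp (-(v powr a * Y w)) \<partial>M) = v powr (c - 1) * \<phi> v"
        by (simp only: integral_mult_right_zero \<phi>[OF True])
      finally show ?thesis using True by (simp add: mult.commute)
    qed simp
  qed
  also have "\<dots> = ennreal m"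
    using m \<phi>0 by (subst nn_integral_eq_integral) (auto simp: has_bochner_integral_iff indicator_def)
  finally have nn: "(\<integral>\<^sup>+w. ennreal (?K * Y w powr (-(c / a))) \<partial>M) = ennreal m" .
  have "m \<ge> 0"
  proof -
    have "m = (\<integral>v. indicator {0<..} v * (v powr (c - 1) * \<phi> v) \<partial>lborel)" using m by (simp add: has_bochner_integral_iff)
    also have "\<dots> \<ge> 0" using \<phi>0 by (intro Bochner_Integration.integral_nonneg) (auto simp: indicator_def)
    finally show ?thesis .
  qed
  then have hb: "has_bochner_integral M (\<lambda>w. ?K * Y w powr (-(c / a))) m"
  proof (intro has_bochner_integral_nn_integral nn)
    show "AE w in M. 0 \<le> ?K * Y w powr (-(c / a))"
      by (intro AE_I2 mult_nonneg_nonneg less_imp_le[OF K] powr_ge_zero)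
  qed auto
  have "has_bochner_integral M (\<lambda>w. 1 / ?K * (?K * Y w powr (-(c / a)))) (1 / ?K * m)"
    by (rule has_bochner_integral_mult_right[OF hb])
  moreover have "1 / ?K * (?K * y) = y" for y using K by (metis divide_self_if mult.assoc mult_1 order_less_irrefl times_divide_eq_left)
  moreover have "1 / ?K * m = m * a / Gamma (c / a)" by simp
  ultimately show ?thesis by (simp only:)
qed

context stable_index
begin

text \<open>The probability of \<open>Y w = 0\<close> is bounded by the Laplace transform at every
  argument, which tends to 0 by \<open>airy_decay\<close>. The nonnegativity of
  \<open>airy 1\<close> required for its Mellin transform comes from the same Laplace
  representation.\<close>

lemma area_moment:
  assumes M: "prob_space M" and Y[measurable]: "Y \<in> borel_measurable M" and Y0: "AE w in M. 0 \<le> Y w"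
    and lt: "\<And>q. q > 0 \<Longrightarrow> (\<integral>w. exp (-(q * Y w)) \<partial>M) = airy q 1 / airy q 0"
  shows area_pos: "AE w in M. 0 < Y w"
    and "0 < c \<Longrightarrow> c < 1 \<Longrightarrow> has_bochner_integral M (\<lambda>w. Y w powr (-(c / (\<alpha> + 1))))
      (airy_Mellin c / airy 1 0 * (\<alpha> + 1) / Gamma (c / (\<alpha> + 1)))"
proof -
  interpret prob_space M by fact
  have a: "\<alpha> + 1 > 0" using \<alpha> by simp
  have h0: "airy 1 0 > 0" by (rule airy_0_pos) simp
  have phi: "(\<integral>w. exp (-(v powr (\<alpha> + 1) * Y w)) \<partial>M) = airy 1 v / airy 1 0" if v: "v > 0" for v
  proof -
    have q: "v powr (\<alpha> + 1) > 0" using v by simp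
    have "(v powr (\<alpha> + 1)) powr (1 / (\<alpha> + 1)) = v" using v a by (simp add: powr_powr)
    then show ?thesis using lt[OF q] airy_scaling[OF q, of 0] airy_scaling[OF q, of 1] v by simp
  qed
  have i: "integrable M (\<lambda>w. exp (-(q * Y w)))" if "q > 0" for q
  proof (rule integrable_const_bound[where B = 1])
    show "AE w in M. norm (exp (-(q * Y w))) \<le> 1" using Y0 by eventually_elim (use that in simp)
  qed simp
  have "prob {w \<in> space M. Y w = 0} \<le> airy_decay 1 / airy 1 0 * (1 / real (Suc n))" for n
  proof -
    let ?v = "real (Suc n)"
    have "prob {w \<in> space M. Y w = 0} = (\<integral>w. indicator {w \<in> space M. Y w = 0} w \<partial>M)" by simp
    also have "\<dots> \<le> (\<integral>w. exp (-(?v powr (\<alpha> + 1) * Y w)) \<partial>M)"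
    proof (rule integral_mono)
      show "integrable M (indicator {w \<in> space M. Y w = 0} :: 'a \<Rightarrow> real)"
        by (rule integrable_real_indicator) (auto simp: emeasure_eq_measure)
    qed (auto intro!: i simp: indicator_def simp del: of_nat_Suc)
    also have "\<dots> = airy 1 ?v / airy 1 0" by (rule phi) simp
    also have "airy 1 ?v \<le> airy_decay 1 * (1 / ?v)"
      using airy_decay[of 1 ?v] by (simp add: abs_mult field_simps)
    finally show ?thesis using h0 by (simp add: divide_right_mono mult.commute)
  qed
  moreover have "(\<lambda>n. airy_decay 1 / airy 1 0 * (1 / real (Suc n))) \<longlonglongrightarrow> 0"
    using tendsto_mult[OF tendsto_const LIMSEQ_inverse_real_of_nat, of "airy_decay 1 / airy 1 0"]
    unfolding inverse_eq_divide mult_zero_right .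
  ultimately have "prob {w \<in> space M. Y w = 0} \<le> 0"
    by (intro tendsto_lowerbound[where F = sequentially]) auto
  then have "prob {w \<in> space M. Y w = 0} = 0" by (simp add: measure_le_0_iff)
  then have "AE w in M. \<not> Y w = 0"
    by (subst AE_iff_measurable[OF _ refl]) (auto simp: emeasure_eq_measure)
  then show pos: "AE w in M. 0 < Y w" using Y0 by eventually_elim simp
  assume c: "0 < c" "c < 1"
  have nonneg: "airy 1 v \<ge> 0" if "v > 0" for v
  proof -
    have "0 \<le> (\<integral>w. exp (-(v powr (\<alpha> + 1) * Y w)) \<partial>M)" by (intro Bochner_Integration.integral_nonneg) simp
    then show ?thesis using h0 by (simp add: phi[OF that] zero_le_divide_iff)
  qed
  have "has_bochner_integral lborel (\<lambda>v. indicator {0<..} v * (v powr (c - 1) * airy 1 v) / airy 1 0) (airy_Mellin c / airy 1 0)"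
    by (rule has_bochner_integral_divide_zero[OF airy_Mellin[OF c nonneg]])
  then have "has_bochner_integral lborel (\<lambda>v. indicator {0<..} v * (v powr (c - 1) * (airy 1 v / airy 1 0))) (airy_Mellin c / airy 1 0)"
    by simp
  from moment_from_laplace[OF M Y pos a c(1) phi this]
  show "has_bochner_integral M (\<lambda>w. Y w powr (-(c / (\<alpha> + 1))))
      (airy_Mellin c / airy 1 0 * (\<alpha> + 1) / Gamma (c / (\<alpha> + 1)))" .
qed

end

section \<open>Moments of the stable and Beta variables\<close>

lemma positive_stable_moment:
  assumes N: "prob_space N" and Z: "positive_stable_rv b N Z" and b: "b > 0" and c: "c > 0"
  shows "has_bochner_integral N (\<lambda>w. Z w powr (- c)) (Gamma (c / b) / b / Gamma c)"
proof -
  have Zm: "Z \<in> borel_measurable N" and pos: "AE w in N. Z w > 0"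
    and lt: "\<And>u. u \<ge> 0 \<Longrightarrow> (\<integral>w. exp (- u * Z w) \<partial>N) = exp (-(u powr b))"
    using Z by (auto simp: positive_stable_rv_def)
  have "has_bochner_integral lborel (\<lambda>v. indicator {0<..} v * (v powr (c - 1) * exp (-(v powr b)))) (Gamma (c / b) / b)"
    using has_bochner_integral_powr_exp[OF b c zero_less_one] by simp
  moreover have "(\<integral>w. exp (-(v powr 1 * Z w)) \<partial>N) = exp (-(v powr b))" if "v > 0" for v
    using lt[of v] that by simp
  ultimately have "has_bochner_integral N (\<lambda>w. Z w powr (-(c / 1))) (Gamma (c / b) / b * 1 / Gamma (c / 1))"
    by (intro moment_from_laplace[OF N Zm pos zero_less_one c, of "\<lambda>v. exp (-(v powr b))"])
  then show ?thesis by simp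
qed

lemma beta_density_nonneg: "a > 0 \<Longrightarrow> b > 0 \<Longrightarrow> beta_density a b x \<ge> 0"
  unfolding beta_density_def by (auto intro!: mult_nonneg_nonneg divide_nonneg_nonneg simp: indicator_def Gamma_real_nonneg)

lemma beta_rv_range:
  assumes B: "beta_rv a b N B"
  shows "AE w in N. 0 < B w \<and> B w < 1"
proof -
  have d: "distributed N lborel B (\<lambda>x. ennreal (beta_density a b x))" using B by (simp add: beta_rv_def)
  have Bm: "B \<in> borel_measurable N" using distributed_measurable[OF d] by simp
  have "emeasure N (B -` (- {0<..<1}) \<inter> space N) = (\<integral>\<^sup>+x. ennreal (beta_density a b x) * indicator (- {0<..<1}) x \<partial>lborel)"
    by (rule distributed_emeasure[OF d]) auto
  also have "\<dots> = (\<integral>\<^sup>+x. 0 \<partial>(lborel :: real measure))"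
    by (rule nn_integral_cong) (auto simp: beta_density_def indicator_def)
  finally have "emeasure N (B -` (- {0<..<1}) \<inter> space N) = 0" by simp
  then show ?thesis
    using Bm by (subst AE_iff_measurable[where N = "B -` (- {0<..<1}) \<inter> space N"]) auto
qed

lemma beta_moment:
  assumes B: "beta_rv a b N B" and ab: "a > 0" "b > 0" and s: "s \<ge> 0"
  shows "has_bochner_integral N (\<lambda>w. B w powr s) (Gamma (a + b) / (Gamma a * Gamma b) * Beta (a + s) b)"
proof (rule has_bochner_integral_nn_integral)
  have d: "distributed N lborel B (\<lambda>x. ennreal (beta_density a b x))" using B by (simp add: beta_rv_def)
  have Bm[measurable]: "B \<in> borel_measurable N" using distributed_measurable[OF d] by simp
  let ?C = "Gamma (a + b) / (Gamma a * Gamma b)"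
  have C: "?C \<ge> 0" using ab by (auto intro!: divide_nonneg_nonneg mult_nonneg_nonneg simp: Gamma_real_nonneg)
  show "(\<lambda>w. B w powr s) \<in> borel_measurable N" by measurable
  have I: "((\<lambda>t. ?C * (t powr (a + s - 1) * (1 - t) powr (b - 1))) has_integral ?C * Beta (a + s) b) {0<..<1}"
    using has_integral_Beta_real[of "a + s" b] ab s
    by (intro has_integral_mult_right) (simp add: has_integral_Icc_iff_Ioo)
  have "(\<integral>\<^sup>+w. ennreal (B w powr s) \<partial>N) = (\<integral>\<^sup>+x. ennreal (beta_density a b x) * ennreal (x powr s) \<partial>lborel)"
    by (rule distributed_nn_integral[OF d, symmetric]) measurable
  also have "\<dots> = (\<integral>\<^sup>+x. ennreal (indicator {0<..<1} x * (?C * (x powr (a + s - 1) * (1 - x) powr (b - 1)))) \<partial>lborel)"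
  proof (rule nn_integral_cong)
    fix x :: real
    have "beta_density a b x * x powr s = indicator {0<..<1} x * (?C * (x powr (a + s - 1) * (1 - x) powr (b - 1)))"
    proof (cases "x \<in> {0<..<1}")
      case True
      have "x powr (a + s - 1) = x powr (a - 1) * x powr s" by (simp add: powr_add[symmetric] algebra_simps)
      then show ?thesis using True by (simp add: beta_density_def)
    qed (simp add: beta_density_def)
    then show "ennreal (beta_density a b x) * ennreal (x powr s) =
        ennreal (indicator {0<..<1} x * (?C * (x powr (a + s - 1) * (1 - x) powr (b - 1))))"
      using beta_density_nonneg[OF ab, of x] by (simp add: ennreal_mult[symmetric])
  qed
  also have "\<dots> = ennreal (?C * Beta (a + s) b)"
    by (rule nn_integral_has_integral_lebesgue[OF _ I]) (intro mult_nonneg_nonneg C powr_ge_zero)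
  finally show "(\<integral>\<^sup>+w. ennreal (B w powr s) \<partial>N) = ennreal (?C * Beta (a + s) b)" .
  show "0 \<le> ?C * Beta (a + s) b"
    using C ab s by (intro mult_nonneg_nonneg) (auto simp: Beta_def intro!: divide_nonneg_nonneg mult_nonneg_nonneg Gamma_real_nonneg)
qed simp

text \<open>The moment of order \<open>- s\<close> of the right-hand side: the scalar factor, the
  moment of order \<open>- 2 * s\<close> of the stable variable, and the moment of order
  \<open>s\<close> of the Beta variable, which enters inverted.\<close>

definition stable_beta_const :: "real \<Rightarrow> real \<Rightarrow> real" where
  "stable_beta_const \<alpha> s = ((\<alpha> + 1) / 4) powr (- s) * (Gamma (2 * s / (2 / (\<alpha> + 1))) / (2 / (\<alpha> + 1)) / Gamma (2 * s) *
        (Gamma (1 / 2 + (\<alpha> - 1) / (2 * (\<alpha> + 1))) / (Gamma (1 / 2) * Gamma ((\<alpha> - 1) / (2 * (\<alpha> + 1)))) *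
          Beta (1 / 2 + s) ((\<alpha> - 1) / (2 * (\<alpha> + 1)))))"

lemma stable_beta_moment:
  assumes N: "prob_space N" and \<alpha>: "1 < \<alpha>" "\<alpha> < 2" and Z: "positive_stable_rv (2 / (\<alpha> + 1)) N Z"
    and B: "beta_rv (1 / 2) ((\<alpha> - 1) / (2 * (\<alpha> + 1))) N B" and ind: "prob_space.indep_var N borel Z borel B"
    and s: "s > 0"
  defines "W \<equiv> \<lambda>w. (\<alpha> + 1) / 4 * (Z w)\<^sup>2 * inverse (B w)"
  shows "W \<in> borel_measurable N" and "AE w in N. W w > 0"
    and "has_bochner_integral N (\<lambda>w. W w powr (- s))
      (stable_beta_const \<alpha> s)"
proof -
  interpret prob_space N by fact
  have Zm[measurable]: "Z \<in> borel_measurable N" and Zpos: "AE w in N. Z w > 0"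
    using Z by (auto simp: positive_stable_rv_def)
  have Bm[measurable]: "B \<in> borel_measurable N" using B distributed_measurable unfolding beta_rv_def by fastforce
  show Wm: "W \<in> borel_measurable N" unfolding W_def by measurable
  show "AE w in N. W w > 0"
    using Zpos beta_rv_range[OF B] by eventually_elim (use \<alpha> in \<open>simp add: W_def\<close>)
  have mZ: "has_bochner_integral N (\<lambda>w. Z w powr (- (2 * s))) (Gamma (2 * s / (2 / (\<alpha> + 1))) / (2 / (\<alpha> + 1)) / Gamma (2 * s))"
    by (rule positive_stable_moment[OF N Z]) (use \<alpha> s in auto)
  have mB: "has_bochner_integral N (\<lambda>w. B w powr s)
      (Gamma (1 / 2 + (\<alpha> - 1) / (2 * (\<alpha> + 1))) / (Gamma (1 / 2) * Gamma ((\<alpha> - 1) / (2 * (\<alpha> + 1)))) *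
          Beta (1 / 2 + s) ((\<alpha> - 1) / (2 * (\<alpha> + 1))))"
    by (rule beta_moment[OF B]) (use \<alpha> s in auto)
  have "indep_var borel ((\<lambda>z. z powr (- (2 * s))) \<circ> Z) borel ((\<lambda>b. b powr s) \<circ> B)"
    by (rule indep_var_compose[OF ind]) auto
  then have iv: "indep_var borel (\<lambda>w. Z w powr (- (2 * s))) borel (\<lambda>w. B w powr s)" by (simp add: o_def)
  have ZB: "has_bochner_integral N (\<lambda>w. Z w powr (- (2 * s)) * B w powr s)
      (Gamma (2 * s / (2 / (\<alpha> + 1))) / (2 / (\<alpha> + 1)) / Gamma (2 * s) *
        (Gamma (1 / 2 + (\<alpha> - 1) / (2 * (\<alpha> + 1))) / (Gamma (1 / 2) * Gamma ((\<alpha> - 1) / (2 * (\<alpha> + 1)))) *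
          Beta (1 / 2 + s) ((\<alpha> - 1) / (2 * (\<alpha> + 1)))))"
  proof -
    note iZ = integrable.intros[OF mZ] and iB = integrable.intros[OF mB]
    show ?thesis
      unfolding has_bochner_integral_iff indep_var_lebesgue_integral[OF iv iZ iB]
        has_bochner_integral_integral_eq[OF mZ] has_bochner_integral_integral_eq[OF mB]
      by (intro conjI indep_var_integrable[OF iv iZ iB] refl)
  qed
  have "has_bochner_integral N (\<lambda>w. ((\<alpha> + 1) / 4) powr (- s) * (Z w powr (- (2 * s)) * B w powr s))
      (stable_beta_const \<alpha> s)"
    unfolding stable_beta_const_def
    by (rule has_bochner_integral_mult_right[OF ZB])
  also have "has_bochner_integral N (\<lambda>w. ((\<alpha> + 1) / 4) powr (- s) * (Z w powr (- (2 * s)) * B w powr s)) v \<longleftrightarrow>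
      has_bochner_integral N (\<lambda>w. W w powr (- s)) v" for v
  proof (rule has_bochner_integral_cong_AE)
    show "AE w in N. ((\<alpha> + 1) / 4) powr (- s) * (Z w powr (- (2 * s)) * B w powr s) = W w powr (- s)"
      using Zpos beta_rv_range[OF B]
    proof eventually_elim
      case (elim w)
      have "(Z w)\<^sup>2 powr (- s) = Z w powr (- (2 * s))"
        using elim by (simp add: powr_powr flip: powr_numeral)
      moreover have "(inverse (B w)) powr (- s) = B w powr s"
        using elim by (simp add: powr_minus inverse_powr)
      moreover have "((\<alpha> + 1) / 4 * (Z w)\<^sup>2 * inverse (B w)) powr (- s) =
          ((\<alpha> + 1) / 4 * (Z w)\<^sup>2) powr (- s) * inverse (B w) powr (- s)"
        by (rule powr_mult; use elim \<alpha> in simp)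
      moreover have "((\<alpha> + 1) / 4 * (Z w)\<^sup>2) powr (- s) = ((\<alpha> + 1) / 4) powr (- s) * (Z w)\<^sup>2 powr (- s)"
        by (rule powr_mult; use elim \<alpha> in simp)
      ultimately show ?case unfolding W_def by (simp only: mult.assoc)
    qed
  qed (use Wm in measurable)
  finally show "has_bochner_integral N (\<lambda>w. W w powr (- s))
      (stable_beta_const \<alpha> s)" .
qed

section \<open>Agreement of the two families of moments\<close>

lemma Gamma_duplication_real:
  fixes s :: real
  assumes s: "s > 0"
  shows "Gamma s * Gamma (s + 1 / 2) = 2 powr (1 - 2 * s) * sqrt pi * Gamma (2 * s)"
proof -
  have "Gamma (complex_of_real s) * Gamma (complex_of_real s + 1 / 2) =
      exp ((1 - 2 * complex_of_real s) * of_real (ln 2)) * of_real (sqrt pi) * Gamma (2 * complex_of_real s)"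
    by (rule Gamma_legendre_duplication) (use s in \<open>auto elim!: nonpos_Ints_cases simp: complex_eq_iff\<close>)
  moreover have "Gamma (complex_of_real s) = of_real (Gamma s)" by (rule Gamma_complex_of_real)
  moreover have "Gamma (complex_of_real s + 1 / 2) = of_real (Gamma (s + 1 / 2))"
    using Gamma_complex_of_real[of "s + 1 / 2"] by simp
  moreover have "Gamma (2 * complex_of_real s) = of_real (Gamma (2 * s))"
    using Gamma_complex_of_real[of "2 * s"] by simp
  moreover have "exp ((1 - 2 * complex_of_real s) * of_real (ln 2)) = of_real (2 powr (1 - 2 * s))"
    using exp_of_real[of "(1 - 2 * s) * ln 2"] by (simp add: powr_def)
  ultimately have "complex_of_real (Gamma s * Gamma (s + 1 / 2)) = of_real (2 powr (1 - 2 * s) * sqrt pi * Gamma (2 * s))"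
    by simp
  then show ?thesis by (simp only: of_real_eq_iff)
qed

text \<open>Reflection turns both products of a Gamma value and a sine into pi over a Gamma value,
  at \<open>1 - u\<close> and at \<open>1 - 1 / a\<close>. These are the two Gamma values left from
  the Beta moment, because its second parameter satisfies \<open>1 / 2 + b = 1 - 1 / a\<close>. What
  remains is \<open>Gamma s * Gamma (s + 1 / 2)\<close> against \<open>Gamma (2 * s)\<close>, that
  is, the duplication formula.\<close>

lemma (in stable_index) area_moment_eq:
  assumes s: "0 < s" "s < 1 / (\<alpha> + 1)"
  shows "airy_Mellin (s * (\<alpha> + 1)) / airy 1 0 * (\<alpha> + 1) / Gamma s =
    stable_beta_const \<alpha> s"
proof -
  define a where "a = \<alpha> + 1"
  \<comment> \<open>This is \<open>(1 - w) / a\<close> at \<open>w = s * a\<close>, the argument of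
    the second Gamma factor in \<open>airy_Mellin\<close>.\<close>
  define u where "u = 1 / a - s"
  define b where "b = (\<alpha> - 1) / (2 * (\<alpha> + 1))"
  have a: "a > 2" using \<alpha> by (simp add: a_def)
  have u: "0 < u" "u < 1"
  proof -
    show "0 < u" using s by (simp add: u_def a_def)
    have "1 / a < 1" using a by simp
    then show "u < 1" using s by (simp add: u_def)
  qed
  have b: "b > 0" using \<alpha> by (simp add: b_def)
  have half_b: "1 / 2 + b = 1 - 1 / a" using \<alpha> by (simp add: b_def a_def field_simps)
  have refl: "Gamma v * sin (pi * v) = pi / Gamma (1 - v)" if "0 < v" "v < 1" for v :: real
  proof -
    have "sin (pi * v) > 0" by (rule sin_gt_zero) (use that in auto)
    moreover have "Gamma (1 - v) > 0" using that by (intro Gamma_real_pos) auto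
    ultimately show ?thesis using Gamma_reflection_real[of v] by (simp add: field_simps)
  qed
  define G1 where "G1 = Gamma (1 - 1 / a)"
  define Gu where "Gu = Gamma (1 - u)"
  define Gs where "Gs = Gamma s"
  define Gh where "Gh = Gamma (s + 1 / 2)"
  define Gb where "Gb = Gamma b"
  define G2 where "G2 = Gamma (2 * s)"
  define A where "A = Gamma (a * s)"
  have "1 - 1 / a > 0" using a by simp
  then have pos: "G1 > 0" "Gu > 0" "Gs > 0" "Gh > 0" "Gb > 0" "G2 > 0"
    using u s b by (auto simp: G1_def Gu_def Gs_def Gh_def Gb_def G2_def intro!: Gamma_real_pos)
  have dup: "Gs * Gh = 2 powr (1 - 2 * s) * sqrt pi * G2"
    unfolding Gs_def Gh_def G2_def by (rule Gamma_duplication_real[OF s(1)])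
  have M: "airy_Mellin (s * (\<alpha> + 1)) = A * (a powr u / a * (pi / Gu))"
  proof -
    have 1: "(1 - s * a) / a = u" using a by (simp add: u_def field_simps)
    then have 2: "pi * (1 - s * a) / a = pi * u" by (simp flip: times_divide_eq_right)
    have "airy_Mellin (s * (\<alpha> + 1)) = A * (Gamma u / a * a powr u * sin (pi * u))"
      unfolding airy_Mellin_def a_def[symmetric] 1 2 A_def by (simp only: mult.commute[of s a])
    also have "\<dots> = A * (a powr u / a * (Gamma u * sin (pi * u)))" by simp
    finally show ?thesis unfolding refl[OF u] Gu_def .
  qed
  have Z: "airy 1 0 = a powr (1 / a) / a * (pi / G1)"
  proof -
    have 1: "Gamma (1 / a) * sin (pi * (1 / a)) = pi / Gamma (1 - 1 / a)" by (rule refl) (use a in auto)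
    have "airy 1 0 = a powr (1 / a) / a * (Gamma (1 / a) * sin (pi * (1 / a)))"
      unfolding airy_0[OF zero_less_one] a_def[symmetric] by simp
    then show ?thesis unfolding 1 G1_def .
  qed
  have "a powr u = a powr (1 / a) * a powr (- s)" by (simp add: u_def powr_diff powr_minus field_simps)
  then have L: "airy_Mellin (s * (\<alpha> + 1)) / airy 1 0 * (\<alpha> + 1) / Gamma s = A * a powr (- s) * G1 / Gu * a / Gs"
    unfolding a_def[symmetric] M[folded a_def] Z Gs_def[symmetric] using a pos by (simp add: field_simps)
  \<comment> \<open>The 4 in the scalar factor of the theorem compensates the power of 2 in the
    duplication formula.\<close>
  have four: "(a / 4) powr (- s) * 2 powr (1 - 2 * s) = 2 * a powr (- s)"
  proof -
    have "(4::real) powr s = (2 powr 2) powr s" by simp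
    also have "\<dots> = 2 powr (2 * s)" by (simp only: powr_powr)
    finally have "(4::real) powr s * 2 powr (1 - 2 * s) = 2" by (simp add: powr_add[symmetric])
    moreover have "(a / 4) powr (- s) = a powr (- s) * 4 powr s" using a by (simp add: powr_divide powr_minus field_simps)
    ultimately show ?thesis by simp
  qed
  have B: "Beta (1 / 2 + s) b = Gh * Gb / Gu"
  proof -
    have "1 / 2 + s + b = 1 - u" using half_b by (simp add: u_def)
    then show ?thesis by (simp add: Beta_def Gh_def Gb_def Gu_def add.commute)
  qed
  have "(a / 4) powr (- s) * (A / (2 / a) / G2 * (G1 / (sqrt pi * Gb) * (Gh * Gb / Gu))) =
      (a / 4) powr (- s) * 2 powr (1 - 2 * s) * A * a * G1 / (2 * Gu * Gs)"
  proof -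
    have "G2 = Gs * Gh / (2 powr (1 - 2 * s) * sqrt pi)" using dup by simp
    then show ?thesis using pos a by (simp add: field_simps)
  qed
  also have "\<dots> = A * a powr (- s) * G1 / Gu * a / Gs" unfolding four using pos by (simp add: field_simps)
  finally have "(a / 4) powr (- s) * (A / (2 / a) / G2 * (G1 / (sqrt pi * Gb) * (Gh * Gb / Gu))) =
      A * a powr (- s) * G1 / Gu * a / Gs" .
  moreover have "Gamma (2 * s / (2 / a)) = A" by (simp add: A_def mult.commute)
  ultimately show ?thesis
    unfolding stable_beta_const_def a_def[symmetric] L[folded a_def] b_def[symmetric, folded a_def] half_b B G1_def[symmetric] G2_def[symmetric] Gb_def[symmetric] Gamma_one_half_real
    by simp
qed

section \<open>The law under the completed measure and the conclusion\<close>

lemma (in prob_space) distr_completion_cong_AE: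
  fixes Y :: "'a \<Rightarrow> real"
  assumes Y: "Y \<in> borel_measurable M" and eq: "AE w in M. X w = Y w"
  shows "X \<in> borel_measurable (completion M)" and "distr (completion M) borel X = distr M borel Y"
proof -
  have Yc: "Y \<in> borel_measurable (completion M)" by (rule measurable_completion[OF Y])
  have eqc: "AE w in completion M. X w = Y w" by (rule AE_completion[OF eq])
  show Xc: "X \<in> borel_measurable (completion M)"
  proof (rule measurableI)
    fix S :: "real set" assume "S \<in> sets borel"
    then have A: "Y -` S \<inter> space (completion M) \<in> sets (completion M)" by (rule measurable_sets[OF Yc])
    have "AE w in completion M. w \<in> Y -` S \<inter> space (completion M) \<longleftrightarrow> w \<in> X -` S \<inter> space (completion M)"
      using eqc by eventually_elim auto
    from completion.in_sets_AE[OF this A] show "X -` S \<inter> space (completion M) \<in> sets (completion M)"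
      by auto
  qed simp
  have "distr (completion M) borel X = distr (completion M) borel Y"
    by (rule distr_cong_AE[OF refl refl eqc Xc Yc])
  then show "distr (completion M) borel X = distr M borel Y" by (simp add: distr_completion[OF Y])
qed

theorem mainTheorem1:
  fixes \<alpha> :: real
    and M :: "'a measure" and L :: "real \<Rightarrow> 'a \<Rightarrow> real"
    and N :: "'b measure" and Z B :: "'b \<Rightarrow> real"
  assumes "1 < \<alpha>" and "\<alpha> < 2"
    and "spectrally_positive_stable_levy \<alpha> M L 1"
    and "prob_space N"
    and "positive_stable_rv (2 / (\<alpha> + 1)) N Z"
    and "beta_rv (1 / 2) ((\<alpha> - 1) / (2 * (\<alpha> + 1))) N B"
    and "prob_space.indep_var N borel Z borel B"
  shows "eq_in_law (completion M) (\<lambda>\<omega>. area_until_zero (\<lambda>t. L t \<omega>))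
           N (\<lambda>\<omega>. (\<alpha> + 1) / 4 * (Z \<omega>)\<^sup>2 * inverse (B \<omega>))"
proof -
  let ?W = "\<lambda>w. (\<alpha> + 1) / 4 * (Z w)\<^sup>2 * inverse (B w)"
  interpret M: prob_space M
    using assms(3) by (simp add: spectrally_positive_stable_levy_def levy_process_def)
  interpret N: prob_space N by fact
  interpret stable_levy \<alpha> M L 1
    using assms(1-3) by unfold_locales
  obtain Y where Y: "Y \<in> borel_measurable M" "AE w in M. area_until_zero (\<lambda>t. L t w) = Y w" "AE w in M. 0 \<le> Y w"
    and lt: "\<And>q. q > 0 \<Longrightarrow> (\<integral>w. exp (-(q * Y w)) \<partial>M) = airy q 1 / airy q 0"
    by (rule laplace_area_until_zero[OF zero_less_one]) blast
  have Ypos: "AE w in M. 0 < Y w" by (rule area_pos[OF M.prob_space_axioms Y(1,3) lt])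
  note W = stable_beta_moment[OF assms(4,1,2,5,6,7)]
  have Wm: "?W \<in> borel_measurable N" and Wpos: "AE w in N. 0 < ?W w"
    using W(1,2)[OF zero_less_one] by auto
  \<comment> \<open>Moments of order \<open>- s\<close> are Laplace transforms of the logarithms at
    \<open>s\<close>. The interval for \<open>s\<close> is the one in which
    \<open>s * (\<alpha> + 1)\<close> lies in (0,1), where \<open>airy_Mellin\<close> holds; its
    midpoint serves as the tilt.\<close>
  have "distr M borel (\<lambda>w. ln (Y w)) = distr N borel (\<lambda>w. ln (?W w))"
  proof (rule distr_eqI_laplace[where I = "{0<..<1 / (\<alpha> + 1)}" and u = "1 / (2 * (\<alpha> + 1))"])
    fix s assume "s \<in> {0<..<1 / (\<alpha> + 1)}"
    then have s: "0 < s" "s < 1 / (\<alpha> + 1)" by auto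
    then have sw: "0 < s * (\<alpha> + 1)" "s * (\<alpha> + 1) < 1"
      using assms(1) by (simp_all add: less_divide_eq)
    let ?G = "airy_Mellin (s * (\<alpha> + 1)) / airy 1 0 * (\<alpha> + 1) / Gamma s"
    have powr_ln: "y powr (- s) = exp (-(s * ln y))" if "y > 0" for y :: real
      using that by (simp add: powr_def)
    have "has_bochner_integral M (\<lambda>w. Y w powr (- s)) ?G"
      using area_moment(2)[OF M.prob_space_axioms Y(1,3) lt sw] assms(1) by simp
    then show "has_bochner_integral M (\<lambda>w. exp (-(s * ln (Y w)))) ?G"
    proof (rule has_bochner_integral_cong_AE[THEN iffD1, rotated 3])
      show "AE w in M. Y w powr (- s) = exp (-(s * ln (Y w)))"
        using Ypos by eventually_elim (rule powr_ln)
    qed (use Y(1) in measurable)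
    have "has_bochner_integral N (\<lambda>w. ?W w powr (- s)) ?G"
      unfolding area_moment_eq[OF s] by (rule W(3)[OF s(1)])
    then show "has_bochner_integral N (\<lambda>w. exp (-(s * ln (?W w)))) ?G"
    proof (rule has_bochner_integral_cong_AE[THEN iffD1, rotated 3])
      show "AE w in N. ?W w powr (- s) = exp (-(s * ln (?W w)))"
        using Wpos by eventually_elim (rule powr_ln)
    qed (use Wm in measurable)
  qed (use assms(1,4) M.prob_space_axioms Y(1) Wm in \<open>auto simp: field_simps\<close>)
  \<comment> \<open>Both variables are positive almost everywhere, so pushing the laws forward by
    \<open>exp\<close> undoes the logarithms.\<close>
  then have "distr (distr M borel (\<lambda>w. ln (Y w))) borel exp = distr (distr N borel (\<lambda>w. ln (?W w))) borel exp"
    by (simp only:)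
  moreover have "distr (distr M borel (\<lambda>w. ln (Y w))) borel exp = distr M borel Y"
  proof (subst distr_distr)
    show "distr M borel (exp \<circ> (\<lambda>w. ln (Y w))) = distr M borel Y"
      by (rule distr_cong_AE) (use Ypos Y(1) in \<open>auto elim: eventually_mono\<close>)
  qed (use Y(1) in auto)
  moreover have "distr (distr N borel (\<lambda>w. ln (?W w))) borel exp = distr N borel ?W"
  proof (subst distr_distr)
    show "distr N borel (exp \<circ> (\<lambda>w. ln (?W w))) = distr N borel ?W"
    proof (rule distr_cong_AE)
      show "AE w in N. (exp \<circ> (\<lambda>w. ln (?W w))) w = ?W w"
        using Wpos by eventually_elim simp
    qed (use Wm in auto)
  qed (use Wm in auto)
  ultimately have "distr M borel Y = distr N borel ?W" by (simp only:)
  then show ?thesis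
    unfolding eq_in_law_def
    using M.distr_completion_cong_AE[OF Y(1,2)] Wm by simp
qed

end
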